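(* Let $(M,h)$ be a complete Kähler manifold of complex dimension $n$ with weight $e^{-\psi}$, where $\psi\colon M\to\mathbb{R}$ is smooth, and let $0\leqslant p\leqslant n-1$. Assume that $\partial_p$ is densely defined in the Bergman space $A^2_{(p,0)}(M,h,e^{-\psi})$. If the $(1,0)$-vector field $(\bar\partial\psi)^{\sharp}$ is holomorphic, then $$D^{\ast}\eta=\partial^{\ast}\eta$$ for all $\eta\in\operatorname{dom}(D^{\ast})\cap A^2_{(p+1,0)}(M,h,e^{-\psi})$. In particular, $D^{\ast}\eta$ is holomorphic for every holomorphic $\eta\in\operatorname{dom}(D^{\ast})$. Here $D^{\ast}$ is the Hilbert space adjoint of $D_p\colon L^2_{(p,0)}(M,h,e^{-\psi})\to L^2_{(p+1,0)}(M,h,e^{-\psi})$ and $\partial^{\ast}$ is the Hilbert space adjoint of $\partial_p\colon A^2_{(p,0)}(M,h,e^{-\psi})\to A^2_{(p+1,0)}(M,h,e^{-\psi})$.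
   Context: In local holomorphic coordinates $h=h_{j\bar k}\,dz^j\otimes d\bar z^k$; $d\mathrm{vol}_h=\det(h_{j\bar k})\,d\lambda$ with $d\lambda$ Lebesgue measure in the coordinates; $h$ induces a pointwise Hermitian inner product $\langle\cdot,\cdot\rangle_h$ on $(p,0)$-forms, with $\langle u,v\rangle_h=h^{j\bar k}u_j\overline{v_k}$ for $(1,0)$-forms, where $[h^{j\bar k}]$ is the transpose of the inverse of $[h_{j\bar k}]$ (so $h^{j\bar k}h_{l\bar k}=\delta^j_l$). $L^2_{(p,0)}(M,h,e^{-\psi})$ is the Hilbert space of $(p,0)$-forms $u$ with $\int_M|u|_h^2e^{-\psi}d\mathrm{vol}_h<\infty$, with inner product $(u,v)_{h,\psi}=\int_M\langle u,v\rangle_h e^{-\psi}d\mathrm{vol}_h$. A $(p,0)$-form is holomorphic if its coefficients in local holomorphic coordinates are holomorphic. $A^2_{(p,0)}(M,h,e^{-\psi})$ is the (closed) subspace of holomorphic forms in $L^2_{(p,0)}(M,h,e^{-\psi})$. $\partial u=\sum'_{|J|=p}\sum_j\frac{\partial u_J}{\partial z_j}dz^j\wedge dz^J$. The operator $\partial_p$ is $\partial$ with domain $\operatorname{dom}(\partial_p)=\{u\in A^2_{(p,0)}(M,h,e^{-\psi}):\partial u\in A^2_{(p+1,0)}(M,h,e^{-\psi})\}$. The operator $D_p$ is the maximal extension of $\partial$ in the sense of distributions: $\operatorname{dom}(D_p)=\{u\in L^2_{(p,0)}(M,h,e^{-\psi}):\partial u\in L^2_{(p+1,0)}(M,h,e^{-\psi})\}$.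 For a $(0,1)$-form $w=w_{\bar k}\,d\bar z^k$, $w^{\sharp}=h^{k\bar j}w_{\bar j}\,\partial_k$, a $(1,0)$-vector field; a $(1,0)$-vector field is holomorphic if its coefficients in local holomorphic coordinates are holomorphic. Thus $(\bar\partial\psi)^\sharp$ is holomorphic iff, in every coordinate patch, $h^{l\bar k}\partial_{\bar k}\psi$ is holomorphic for each $l$. *)

theory Defs
  imports "HOL-Analysis.Analysis"
begin

section \<open>Calculus on open subsets of complex n-space\<close>

primrec Ck_on :: "nat \<Rightarrow> 'a::real_normed_vector set \<Rightarrow> ('a \<Rightarrow> 'b::real_normed_vector) \<Rightarrow> bool" where
  "Ck_on 0 S f \<longleftrightarrow> continuous_on S f"
| "Ck_on (Suc k) S f \<longleftrightarrow>
     (\<forall>x\<in>S. f differentiable (at x)) \<and>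
     (\<forall>v. Ck_on k S (\<lambda>x. frechet_derivative f (at x) v))"

definition smooth_on :: "'a::real_normed_vector set \<Rightarrow> ('a \<Rightarrow> 'b::real_normed_vector) \<Rightarrow> bool" where
  "smooth_on S f \<longleftrightarrow> (\<forall>k. Ck_on k S f)"

text \<open>Holomorphy in several variables, on an open set: the real Frechet derivative exists and
  is complex linear. The single-variable notion of the library is not applicable to
  \<^typ>\<open>complex^'n\<close>.\<close>

definition holo_on :: "(complex^'n) set \<Rightarrow> (complex^'n \<Rightarrow> complex) \<Rightarrow> bool" where
  "holo_on S f \<longleftrightarrow>
     (\<forall>z\<in>S. \<exists>f'. (f has_derivative f') (at z) \<and> (\<forall>a v. f' (a *s v) = a * f' v))"

text \<open>The Wirtinger operators \<open>\<partial>/\<partial>z\<^sub>j = 1/2 (\<partial>/\<partial>x\<^sub>j - i \<partial>/\<partial>y\<^sub>j)\<close> and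
  \<open>\<partial>/\<partial>\<bar>z\<^sub>j = 1/2 (\<partial>/\<partial>x\<^sub>j + i \<partial>/\<partial>y\<^sub>j)\<close>.\<close>

definition dz :: "'n::finite \<Rightarrow> (complex^'n \<Rightarrow> complex) \<Rightarrow> complex^'n \<Rightarrow> complex" where
  "dz j f z = (frechet_derivative f (at z) (axis j 1)
               - \<i> * frechet_derivative f (at z) (axis j \<i>)) / 2"

definition dzbar :: "'n::finite \<Rightarrow> (complex^'n \<Rightarrow> complex) \<Rightarrow> complex^'n \<Rightarrow> complex" where
  "dzbar j f z = (frechet_derivative f (at z) (axis j 1)
                  + \<i> * frechet_derivative f (at z) (axis j \<i>)) / 2"


section \<open>Complex manifolds\<close>

text \<open>The manifold is the whole type \<open>'a\<close>, which is Hausdorff and second countable; its dimension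
  is \<open>CARD('n)\<close>. A chart is its domain together with the coordinate map, whose values outside the
  domain are irrelevant. An atlas is any (not necessarily maximal) set of charts.\<close>

type_synonym ('a, 'n) chart = "'a set \<times> ('a \<Rightarrow> complex^'n)"

definition cdom :: "('a, 'n) chart \<Rightarrow> 'a set" where
  "cdom c = fst c"

definition cmap :: "('a, 'n) chart \<Rightarrow> 'a \<Rightarrow> complex^'n" where
  "cmap c = snd c"

definition cimg :: "('a, 'n) chart \<Rightarrow> (complex^'n) set" where
  "cimg c = cmap c ` cdom c"

definition cinv :: "('a, 'n) chart \<Rightarrow> complex^'n \<Rightarrow> 'a" where
  "cinv c = inv_into (cdom c) (cmap c)"

definition trans_map :: "('a, 'n) chart \<Rightarrow> ('a, 'n) chart \<Rightarrow> complex^'n \<Rightarrow> complex^'n" where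
  "trans_map c d z = cmap d (cinv c z)"

definition complex_atlas ::
    "('a::{t2_space,second_countable_topology}, 'n::finite) chart set \<Rightarrow> bool" where
  "complex_atlas A \<longleftrightarrow>
     (\<Union>c\<in>A. cdom c) = UNIV \<and>
     (\<forall>c\<in>A. open (cdom c) \<and> open (cimg c) \<and> homeomorphism (cdom c) (cimg c) (cmap c) (cinv c)) \<and>
     (\<forall>c\<in>A. \<forall>d\<in>A. \<forall>l. holo_on (cmap c ` (cdom c \<inter> cdom d)) (\<lambda>z. trans_map c d z $ l))"

definition jac :: "('a, 'n::finite) chart \<Rightarrow> ('a, 'n) chart \<Rightarrow> complex^'n \<Rightarrow> complex^'n^'n" where
  "jac c d z = (\<chi> l j. dz j (\<lambda>w. trans_map c d w $ l) z)"

definition smooth_fun ::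
    "('a, 'n::finite) chart set \<Rightarrow> ('a \<Rightarrow> real) \<Rightarrow> bool" where
  "smooth_fun A f \<longleftrightarrow> (\<forall>c\<in>A. smooth_on (cimg c) (\<lambda>z. f (cinv c z)))"


section \<open>Hermitian and Kaehler metrics\<close>

text \<open>A metric is given by its local coefficient matrices: \<open>h c z $ j $ k\<close> is the coefficient
  \<open>h\<^sub>j\<^sub>k\<close> of \<open>dz\<^sub>j \<otimes> d\<bar>z\<^sub>k\<close> in the chart \<open>c\<close> at the point with coordinates \<open>z\<close>. The last
  conjunct is the transformation law that makes these a globally defined tensor.\<close>

type_synonym ('a, 'n) metric = "('a, 'n) chart \<Rightarrow> complex^'n \<Rightarrow> complex^'n^'n"

definition hermitian_metric ::
    "('a, 'n::finite) chart set \<Rightarrow> ('a, 'n) metric \<Rightarrow> bool" where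
  "hermitian_metric A h \<longleftrightarrow>
     (\<forall>c\<in>A. \<forall>j k. smooth_on (cimg c) (\<lambda>z. h c z $ j $ k)) \<and>
     (\<forall>c\<in>A. \<forall>z\<in>cimg c. \<forall>j k. h c z $ k $ j = cnj (h c z $ j $ k)) \<and>
     (\<forall>c\<in>A. \<forall>z\<in>cimg c. \<forall>v::complex^'n. v \<noteq> 0 \<longrightarrow>
        Re (\<Sum>j\<in>UNIV. \<Sum>k\<in>UNIV. h c z $ j $ k * v $ j * cnj (v $ k)) > 0) \<and>
     (\<forall>c\<in>A. \<forall>d\<in>A. \<forall>x \<in> cdom c \<inter> cdom d. \<forall>j k.
        h c (cmap c x) $ j $ k =
          (\<Sum>l\<in>UNIV. \<Sum>m\<in>UNIV. jac c d (cmap c x) $ l $ j * cnj (jac c d (cmap c x) $ m $ k)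
             * h d (cmap d x) $ l $ m))"

text \<open>Closedness of the fundamental form \<open>\<omega> = i/2 \<Sum> h\<^sub>j\<^sub>k dz\<^sub>j \<and> d\<bar>z\<^sub>k\<close>: the two conjuncts are the
  vanishing of the coefficients of \<open>dz\<^sub>l \<and> dz\<^sub>j \<and> d\<bar>z\<^sub>k\<close> and of \<open>dz\<^sub>j \<and> d\<bar>z\<^sub>k \<and> d\<bar>z\<^sub>l\<close> in
  \<open>d\<omega>\<close>, up to a nonzero constant factor.\<close>

definition fundamental_form_closed ::
    "('a, 'n::finite) chart set \<Rightarrow> ('a, 'n) metric \<Rightarrow> bool" where
  "fundamental_form_closed A h \<longleftrightarrow>
     (\<forall>c\<in>A. \<forall>z\<in>cimg c. \<forall>j k l.
        dz l (\<lambda>w. h c w $ j $ k) z - dz j (\<lambda>w. h c w $ l $ k) z = 0 \<and>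
        dzbar l (\<lambda>w. h c w $ j $ k) z - dzbar k (\<lambda>w. h c w $ j $ l) z = 0)"

definition chart_at :: "('a, 'n) chart set \<Rightarrow> 'a \<Rightarrow> ('a, 'n) chart" where
  "chart_at A x = (SOME c. c \<in> A \<and> x \<in> cdom c)"

definition C1_curve ::
    "('a::topological_space, 'n::finite) chart set \<Rightarrow> (real \<Rightarrow> 'a) \<Rightarrow> bool" where
  "C1_curve A g \<longleftrightarrow>
     path g \<and>
     (\<exists>K. finite K \<and> (\<forall>c\<in>A. (\<lambda>t. cmap c (g t)) C1_differentiable_on ({t \<in> {0..1}. g t \<in> cdom c} - K)))"

definition speed ::
    "('a, 'n::finite) chart set \<Rightarrow> ('a, 'n) metric \<Rightarrow> (real \<Rightarrow> 'a) \<Rightarrow> real \<Rightarrow> real" where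
  "speed A h g t =
     (let c = chart_at A (g t);
          v = vector_derivative (\<lambda>s. cmap c (g s)) (at t)
      in sqrt (Re (\<Sum>j\<in>UNIV. \<Sum>k\<in>UNIV. h c (cmap c (g t)) $ j $ k * v $ j * cnj (v $ k))))"

definition curve_length ::
    "('a, 'n::finite) chart set \<Rightarrow> ('a, 'n) metric \<Rightarrow> (real \<Rightarrow> 'a) \<Rightarrow> ennreal" where
  "curve_length A h g = (\<integral>\<^sup>+ t\<in>{0..1}. ennreal (speed A h g t) \<partial>lborel)"

text \<open>The geodesic distance; it is infinite between points of different components.\<close>

definition geodesic_dist ::
    "('a::topological_space, 'n::finite) chart set \<Rightarrow> ('a, 'n) metric \<Rightarrow> 'a \<Rightarrow> 'a \<Rightarrow> ennreal" where
  "geodesic_dist A h x y =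
     (INF g \<in> {g. C1_curve A g \<and> pathstart g = x \<and> pathfinish g = y}. curve_length A h g)"

definition complete_metric ::
    "('a::topological_space, 'n::finite) chart set \<Rightarrow> ('a, 'n) metric \<Rightarrow> bool" where
  "complete_metric A h \<longleftrightarrow>
     (\<forall>X::nat \<Rightarrow> 'a.
        (\<forall>e::real>0. \<exists>N. \<forall>m\<ge>N. \<forall>n\<ge>N. geodesic_dist A h (X m) (X n) < ennreal e) \<longrightarrow>
        (\<exists>x. \<forall>e::real>0. \<exists>N. \<forall>n\<ge>N. geodesic_dist A h (X n) x < ennreal e))"

definition complete_kaehler_manifold ::
    "('a::{t2_space,second_countable_topology}, 'n::finite) chart set \<Rightarrow> ('a, 'n) metric \<Rightarrow> bool" where
  "complete_kaehler_manifold A h \<longleftrightarrow>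
     complex_atlas A \<and> hermitian_metric A h \<and> fundamental_form_closed A h \<and> complete_metric A h"

text \<open>\<open>V\<close> is the measure \<open>dvol\<^sub>h\<close>, i.e. \<open>det (h\<^sub>j\<^sub>k) d\<lambda>\<close> in every chart. It is unique
  by the lemma below, and it exists by the change of variables formula.\<close>

definition is_dvol ::
    "('a::topological_space, 'n::finite) chart set \<Rightarrow> ('a, 'n) metric \<Rightarrow> 'a measure \<Rightarrow> bool" where
  "is_dvol A h V \<longleftrightarrow>
     sets V = sets borel \<and>
     (\<forall>c\<in>A. \<forall>B \<in> sets borel. B \<subseteq> cdom c \<longrightarrow>
        emeasure V B = (\<integral>\<^sup>+ z \<in> cmap c ` B. ennreal (Re (det (h c z))) \<partial>lborel))"

lemma is_dvol_unique:
  fixes A :: "('a::{t2_space,second_countable_topology}, 'n::finite) chart set"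
  assumes A: "complex_atlas A" and V: "is_dvol A h V" and W: "is_dvol A h W"
  shows "V = W"
proof (rule measure_eqI)
  show sets: "sets V = sets W"
    using V W by (simp add: is_dvol_def)
  fix B assume "B \<in> sets V"
  then have B: "B \<in> sets borel"
    using V by (simp add: is_dvol_def)
  have op: "open U" if "U \<in> cdom ` A" for U
    using A that by (auto simp: complex_atlas_def)
  obtain F where F: "F \<subseteq> cdom ` A" "countable F" "\<Union>F = \<Union>(cdom ` A)"
    using Lindelof[of "cdom ` A", OF op] by blast
  have cov: "\<Union>F = UNIV"
    using A F(3) by (simp add: complex_atlas_def)
  then have ne: "F \<noteq> {}"
    by auto
  define U where "U = from_nat_into F"
  have U: "U i \<in> cdom ` A" for i
    using F(1) from_nat_into[OF ne, of i] unfolding U_def by blast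
  have UU: "(\<Union>i. U i) = UNIV"
    using cov ne F(2) unfolding U_def by (simp add: range_from_nat_into)
  define E where "E i = B \<inter> disjointed U i" for i
  have Eb: "E i \<in> sets borel" for i
  proof -
    have "range U \<subseteq> sets borel"
      using U op by auto
    then have "range (disjointed U) \<subseteq> sets borel"
      by (rule sets.range_disjointed_sets)
    then show ?thesis
      using B unfolding E_def by blast
  qed
  have disj: "disjoint_family E"
    using disjoint_family_disjointed[of U] unfolding E_def disjoint_family_on_def by blast
  have EB: "(\<Union>i. E i) = B"
    using UU UN_disjointed_eq[of U] unfolding E_def by blast
  have eq: "emeasure V (E i) = emeasure W (E i)" for i
  proof -
    obtain c where c: "c \<in> A" "U i = cdom c"
      using U by blast
    have "E i \<subseteq> cdom c"
      using disjointed_subset[of U i] c(2) unfolding E_def by blast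
    with V W c(1) Eb[of i] show ?thesis
      by (simp add: is_dvol_def)
  qed
  have r: "range E \<subseteq> sets V" "range E \<subseteq> sets W"
    using Eb V W by (auto simp: is_dvol_def)
  have "emeasure V B = (\<Sum>i. emeasure V (E i))"
    using suminf_emeasure[OF r(1) disj] EB by simp
  also have "\<dots> = (\<Sum>i. emeasure W (E i))"
    by (simp add: eq)
  also have "\<dots> = emeasure W B"
    using suminf_emeasure[OF r(2) disj] EB by simp
  finally show "emeasure V B = emeasure W B" .
qed

text \<open>\<open>h\<^sup>j\<^sup>k\<close>, the transpose of the inverse of \<open>h\<^sub>j\<^sub>k\<close>.\<close>

definition hinv :: "('a, 'n::finite) metric \<Rightarrow> ('a, 'n) chart \<Rightarrow> complex^'n \<Rightarrow> complex^'n^'n" where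
  "hinv h c z = transpose (matrix_inv (h c z))"

definition dbar_sharp ::
    "('a, 'n::finite) metric \<Rightarrow> ('a \<Rightarrow> real) \<Rightarrow> ('a, 'n) chart \<Rightarrow> complex^'n \<Rightarrow> 'n \<Rightarrow> complex" where
  "dbar_sharp h \<psi> c z l =
     (\<Sum>k\<in>UNIV. hinv h c z $ l $ k * dzbar k (\<lambda>w. complex_of_real (\<psi> (cinv c w))) z)"

definition dbar_sharp_holomorphic ::
    "('a, 'n::finite) chart set \<Rightarrow> ('a, 'n) metric \<Rightarrow> ('a \<Rightarrow> real) \<Rightarrow> bool" where
  "dbar_sharp_holomorphic A h \<psi> \<longleftrightarrow>
     (\<forall>c\<in>A. \<forall>l. holo_on (cimg c) (\<lambda>z. dbar_sharp h \<psi> c z l))"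


section \<open>Forms of type (p,0)\<close>

text \<open>A \<open>(p,0)\<close>-form is given by its local coefficients: \<open>u c z J\<close>, for an arbitrary multi-index
  \<open>J\<close> of length \<open>p\<close>, is the coefficient \<open>u\<^sub>J\<close> in the chart \<open>c\<close> at the point with coordinates
  \<open>z\<close>. The coefficients are defined for all \<open>J\<close> and are skew-symmetric in \<open>J\<close>, so that
  \<open>u = \<Sum>' u\<^sub>J dz\<^sup>J = 1/p! \<Sum> u\<^sub>J dz\<^sup>J\<close>, the first sum being over increasing \<open>J\<close> and the second
  one over all \<open>J\<close>. Values at other \<open>J\<close>, \<open>c\<close>, or \<open>z\<close> are irrelevant.\<close>

type_synonym ('a, 'n) form = "('a, 'n) chart \<Rightarrow> complex^'n \<Rightarrow> 'n list \<Rightarrow> complex"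

definition multi_idx :: "nat \<Rightarrow> 'n list set" where
  "multi_idx p = {J. length J = p}"

definition del_nth :: "nat \<Rightarrow> 'n list \<Rightarrow> 'n list" where
  "del_nth i J = take i J @ drop (Suc i) J"

definition p0_form :: "('a, 'n::finite) chart set \<Rightarrow> nat \<Rightarrow> ('a, 'n) form \<Rightarrow> bool" where
  "p0_form A p u \<longleftrightarrow>
     (\<forall>c\<in>A. \<forall>z\<in>cimg c. \<forall>J\<in>multi_idx p. \<forall>\<sigma>. \<sigma> permutes {..<p} \<longrightarrow>
        u c z (permute_list \<sigma> J) = of_int (sign \<sigma>) * u c z J) \<and>
     (\<forall>c\<in>A. \<forall>d\<in>A. \<forall>x \<in> cdom c \<inter> cdom d. \<forall>J\<in>multi_idx p.
        u c (cmap c x) J =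
          (\<Sum>K\<in>multi_idx p. (\<Prod>i<p. jac c d (cmap c x) $ (K ! i) $ (J ! i)) * u d (cmap d x) K))"

definition holomorphic_form :: "('a, 'n::finite) chart set \<Rightarrow> nat \<Rightarrow> ('a, 'n) form \<Rightarrow> bool" where
  "holomorphic_form A p u \<longleftrightarrow>
     p0_form A p u \<and> (\<forall>c\<in>A. \<forall>J\<in>multi_idx p. holo_on (cimg c) (\<lambda>z. u c z J))"

text \<open>The pointwise inner product induced by \<open>h\<close>: for increasing multi-indices,
  \<open>dz\<^sup>J\<close> and \<open>dz\<^sup>K\<close> have inner product \<open>det (h\<^sup>j\<^sup>k)\<close> with \<open>j\<close>, \<open>k\<close> running through \<open>J\<close>, \<open>K\<close>. Summing
  over all multi-indices instead, this becomes the formula below. It does not depend on the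
  chart.\<close>

definition form_inner ::
    "('a, 'n::finite) chart set \<Rightarrow> ('a, 'n) metric \<Rightarrow> nat \<Rightarrow> ('a, 'n) form \<Rightarrow> ('a, 'n) form \<Rightarrow> 'a \<Rightarrow> complex"
  where
  "form_inner A h p u v x =
     (let c = chart_at A x; z = cmap c x in
        (\<Sum>J\<in>multi_idx p. \<Sum>K\<in>multi_idx p.
           (\<Prod>i<p. hinv h c z $ (J ! i) $ (K ! i)) * u c z J * cnj (v c z K)) / fact p)"

text \<open>The exterior derivative \<open>\<partial>u = \<Sum>' \<Sum> \<partial>u\<^sub>J/\<partial>z\<^sub>j dz\<^sub>j \<and> dz\<^sup>J\<close> in terms of skew-symmetric
  coefficients.\<close>

definition del :: "('a, 'n::finite) form \<Rightarrow> ('a, 'n) form" where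
  "del u = (\<lambda>c z J. \<Sum>i<length J. (-1) ^ i * dz (J ! i) (\<lambda>w. u c w (del_nth i J)) z)"

text \<open>\<open>\<partial>u = f\<close> in the sense of distributions in every chart, for a \<open>(p,0)\<close>-form \<open>u\<close> and a
  \<open>(p+1,0)\<close>-form \<open>f\<close> with locally integrable coefficients.\<close>

definition weak_del :: "('a, 'n::finite) chart set \<Rightarrow> nat \<Rightarrow> ('a, 'n) form \<Rightarrow> ('a, 'n) form \<Rightarrow> bool" where
  "weak_del A p u f \<longleftrightarrow>
     (\<forall>c\<in>A. \<forall>J\<in>multi_idx (Suc p). \<forall>\<phi>::complex^'n \<Rightarrow> complex.
        smooth_on UNIV \<phi> \<and> compact (closure {z. \<phi> z \<noteq> 0}) \<and> closure {z. \<phi> z \<noteq> 0} \<subseteq> cimg c \<longrightarrow>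
        (LINT z:cimg c|lborel. f c z J * \<phi> z) =
        - (LINT z:cimg c|lborel. \<Sum>i<Suc p. (-1) ^ i * u c z (del_nth i J) * dz (J ! i) \<phi> z))"


section \<open>Weighted spaces of forms\<close>

text \<open>In the following, \<open>V\<close> is the measure \<open>dvol\<^sub>h\<close>. Elements of the Hilbert spaces are represented
  by everywhere defined forms; the equality of the Hilbert spaces is \<open>L2_eq\<close>.\<close>

definition L2_inner ::
    "('a, 'n::finite) chart set \<Rightarrow> ('a, 'n) metric \<Rightarrow> 'a measure \<Rightarrow> ('a \<Rightarrow> real) \<Rightarrow> nat
     \<Rightarrow> ('a, 'n) form \<Rightarrow> ('a, 'n) form \<Rightarrow> complex" where
  "L2_inner A h V \<psi> p u v = (LINT x|V. form_inner A h p u v x * complex_of_real (exp (- \<psi> x)))"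

definition L2_norm ::
    "('a, 'n::finite) chart set \<Rightarrow> ('a, 'n) metric \<Rightarrow> 'a measure \<Rightarrow> ('a \<Rightarrow> real) \<Rightarrow> nat
     \<Rightarrow> ('a, 'n) form \<Rightarrow> real" where
  "L2_norm A h V \<psi> p u = sqrt (Re (L2_inner A h V \<psi> p u u))"

definition L2 ::
    "('a, 'n::finite) chart set \<Rightarrow> ('a, 'n) metric \<Rightarrow> 'a measure \<Rightarrow> ('a \<Rightarrow> real) \<Rightarrow> nat
     \<Rightarrow> ('a, 'n) form set" where
  "L2 A h V \<psi> p =
     {u. p0_form A p u \<and>
         (\<forall>c\<in>A. \<forall>J\<in>multi_idx p. set_borel_measurable lborel (cimg c) (\<lambda>z. u c z J)) \<and>
         integrable V (\<lambda>x. Re (form_inner A h p u u x) * exp (- \<psi> x))}"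

definition L2_eq ::
    "('a, 'n::finite) chart set \<Rightarrow> 'a measure \<Rightarrow> nat \<Rightarrow> ('a, 'n) form \<Rightarrow> ('a, 'n) form \<Rightarrow> bool" where
  "L2_eq A V p u v \<longleftrightarrow>
     (AE x in V. \<forall>c\<in>A. x \<in> cdom c \<longrightarrow> (\<forall>J\<in>multi_idx p. u c (cmap c x) J = v c (cmap c x) J))"

definition A2 ::
    "('a, 'n::finite) chart set \<Rightarrow> ('a, 'n) metric \<Rightarrow> 'a measure \<Rightarrow> ('a \<Rightarrow> real) \<Rightarrow> nat
     \<Rightarrow> ('a, 'n) form set" where
  "A2 A h V \<psi> p = {u \<in> L2 A h V \<psi> p. holomorphic_form A p u}"

text \<open>Unbounded operators are represented by their graphs, their domains by \<^const>\<open>Domain\<close>.\<close>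

definition D_op ::
    "('a, 'n::finite) chart set \<Rightarrow> ('a, 'n) metric \<Rightarrow> 'a measure \<Rightarrow> ('a \<Rightarrow> real) \<Rightarrow> nat
     \<Rightarrow> (('a, 'n) form \<times> ('a, 'n) form) set" where
  "D_op A h V \<psi> p =
     {(u, f). u \<in> L2 A h V \<psi> p \<and> f \<in> L2 A h V \<psi> (Suc p) \<and> weak_del A p u f}"

definition del_op ::
    "('a, 'n::finite) chart set \<Rightarrow> ('a, 'n) metric \<Rightarrow> 'a measure \<Rightarrow> ('a \<Rightarrow> real) \<Rightarrow> nat
     \<Rightarrow> (('a, 'n) form \<times> ('a, 'n) form) set" where
  "del_op A h V \<psi> p =
     {(u, f). u \<in> A2 A h V \<psi> p \<and> f = del u \<and> del u \<in> A2 A h V \<psi> (Suc p)}"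

text \<open>The graph of the Hilbert space adjoint of an operator with graph \<open>T\<close> from \<open>H\<close> to \<open>K\<close>, with
  inner products \<open>ipH\<close> and \<open>ipK\<close>.\<close>

definition hilbert_adjoint ::
    "'f set \<Rightarrow> ('f \<Rightarrow> 'f \<Rightarrow> complex) \<Rightarrow> 'f set \<Rightarrow> ('f \<Rightarrow> 'f \<Rightarrow> complex) \<Rightarrow> ('f \<times> 'f) set \<Rightarrow> ('f \<times> 'f) set"
  where
  "hilbert_adjoint H ipH K ipK T =
     {(\<eta>, \<zeta>). \<eta> \<in> K \<and> \<zeta> \<in> H \<and> (\<forall>(u, f)\<in>T. ipK f \<eta> = ipH u \<zeta>)}"

definition D_star ::
    "('a, 'n::finite) chart set \<Rightarrow> ('a, 'n) metric \<Rightarrow> 'a measure \<Rightarrow> ('a \<Rightarrow> real) \<Rightarrow> nat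
     \<Rightarrow> (('a, 'n) form \<times> ('a, 'n) form) set" where
  "D_star A h V \<psi> p =
     hilbert_adjoint (L2 A h V \<psi> p) (L2_inner A h V \<psi> p)
       (L2 A h V \<psi> (Suc p)) (L2_inner A h V \<psi> (Suc p)) (D_op A h V \<psi> p)"

definition del_star ::
    "('a, 'n::finite) chart set \<Rightarrow> ('a, 'n) metric \<Rightarrow> 'a measure \<Rightarrow> ('a \<Rightarrow> real) \<Rightarrow> nat
     \<Rightarrow> (('a, 'n) form \<times> ('a, 'n) form) set" where
  "del_star A h V \<psi> p =
     hilbert_adjoint (A2 A h V \<psi> p) (L2_inner A h V \<psi> p)
       (A2 A h V \<psi> (Suc p)) (L2_inner A h V \<psi> (Suc p)) (del_op A h V \<psi> p)"

definition del_densely_defined ::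
    "('a, 'n::finite) chart set \<Rightarrow> ('a, 'n) metric \<Rightarrow> 'a measure \<Rightarrow> ('a \<Rightarrow> real) \<Rightarrow> nat \<Rightarrow> bool" where
  "del_densely_defined A h V \<psi> p \<longleftrightarrow>
     (\<forall>v \<in> A2 A h V \<psi> p. \<forall>e>0. \<exists>u \<in> Domain (del_op A h V \<psi> p).
        L2_norm A h V \<psi> p (\<lambda>c z J. v c z J - u c z J) < e)"

end

theory Submission
  imports Defs "HOL-Complex_Analysis.Cauchy_Integral_Formula"
begin

text \<open>Test the adjoint relation \<open>(Du, \<eta>) = (u, D\<^sup>*\<eta>)\<close> with forms \<open>u\<close> of class \<open>C\<^sup>1\<close> whose support is
  compact and contained in one chart, and integrate by parts there. On a Kaehler manifold the first
  derivatives of the metric cancel, and those of \<open>\<eta>\<close> vanish because \<open>\<eta>\<close> is holomorphic. Only the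
  derivative of the weight survives: \<open>D\<^sup>*\<eta>\<close> is the contraction of \<open>\<eta>\<close> with \<open>(\<partial>bar \<psi>)\<^sup>\<sharp>\<close>, which is
  holomorphic. Since \<open>D\<close> extends \<open>\<partial>\<close> on holomorphic forms, this contraction is also an adjoint value
  for \<open>\<partial>\<close>, and such a value is unique because \<open>\<partial>\<close> is densely defined.\<close>

subsection \<open>Skew-symmetric coefficient families\<close>

text \<open>The Kaehler condition enters twice. It makes the sum over \<open>l\<close> of
  \<open>H^lk \<partial>_l H^jm\<close> symmetric in \<open>k\<close> and \<open>m\<close>, so the
  derivatives of the metric inside the pointwise inner product vanish against the skew
  \<open>\<eta>\<close>; and it makes the columns of \<open>H\<close> times the volume density
  divergence free, which removes the remaining ones. Test forms of class C1 suffice because their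
  classical \<partial> is also their distributional one, so cut-offs can be built from squares of
  positive parts. A form is a family of coefficients in all charts; a local test form has to be
  pulled back to every other chart, and \<partial> is carried along only because second derivatives
  of coordinate changes commute. Holomorphy is assumed pointwise, so this regularity is first
  extracted from Cauchy's integral. The field may be unbounded, so it is not evident that the
  contraction is square integrable. The tests have compact support and need only local
  integrability; they identify the contraction with \<open>D^* \<eta>\<close> almost everywhere, and
  from there it inherits its finite norm.\<close>

text \<open>\<open>pull M u\<close> are the coefficients of the pullback of \<open>u\<close> by the linear map with matrix \<open>M\<close>, and
  \<open>ip H p\<close> is \<open>p!\<close> times the pointwise inner product. They are defined by recursion on the multi-index
  so that the identities below become inductions; skew-symmetry enters only through exchanges of
  neighbouring indices. For \<open>D j K = \<partial>u\<^sub>K/\<partial>z\<^sub>j\<close>, \<open>altd D\<close> are the coefficients of \<open>\<partial>u\<close>.\<close>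

primrec pull :: "('n::finite \<Rightarrow> 'n \<Rightarrow> complex) \<Rightarrow> ('n list \<Rightarrow> complex) \<Rightarrow> 'n list \<Rightarrow> complex" where
  "pull M u [] = u []"
| "pull M u (x # J) = (\<Sum>k\<in>UNIV. M k x * pull M (\<lambda>K. u (k # K)) J)"

primrec ip :: "('n::finite \<Rightarrow> 'n \<Rightarrow> complex) \<Rightarrow> nat \<Rightarrow> ('n list \<Rightarrow> complex) \<Rightarrow> ('n list \<Rightarrow> complex) \<Rightarrow> complex"
  where
  "ip H 0 u v = u [] * cnj (v [])"
| "ip H (Suc p) u v = (\<Sum>j\<in>UNIV. \<Sum>k\<in>UNIV. H j k * ip H p (\<lambda>K. u (j # K)) (\<lambda>K. v (k # K)))"

definition skew :: "nat \<Rightarrow> ('n list \<Rightarrow> complex) \<Rightarrow> bool" where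
  "skew p u \<longleftrightarrow> (\<forall>X x y Y. length X + length Y + 2 = p \<longrightarrow> u (X @ x # y # Y) = - u (X @ y # x # Y))"

definition altd :: "('n \<Rightarrow> 'n list \<Rightarrow> complex) \<Rightarrow> 'n list \<Rightarrow> complex" where
  "altd D J = (\<Sum>i<length J. (-1) ^ i * D (J ! i) (del_nth i J))"

lemma finite_multi_idx [simp]: "finite (multi_idx p :: 'n::finite list set)"
  unfolding multi_idx_def using finite_lists_length_eq[of "UNIV :: 'n set" p] by simp

lemma multi_idx_0 [simp]: "multi_idx 0 = {[]}"
  by (auto simp: multi_idx_def)

lemma sum_multi_idx_Suc:
  "(\<Sum>J\<in>multi_idx (Suc p). f J) = (\<Sum>k\<in>(UNIV::'n::finite set). \<Sum>J\<in>multi_idx p. f (k # J))"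
proof -
  have "(\<Sum>(k,J)\<in>(UNIV::'n set) \<times> multi_idx p. f (k # J)) = (\<Sum>J\<in>multi_idx (Suc p). f J)"
    by (rule sum.reindex_bij_witness[where i = "\<lambda>J. (hd J, tl J)" and j = "\<lambda>(k,J). k # J"])
      (auto simp: multi_idx_def length_Suc_conv)
  then show ?thesis by (simp add: sum.cartesian_product)
qed

lemma length_del_nth: "i < length J \<Longrightarrow> length (del_nth i J) = length J - 1"
  by (simp add: del_nth_def)

lemma del_nth_Cons [simp]:
  "del_nth 0 (x # J) = J" "del_nth (Suc i) (x # J) = x # del_nth i J"
  by (simp_all add: del_nth_def)

text \<open>Identifies the recursion with the sum in the transformation law of
  \<open>p0_form\<close>; the index list is consumed from the front, so the factor for position 0
  splits off the product.\<close>

lemma pull_eq: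
  "length J = p \<Longrightarrow> pull M u J = (\<Sum>K\<in>multi_idx p. (\<Prod>i<p. M (K ! i) (J ! i)) * u K)"
proof (induction J arbitrary: p u)
  case (Cons x J)
  obtain q where q: "p = Suc q" "length J = q" using Cons.prems by auto
  show ?case unfolding q(1) pull.simps sum_multi_idx_Suc Cons.IH[OF q(2)]
    by (simp add: prod.lessThan_Suc_shift sum_distrib_left mult.assoc del: prod.lessThan_Suc)
qed simp

lemma ip_eq:
  "ip H p u v = (\<Sum>J\<in>multi_idx p. \<Sum>K\<in>multi_idx p. (\<Prod>i<p. H (J ! i) (K ! i)) * u J * cnj (v K))"
proof (induction p arbitrary: u v)
  case (Suc p)
  show ?case unfolding ip.simps sum_multi_idx_Suc Suc.IH
    apply (simp add: prod.lessThan_Suc_shift sum_distrib_left mult.assoc del: prod.lessThan_Suc)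
    apply (rule sum.cong[OF refl], rule sum.swap)
    done
qed simp

text \<open>Raising the indices of \<open>v\<close> with \<open>H\<close> leaves a plain pairing
  over multi-indices. In this form a single raised coefficient can be isolated by
  \<open>alt_unit\<close>, and \<open>ip H p v v\<close> is seen to vanish once all raised
  coefficients do.\<close>

lemma ip_eq_pull:
  "ip H p u v = (\<Sum>J\<in>multi_idx p. u J * pull (\<lambda>k j. H j k) (\<lambda>K. cnj (v K)) J)"
  unfolding ip_eq
  by (rule sum.cong[OF refl], subst pull_eq[where p=p])
    (auto simp: multi_idx_def sum_distrib_left mult_ac)

lemma pull_cong: "(\<And>K. length K = length J \<Longrightarrow> u K = v K) \<Longrightarrow> pull M u J = pull M v J"
proof (induction J arbitrary: u v)
  case (Cons x J)
  have "pull M (\<lambda>K. u (k # K)) J = pull M (\<lambda>K. v (k # K)) J" for k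
    by (rule Cons.IH) (simp add: Cons.prems)
  then show ?case by simp
qed simp

lemma pull_sum: "pull M (\<lambda>K. \<Sum>i\<in>I. c i * u i K) J = (\<Sum>i\<in>I. c i * pull M (u i) J)"
proof (induction J arbitrary: u)
  case (Cons x J)
  have "pull M (\<lambda>K. \<Sum>i\<in>I. c i * u i K) (x # J) =
     (\<Sum>k\<in>UNIV. M k x * (\<Sum>i\<in>I. c i * pull M (\<lambda>K. u i (k # K)) J))"
    by (simp add: Cons.IH)
  also have "\<dots> = (\<Sum>k\<in>UNIV. \<Sum>i\<in>I. c i * (M k x * pull M (\<lambda>K. u i (k # K)) J))"
    by (simp add: sum_distrib_left mult_ac)
  also have "\<dots> = (\<Sum>i\<in>I. \<Sum>k\<in>UNIV. c i * (M k x * pull M (\<lambda>K. u i (k # K)) J))"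
    by (rule sum.swap)
  finally show ?case by (simp add: sum_distrib_left)
qed simp

lemma pull_add: "pull M (\<lambda>K. u K + v K) J = pull M u J + pull M v J"
  by (induction J arbitrary: u v) (simp_all add: sum.distrib algebra_simps)

lemma pull_scale: "pull M (\<lambda>K. c * u K) J = c * pull M u J"
  by (induction J arbitrary: u) (simp_all add: sum_distrib_left mult_ac)

lemma pull_uminus: "pull M (\<lambda>K. - u K) J = - pull M u J"
  using pull_scale[of M "-1" u J] by simp

lemma pull_diff: "pull M (\<lambda>K. u K - v K) J = pull M u J - pull M v J"
  using pull_add[of M u "\<lambda>K. - v K" J] by (simp add: pull_uminus)

lemma pull_zero [simp]: "pull M (\<lambda>K. 0) J = 0"
  by (induction J) simp_all

text \<open>Functoriality of the pullback, with the matrix product in the order of the chain rule.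
  It serves for the cocycle identity of coordinate changes and for undoing a pullback by an inverse
  matrix.\<close>

lemma pull_compose:
  "pull M (pull N u) J = pull (\<lambda>k x. \<Sum>l\<in>UNIV. N k l * M l x) u J"
proof (induction J arbitrary: u)
  case (Cons x J)
  have "pull M (pull N u) (x # J) =
     (\<Sum>l\<in>UNIV. M l x * pull M (\<lambda>K. \<Sum>k\<in>UNIV. N k l * pull N (\<lambda>L. u (k # L)) K) J)"
    by simp
  also have "\<dots> = (\<Sum>l\<in>UNIV. M l x * (\<Sum>k\<in>UNIV. N k l * pull M (pull N (\<lambda>L. u (k # L))) J))"
    by (simp add: pull_sum)
  also have "\<dots> = (\<Sum>l\<in>UNIV. \<Sum>k\<in>UNIV. N k l * M l x *
       pull (\<lambda>k x. \<Sum>l\<in>UNIV. N k l * M l x) (\<lambda>L. u (k # L)) J)"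
    by (simp add: Cons.IH sum_distrib_left mult_ac)
  also have "\<dots> = pull (\<lambda>k x. \<Sum>l\<in>UNIV. N k l * M l x) u (x # J)"
    by (subst sum.swap) (simp add: sum_distrib_right)
  finally show ?case .
qed simp

lemma pull_id: "pull (\<lambda>k x. if k = x then 1 else 0) u J = u J"
proof (induction J arbitrary: u)
  case (Cons x J)
  then show ?case by (simp add: if_distrib[of "\<lambda>c. c * _"] sum.delta cong: if_cong)
qed simp

lemma ip_add_left: "ip H p (\<lambda>K. u K + u' K) v = ip H p u v + ip H p u' v"
  by (induction p arbitrary: u u' v) (simp_all add: sum.distrib algebra_simps)

lemma ip_scale_left: "ip H p (\<lambda>K. c * u K) v = c * ip H p u v"
  by (induction p arbitrary: u v) (simp_all add: sum_distrib_left mult_ac)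

lemma ip_add_right: "ip H p u (\<lambda>K. v K + v' K) = ip H p u v + ip H p u v'"
  by (induction p arbitrary: u v v') (simp_all add: sum.distrib algebra_simps)

lemma ip_scale_right: "ip H p u (\<lambda>K. c * v K) = cnj c * ip H p u v"
  by (induction p arbitrary: u v) (simp_all add: sum_distrib_left mult_ac)

lemma ip_diff_right: "ip H p u (\<lambda>K. v K - v' K) = ip H p u v - ip H p u v'"
  using ip_add_right[of H p u v "\<lambda>K. -1 * v' K"] by (simp only: ip_scale_right) simp

lemma ip_diff_left: "ip H p (\<lambda>K. u K - u' K) v = ip H p u v - ip H p u' v"
  using ip_add_left[of H p u "\<lambda>K. -1 * u' K" v] by (simp only: ip_scale_left) simp

lemma ip_uminus_right: "ip H p u (\<lambda>K. - v K) = - ip H p u v"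
  using ip_scale_right[of H p u "-1" v] by simp

lemma ip_zero_left [simp]: "ip H p (\<lambda>K. 0) v = 0"
  by (induction p arbitrary: v) simp_all

lemma ip_zero_right [simp]: "ip H p u (\<lambda>K. 0) = 0"
  by (induction p arbitrary: u) simp_all

lemma ip_sum_left: "ip H p (\<lambda>K. \<Sum>i\<in>I. c i * u i K) v = (\<Sum>i\<in>I. c i * ip H p (u i) v)"
  by (induction I rule: infinite_finite_induct) (simp_all add: ip_add_left ip_scale_left)

lemma ip_sum_right: "ip H p u (\<lambda>K. \<Sum>i\<in>I. c i * v i K) = (\<Sum>i\<in>I. cnj (c i) * ip H p u (v i))"
  by (induction I rule: infinite_finite_induct) (simp_all add: ip_add_right ip_scale_right)

lemma ip_cong:
  "(\<And>K. length K = p \<Longrightarrow> u K = u' K) \<Longrightarrow> (\<And>K. length K = p \<Longrightarrow> v K = v' K) \<Longrightarrow>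
    ip H p u v = ip H p u' v'"
  unfolding ip_eq by (intro sum.cong) (auto simp: multi_idx_def)

text \<open>Each index pair transforms by itself, so a change of coordinates can be absorbed into
  the matrix. The new matrix is the one that \<open>hinv_transform\<close> gives for the inverse
  metric; hence the chart independence of \<open>form_inner\<close>.\<close>

lemma ip_pull:
  "ip H p (pull M u) (pull M v) =
   ip (\<lambda>l m. \<Sum>j\<in>UNIV. \<Sum>k\<in>UNIV. H j k * M l j * cnj (M m k)) p u v"
proof (induction p arbitrary: u v)
  case (Suc p)
  let ?G = "\<lambda>l m. \<Sum>j\<in>UNIV. \<Sum>k\<in>UNIV. H j k * M l j * cnj (M m k)"
  let ?c = "\<lambda>j k l m. H j k * M l j * cnj (M m k) * ip ?G p (\<lambda>K. u (l # K)) (\<lambda>K. v (m # K))"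
  have "ip H (Suc p) (pull M u) (pull M v) =
    (\<Sum>j\<in>UNIV. \<Sum>k\<in>UNIV. H j k * ip H p (\<lambda>K. \<Sum>l\<in>UNIV. M l j * pull M (\<lambda>L. u (l # L)) K)
       (\<lambda>K. \<Sum>m\<in>UNIV. M m k * pull M (\<lambda>L. v (m # L)) K))"
    by simp
  also have "\<dots> = (\<Sum>j\<in>UNIV. \<Sum>k\<in>UNIV. \<Sum>l\<in>UNIV. \<Sum>m\<in>UNIV. ?c j k l m)"
    unfolding ip_sum_left ip_sum_right Suc.IH by (simp add: sum_distrib_left mult_ac)
  also have "\<dots> = (\<Sum>j\<in>UNIV. \<Sum>l\<in>UNIV. \<Sum>k\<in>UNIV. \<Sum>m\<in>UNIV. ?c j k l m)"
    by (rule sum.cong[OF refl], rule sum.swap)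
  also have "\<dots> = (\<Sum>j\<in>UNIV. \<Sum>l\<in>UNIV. \<Sum>m\<in>UNIV. \<Sum>k\<in>UNIV. ?c j k l m)"
    by (rule sum.cong[OF refl], rule sum.cong[OF refl], rule sum.swap)
  also have "\<dots> = (\<Sum>l\<in>UNIV. \<Sum>j\<in>UNIV. \<Sum>m\<in>UNIV. \<Sum>k\<in>UNIV. ?c j k l m)"
    by (rule sum.swap)
  also have "\<dots> = (\<Sum>l\<in>UNIV. \<Sum>m\<in>UNIV. \<Sum>j\<in>UNIV. \<Sum>k\<in>UNIV. ?c j k l m)"
    by (rule sum.cong[OF refl], rule sum.swap)
  also have "\<dots> = ip ?G (Suc p) u v"
    by (simp add: sum_distrib_right)
  finally show ?case .
qed simp

lemma ip_id: "ip (\<lambda>j k. if j = k then 1 else 0) p u v = (\<Sum>J\<in>multi_idx p. u J * cnj (v J))"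
  unfolding ip_eq_pull
  by (simp add: eq_commute[of _ "_ :: 'n::finite"] pull_id)

text \<open>A factor \<open>C\<close> of \<open>H\<close> turns coefficients into coefficients with
  respect to an orthonormal frame, where the inner product is the standard one.\<close>

lemma ip_gram:
  assumes "\<And>j k. H j k = (\<Sum>r\<in>UNIV. C r j * cnj (C r k))"
  shows "ip H p u v = (\<Sum>R\<in>multi_idx p. pull (\<lambda>j r. C r j) u R * cnj (pull (\<lambda>j r. C r j) v R))"
proof -
  have "ip (\<lambda>j k. if j = k then 1 else 0) p (pull (\<lambda>j r. C r j) u) (pull (\<lambda>j r. C r j) v) = ip H p u v"
    unfolding ip_pull assms by (simp add: if_distrib[of "\<lambda>c. c * _"] sum.delta cong: if_cong)
  then show ?thesis by (simp add: ip_id)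
qed

lemma skewD:
  "skew p u \<Longrightarrow> length X + length Y + 2 = p \<Longrightarrow> u (X @ x # y # Y) = - u (X @ y # x # Y)"
  unfolding skew_def by blast

lemma skew_Cons:
  assumes "skew (Suc p) u"
  shows "skew p (\<lambda>K. u (k # K))"
  unfolding skew_def
proof (intro allI impI)
  fix X Y :: "'a list" and x y
  assume "length X + length Y + 2 = p"
  then show "u (k # X @ x # y # Y) = - u (k # X @ y # x # Y)"
    using assms[unfolded skew_def, rule_format, of "k # X" Y x y] by simp
qed

lemma skew_head:
  assumes "skew (Suc (Suc p)) u" "length K = p"
  shows "u (x # y # K) = - u (y # x # K)"
  using assms(1)[unfolded skew_def, rule_format, of "[]" K x y] assms(2)
  unfolding append_Nil list.size by simp

text \<open>An exchange of neighbours either involves the head or happens in the tail; this split is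
  the induction step in \<open>skew_pull\<close> and \<open>skew_altd\<close>.\<close>

lemma skewI:
  fixes u :: "'a list \<Rightarrow> complex"
  assumes "\<And>k. skew p (\<lambda>K. u (k # K))"
    and "\<And>x y K. Suc (length K) = p \<Longrightarrow> u (x # y # K) = - u (y # x # K)"
  shows "skew (Suc p) u"
  unfolding skew_def
proof (intro allI impI)
  fix X Y :: "'a list" and x y
  assume l: "length X + length Y + 2 = Suc p"
  show "u (X @ x # y # Y) = - u (X @ y # x # Y)"
  proof (cases X)
    case Nil
    then show ?thesis using assms(2)[of Y x y] l by simp
  next
    case (Cons a Z)
    then show ?thesis using skewD[OF assms(1), of Z Y a x y] l by simp
  qed
qed

lemma skew_0 [simp]: "skew 0 u"
  by (simp add: skew_def)

lemma skew_sum: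
  assumes "\<And>i. i \<in> I \<Longrightarrow> skew p (u i)"
  shows "skew p (\<lambda>K. \<Sum>i\<in>I. c i * u i K)"
  unfolding skew_def
proof (intro allI impI)
  fix X Y :: "'b list" and x y
  assume l: "length X + length Y + 2 = p"
  show "(\<Sum>i\<in>I. c i * u i (X @ x # y # Y)) = - (\<Sum>i\<in>I. c i * u i (X @ y # x # Y))"
    unfolding sum_negf[symmetric]
  proof (rule sum.cong[OF refl])
    fix i assume "i \<in> I"
    from skewD[OF assms[OF this] l, of x y]
    show "c i * u i (X @ x # y # Y) = - (c i * u i (X @ y # x # Y))" by simp
  qed
qed

lemma skew_scale: "skew p u \<Longrightarrow> skew p (\<lambda>K. c * u K)"
  using skew_sum[of "{()}" p "\<lambda>_. u" "\<lambda>_. c"] by simp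

lemma skew_diff:
  assumes "skew p u" "skew p v"
  shows "skew p (\<lambda>K. u K - v K)"
  unfolding skew_def
proof (intro allI impI)
  fix X Y :: "'a list" and x y
  assume l: "length X + length Y + 2 = p"
  show "u (X @ x # y # Y) - v (X @ x # y # Y) = - (u (X @ y # x # Y) - v (X @ y # x # Y))"
    using skewD[OF assms(1) l, of x y] skewD[OF assms(2) l, of x y] by simp
qed

lemma skew_cnj:
  assumes "skew p u"
  shows "skew p (\<lambda>K. cnj (u K))"
  unfolding skew_def
proof (intro allI impI)
  fix X Y :: "'a list" and x y
  assume l: "length X + length Y + 2 = p"
  show "cnj (u (X @ x # y # Y)) = - cnj (u (X @ y # x # Y))"
    using skewD[OF assms l, of x y] by simp
qed

lemma skew_pull: "skew p u \<Longrightarrow> skew p (pull M u)"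
proof (induction p arbitrary: u)
  case (Suc p)
  show ?case
  proof (rule skewI)
    show "skew p (\<lambda>K. pull M u (k # K))" for k
      unfolding pull.simps by (rule skew_sum, rule Suc.IH, rule skew_Cons, rule Suc.prems)
    fix x y and K :: "'a list" assume K: "Suc (length K) = p"
    have s: "pull M (\<lambda>L. u (a # b # L)) K = - pull M (\<lambda>L. u (b # a # L)) K" for a b
      unfolding pull_uminus[symmetric]
      by (rule pull_cong, rule skew_head[of "length K"]) (use Suc.prems K in auto)
    have "pull M u (x # y # K) =
      (\<Sum>a\<in>UNIV. \<Sum>b\<in>UNIV. M a x * (M b y * pull M (\<lambda>L. u (a # b # L)) K))"
      by (simp add: sum_distrib_left)
    also have "\<dots> = (\<Sum>b\<in>UNIV. \<Sum>a\<in>UNIV. M a x * (M b y * pull M (\<lambda>L. u (a # b # L)) K))"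
      by (rule sum.swap)
    also have "\<dots> = - pull M u (y # x # K)"
      by (subst s) (simp add: sum_distrib_left sum_negf mult_ac)
    finally show "pull M u (x # y # K) = - pull M u (y # x # K)" .
  qed
qed simp

lemma altd_Nil [simp]: "altd D [] = 0"
  by (simp add: altd_def)

text \<open>The first term is position 0; every other position moves by one, which flips its sign.
  The inductions below use this recursion in place of explicit signs.\<close>

lemma altd_Cons [simp]: "altd D (x # J) = D x J - altd (\<lambda>j K. D j (x # K)) J"
  unfolding altd_def
  by (simp add: sum.lessThan_Suc_shift sum_negf del: sum.lessThan_Suc)

lemma altd_cong:
  "(\<And>j K. Suc (length K) = length J \<Longrightarrow> D j K = E j K) \<Longrightarrow> altd D J = altd E J"
  unfolding altd_def by (intro sum.cong) (auto simp: length_del_nth)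

lemma altd_sum: "altd (\<lambda>j K. \<Sum>i\<in>I. c i * D i j K) J = (\<Sum>i\<in>I. c i * altd (D i) J)"
  unfolding altd_def by (subst sum_distrib_left, subst sum.swap) (simp add: sum_distrib_left mult_ac)

lemma altd_add: "altd (\<lambda>j K. D j K + E j K) J = altd D J + altd E J"
  unfolding altd_def by (simp add: sum.distrib algebra_simps)

lemma altd_uminus: "altd (\<lambda>j K. - D j K) J = - altd D J"
  unfolding altd_def by (simp add: sum_negf)

text \<open>For the head exchange, \<open>altd D (x # y # K)\<close> is
  \<open>D x (y # K) - D y (x # K)\<close> plus a remainder: the first two terms change sign
  together, the remainder by skew-symmetry of \<open>D\<close>.\<close>

lemma skew_altd: "(\<And>j. skew p (D j)) \<Longrightarrow> skew (Suc p) (altd D)"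
proof (induction p arbitrary: D)
  case 0
  then show ?case by (simp add: skew_def)
next
  case (Suc p)
  show ?case
  proof (rule skewI)
    fix k
    have "skew (Suc p) (\<lambda>K. D k K)" "skew (Suc p) (altd (\<lambda>j K. D j (k # K)))"
      by (rule Suc.prems, rule Suc.IH, rule skew_Cons, rule Suc.prems)
    then show "skew (Suc p) (\<lambda>K. altd D (k # K))" by (simp add: skew_diff)
  next
    fix x y and K :: "'a list" assume K: "Suc (length K) = Suc p"
    have "altd (\<lambda>j L. D j (x # y # L)) K = - altd (\<lambda>j L. D j (y # x # L)) K"
      unfolding altd_uminus[symmetric]
    proof (rule altd_cong)
      fix j and L :: "'a list" assume "Suc (length L) = length K"
      then show "D j (x # y # L) = - D j (y # x # L)"
        using K Suc.prems[of j] by (intro skew_head[of "length L"]) auto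
    qed
    then show "altd D (x # y # K) = - altd D (y # x # K)" by simp
  qed
qed

text \<open>The derivative of \<open>M \<mapsto> pull M u\<close> in direction \<open>M'\<close>.\<close>

primrec pullD :: "('n::finite \<Rightarrow> 'n \<Rightarrow> complex) \<Rightarrow> ('n \<Rightarrow> 'n \<Rightarrow> complex) \<Rightarrow> ('n list \<Rightarrow> complex) \<Rightarrow> 'n list \<Rightarrow> complex" where
  "pullD M M' u [] = 0"
| "pullD M M' u (x # J) = (\<Sum>k\<in>UNIV. M' k x * pull M (\<lambda>K. u (k # K)) J)
      + (\<Sum>k\<in>UNIV. M k x * pullD M M' (\<lambda>K. u (k # K)) J)"

text \<open>\<open>N k y x\<close> stands for a second derivative of the \<open>k\<close>-th
  component of a map. The Leibniz rule differentiates one factor at a time; moving the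
  differentiated index to the front of \<open>u\<close> costs the sign that \<open>altd\<close>
  carries, and the symmetry of \<open>N\<close> exchanges the direction \<open>x\<close> with the
  index at that place.\<close>

lemma pullD_eq_altd:
  fixes N :: "'n::finite \<Rightarrow> 'n \<Rightarrow> 'n \<Rightarrow> complex"
  assumes S: "\<And>k x y. N k x y = N k y x"
  shows "skew (length J) u \<Longrightarrow>
    pullD M (\<lambda>k y. N k y x) u J = (\<Sum>k\<in>UNIV. altd (\<lambda>j K. N k x j * pull M (\<lambda>L. u (k # L)) K) J)"
proof (induction J arbitrary: u)
  case (Cons y J)
  have "(\<Sum>k\<in>UNIV. altd (\<lambda>j K. N k x j * pull M (\<lambda>L. u (k # L)) (y # K)) J) =
        (\<Sum>k\<in>UNIV. altd (\<lambda>j K. \<Sum>m\<in>UNIV. - M m y * (N k x j * pull M (\<lambda>L. u (m # k # L)) K)) J)"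
  proof (intro sum.cong refl altd_cong)
    fix k j and K :: "'n list" assume K: "Suc (length K) = length J"
    have "pull M (\<lambda>L. u (k # m # L)) K = - pull M (\<lambda>L. u (m # k # L)) K" for m
      unfolding pull_uminus[symmetric]
      by (rule pull_cong, rule skew_head[of "length K"]) (use Cons.prems K in auto)
    then show "N k x j * pull M (\<lambda>L. u (k # L)) (y # K) =
      (\<Sum>m\<in>UNIV. - M m y * (N k x j * pull M (\<lambda>L. u (m # k # L)) K))"
      by (simp add: sum_distrib_left mult_ac)
  qed
  also have "\<dots> = (\<Sum>k\<in>UNIV. \<Sum>m\<in>UNIV. - M m y * altd (\<lambda>j K. N k x j * pull M (\<lambda>L. u (m # k # L)) K) J)"
    unfolding altd_sum ..
  also have "\<dots> = (\<Sum>m\<in>UNIV. \<Sum>k\<in>UNIV. - M m y * altd (\<lambda>j K. N k x j * pull M (\<lambda>L. u (m # k # L)) K) J)"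
    by (rule sum.swap)
  also have "\<dots> = (\<Sum>m\<in>UNIV. - M m y * pullD M (\<lambda>k y. N k y x) (\<lambda>L. u (m # L)) J)"
    using Cons.prems by (simp add: Cons.IH skew_Cons sum_distrib_left)
  finally show ?case by (simp add: sum_subtractf sum_negf S[of _ x y])
qed simp

text \<open>With \<open>E l K\<close> as the derivative of \<open>u K\<close> in direction
  \<open>l\<close>, the argument of \<open>altd\<close> on the left is the product and chain rule
  for pulled back coefficients. This is the algebra behind \<partial> commuting with
  pullbacks.\<close>

lemma altd_pull:
  fixes N :: "'n::finite \<Rightarrow> 'n \<Rightarrow> 'n \<Rightarrow> complex"
  assumes S: "\<And>k x y. N k x y = N k y x"
  shows "Suc p = length J \<Longrightarrow> skew p u \<Longrightarrow>
    altd (\<lambda>j K. pullD M (\<lambda>k y. N k y j) u K + (\<Sum>l\<in>UNIV. M l j * pull M (E l) K)) J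
      = pull M (altd E) J"
proof (induction J arbitrary: u E p)
  case (Cons x J)
  let ?D = "\<lambda>u E j K. pullD M (\<lambda>k y. N k y j) u K + (\<Sum>l\<in>UNIV. M l j * pull M (E l) K)"
  have p: "p = length J" using Cons.prems by simp
  have sk: "skew (length J) u" using Cons.prems p by simp
  have e: "altd (\<lambda>j K. ?D u E j (x # K)) J =
     (\<Sum>k\<in>UNIV. altd (\<lambda>j K. N k x j * pull M (\<lambda>L. u (k # L)) K) J)
     + (\<Sum>k\<in>UNIV. M k x * altd (?D (\<lambda>K. u (k # K)) (\<lambda>l K. E l (k # K))) J)"
  proof -
    have "?D u E j (x # K) = (\<Sum>k\<in>UNIV. 1 * (N k x j * pull M (\<lambda>L. u (k # L)) K)) +
        (\<Sum>k\<in>UNIV. M k x * ?D (\<lambda>K. u (k # K)) (\<lambda>l K. E l (k # K)) j K)" for j K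
    proof -
      have "(\<Sum>l\<in>UNIV. M l j * pull M (E l) (x # K)) =
        (\<Sum>l\<in>UNIV. \<Sum>k\<in>UNIV. M k x * (M l j * pull M (\<lambda>L. E l (k # L)) K))"
        by (simp add: sum_distrib_left mult_ac)
      also have "\<dots> = (\<Sum>k\<in>UNIV. \<Sum>l\<in>UNIV. M k x * (M l j * pull M (\<lambda>L. E l (k # L)) K))"
        by (rule sum.swap)
      finally show ?thesis by (simp add: sum.distrib sum_distrib_left algebra_simps)
    qed
    then show ?thesis by (simp only: altd_add altd_sum) simp
  qed
  have IH: "M k x * altd (?D (\<lambda>K. u (k # K)) (\<lambda>l K. E l (k # K))) J =
        M k x * pull M (altd (\<lambda>l K. E l (k # K))) J" for k
  \<comment> \<open>The induction hypothesis covers nonempty lists only; for the empty one both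
    sides are 0.\<close>
  proof (cases "J")
    case Nil
    then show ?thesis by simp
  next
    case (Cons a L)
    then have "skew (Suc (length L)) u" using sk by simp
    then have "skew (length L) (\<lambda>K. u (k # K))" by (rule skew_Cons)
    then show ?thesis using Cons Cons.IH[of "length L" "\<lambda>K. u (k # K)" "\<lambda>l K. E l (k # K)"] by simp
  qed
  have "altd (?D u E) (x # J) = ?D u E x J - altd (\<lambda>j K. ?D u E j (x # K)) J" by simp
  \<comment> \<open>The second derivatives occur once in \<open>pullD\<close>, in direction
    \<open>x\<close>, and once inside \<open>altd\<close> over the remaining indices;
    \<open>pullD_eq_altd\<close> makes them cancel.\<close>
  also have "\<dots> = (\<Sum>l\<in>UNIV. M l x * pull M (E l) J) -
      (\<Sum>k\<in>UNIV. M k x * pull M (altd (\<lambda>l K. E l (k # K))) J)"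
    unfolding e IH pullD_eq_altd[of N, OF S sk] by simp
  also have "\<dots> = pull M (altd E) (x # J)"
    by (simp add: pull_diff sum_subtractf algebra_simps)
  finally show ?case .
qed simp

text \<open>All \<open>Suc p\<close> terms of \<open>altd\<close> contribute equally: against a skew
  \<open>v\<close> the differentiated index can be brought to the front.\<close>

lemma ip_altd:
  "skew (Suc p) v \<Longrightarrow> ip H (Suc p) (altd D) v =
    of_nat (Suc p) * (\<Sum>l\<in>UNIV. \<Sum>k\<in>UNIV. H l k * ip H p (D l) (\<lambda>K. v (k # K)))"
proof (induction p arbitrary: D v)
  case (Suc p)
  let ?S = "\<Sum>l\<in>UNIV. \<Sum>k\<in>UNIV. H l k * ip H (Suc p) (D l) (\<lambda>K. v (k # K))"
  let ?t = "\<lambda>l k l' k'. H l k * (H l' k' * ip H p (\<lambda>K. D l' (l # K)) (\<lambda>K. v (k # k' # K)))"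
  have sw: "ip H p a (\<lambda>K. v (k # k' # K)) = - ip H p a (\<lambda>K. v (k' # k # K))" for a k k'
    unfolding ip_uminus_right[symmetric]
    by (rule ip_cong[OF refl], rule skew_head[OF Suc.prems])
  have "ip H (Suc (Suc p)) (altd D) v =
    (\<Sum>l\<in>UNIV. \<Sum>k\<in>UNIV. H l k * (ip H (Suc p) (D l) (\<lambda>K. v (k # K))
       - ip H (Suc p) (altd (\<lambda>j K. D j (l # K))) (\<lambda>K. v (k # K))))"
    by (subst ip.simps) (simp only: altd_Cons ip_diff_left)
  also have "\<dots> = ?S - (\<Sum>l\<in>UNIV. \<Sum>k\<in>UNIV. of_nat (Suc p) * (\<Sum>l'\<in>UNIV. \<Sum>k'\<in>UNIV. ?t l k l' k'))"
    unfolding Suc.IH[OF skew_Cons[OF Suc.prems]]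
    by (simp only: right_diff_distrib sum_subtractf) (simp add: sum_distrib_left mult_ac)
  also have "(\<Sum>l\<in>UNIV. \<Sum>k\<in>UNIV. of_nat (Suc p) * (\<Sum>l'\<in>UNIV. \<Sum>k'\<in>UNIV. ?t l k l' k')) =
     of_nat (Suc p) * (\<Sum>l\<in>UNIV. \<Sum>k\<in>UNIV. \<Sum>l'\<in>UNIV. \<Sum>k'\<in>UNIV. ?t l k l' k')"
    by (simp only: sum_distrib_left)
  also have "(\<Sum>l\<in>UNIV. \<Sum>k\<in>UNIV. \<Sum>l'\<in>UNIV. \<Sum>k'\<in>UNIV. ?t l k l' k') =
     (\<Sum>l\<in>UNIV. \<Sum>l'\<in>UNIV. \<Sum>k\<in>UNIV. \<Sum>k'\<in>UNIV. ?t l k l' k')"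
    by (rule sum.cong[OF refl], rule sum.swap)
  also have "\<dots> = (\<Sum>l\<in>UNIV. \<Sum>l'\<in>UNIV. \<Sum>k'\<in>UNIV. \<Sum>k\<in>UNIV. ?t l k l' k')"
    by (rule sum.cong[OF refl], rule sum.cong[OF refl], rule sum.swap)
  also have "\<dots> = (\<Sum>l'\<in>UNIV. \<Sum>l\<in>UNIV. \<Sum>k'\<in>UNIV. \<Sum>k\<in>UNIV. ?t l k l' k')"
    by (rule sum.swap)
  also have "\<dots> = (\<Sum>l'\<in>UNIV. \<Sum>k'\<in>UNIV. \<Sum>l\<in>UNIV. \<Sum>k\<in>UNIV. ?t l k l' k')"
    by (rule sum.cong[OF refl], rule sum.swap)
  \<comment> \<open>After renaming the two index pairs only the order of \<open>k\<close> and
    \<open>k'\<close> in \<open>v\<close> differs from \<open>?S\<close>, which gives the sign. The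
    total is \<open>?S\<close> plus \<open>Suc p\<close> times \<open>?S\<close>.\<close>
  also have "\<dots> = - ?S"
    by (subst sw) (simp add: sum_distrib_left sum_negf mult_ac)
  finally show ?case by (simp add: algebra_simps)
qed simp

text \<open>The derivative of \<open>H \<mapsto> ip H p u v\<close> in direction \<open>H'\<close>.\<close>

primrec ipD :: "('n::finite \<Rightarrow> 'n \<Rightarrow> complex) \<Rightarrow> ('n \<Rightarrow> 'n \<Rightarrow> complex) \<Rightarrow> nat \<Rightarrow> ('n list \<Rightarrow> complex) \<Rightarrow> ('n list \<Rightarrow> complex) \<Rightarrow> complex"
  where
  "ipD H H' 0 u v = 0"
| "ipD H H' (Suc p) u v =
     (\<Sum>j\<in>UNIV. \<Sum>k\<in>UNIV. H' j k * ip H p (\<lambda>K. u (j # K)) (\<lambda>K. v (k # K)))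
     + (\<Sum>j\<in>UNIV. \<Sum>k\<in>UNIV. H j k * ipD H H' p (\<lambda>K. u (j # K)) (\<lambda>K. v (k # K)))"

lemma ipD_cong:
  "(\<And>K. length K = p \<Longrightarrow> v K = v' K) \<Longrightarrow> ipD H H' p u v = ipD H H' p u v'"
proof (induction p arbitrary: u v v')
  case (Suc p)
  have "ip H p a (\<lambda>K. v (k # K)) = ip H p a (\<lambda>K. v' (k # K))"
       "ipD H H' p a (\<lambda>K. v (k # K)) = ipD H H' p a (\<lambda>K. v' (k # K))" for a k
    using Suc.prems by (auto intro!: ip_cong Suc.IH)
  then show ?case by simp
qed simp

lemma ipD_uminus_right: "ipD H H' p u (\<lambda>K. - v K) = - ipD H H' p u v"
  by (induction p arbitrary: u v) (simp_all add: ip_uminus_right sum_negf)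

lemma sum_sym_skew:
  fixes S :: "'n::finite \<Rightarrow> 'n \<Rightarrow> complex"
  assumes "\<And>a b. S a b = S b a" and "\<And>a b. T a b = - T b a"
  shows "(\<Sum>a\<in>UNIV. \<Sum>b\<in>UNIV. S a b * T a b) = 0"
proof -
  have "(\<Sum>a\<in>UNIV. \<Sum>b\<in>UNIV. S a b * T a b) = (\<Sum>b\<in>UNIV. \<Sum>a\<in>UNIV. S a b * T a b)"
    by (rule sum.swap)
  also have "\<dots> = (\<Sum>b\<in>UNIV. \<Sum>a\<in>UNIV. - (S b a * T b a))"
    by (intro sum.cong refl) (metis assms mult_minus_right)
  also have "\<dots> = - (\<Sum>a\<in>UNIV. \<Sum>b\<in>UNIV. S a b * T a b)"
    by (simp add: sum_negf)
  finally show ?thesis by simp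
qed

text \<open>For \<open>H' l\<close> the derivative of the inverse metric in direction
  \<open>l\<close>, the hypothesis is what the Kaehler condition provides. If the derivative falls
  on the first factor, an expression symmetric in \<open>k\<close>, \<open>m\<close> meets the skew
  \<open>v (k # m # K)\<close>; if it falls on a later one, \<open>k\<close> is moved past
  \<open>m\<close> and the induction hypothesis applies.\<close>

lemma ipD_skew:
  fixes H :: "'n::finite \<Rightarrow> 'n \<Rightarrow> complex"
  assumes S: "\<And>j k m. (\<Sum>l\<in>UNIV. H l k * H' l j m) = (\<Sum>l\<in>UNIV. H l m * H' l j k)"
  shows "skew (Suc p) v \<Longrightarrow> (\<Sum>l\<in>UNIV. \<Sum>k\<in>UNIV. H l k * ipD H (H' l) p u (\<lambda>K. v (k # K))) = 0"
proof (induction p arbitrary: u v)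
  case (Suc p)
  have sk: "length K = p \<Longrightarrow> v (k # m # K) = - v (m # k # K)" for k m K
    using skew_head[OF Suc.prems] by blast
  have swD: "ipD H H' p a (\<lambda>K. v (k # m # K)) = - ipD H H' p a (\<lambda>K. v (m # k # K))" for H' a k m
    unfolding ipD_uminus_right[symmetric] by (rule ipD_cong, rule sk)
  have sw: "ip H p a (\<lambda>K. v (k # m # K)) = - ip H p a (\<lambda>K. v (m # k # K))" for a k m
    unfolding ip_uminus_right[symmetric] by (rule ip_cong[OF refl], rule sk)
  let ?a = "\<lambda>l k j m. H l k * (H' l j m * ip H p (\<lambda>K. u (j # K)) (\<lambda>K. v (k # m # K)))"
  let ?b = "\<lambda>l k j m. H l k * (H j m * ipD H (H' l) p (\<lambda>K. u (j # K)) (\<lambda>K. v (k # m # K)))"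
  have perm: "(\<Sum>l\<in>UNIV. \<Sum>k\<in>UNIV. \<Sum>j\<in>UNIV. \<Sum>m\<in>UNIV. f l k j m) =
        (\<Sum>j\<in>UNIV. \<Sum>m\<in>UNIV. \<Sum>l\<in>UNIV. \<Sum>k\<in>UNIV. f l k j m)" for f :: "'n \<Rightarrow> 'n \<Rightarrow> 'n \<Rightarrow> 'n \<Rightarrow> complex"
  proof -
    have "(\<Sum>l\<in>UNIV. \<Sum>k\<in>UNIV. \<Sum>j\<in>UNIV. \<Sum>m\<in>UNIV. f l k j m) =
      (\<Sum>l\<in>UNIV. \<Sum>j\<in>UNIV. \<Sum>k\<in>UNIV. \<Sum>m\<in>UNIV. f l k j m)"
      by (rule sum.cong[OF refl], rule sum.swap)
    also have "\<dots> = (\<Sum>l\<in>UNIV. \<Sum>j\<in>UNIV. \<Sum>m\<in>UNIV. \<Sum>k\<in>UNIV. f l k j m)"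
      by (rule sum.cong[OF refl], rule sum.cong[OF refl], rule sum.swap)
    also have "\<dots> = (\<Sum>j\<in>UNIV. \<Sum>l\<in>UNIV. \<Sum>m\<in>UNIV. \<Sum>k\<in>UNIV. f l k j m)"
      by (rule sum.swap)
    also have "\<dots> = (\<Sum>j\<in>UNIV. \<Sum>m\<in>UNIV. \<Sum>l\<in>UNIV. \<Sum>k\<in>UNIV. f l k j m)"
      by (rule sum.cong[OF refl], rule sum.swap)
    finally show ?thesis .
  qed
  have A: "(\<Sum>l\<in>UNIV. \<Sum>k\<in>UNIV. \<Sum>j\<in>UNIV. \<Sum>m\<in>UNIV. ?a l k j m) = 0"
  proof -
    have "(\<Sum>m\<in>UNIV. \<Sum>l\<in>UNIV. \<Sum>k\<in>UNIV. ?a l k j m) = 0" for j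
    proof -
      have "(\<Sum>m\<in>UNIV. \<Sum>l\<in>UNIV. \<Sum>k\<in>UNIV. ?a l k j m) =
          (\<Sum>m\<in>UNIV. \<Sum>k\<in>UNIV. \<Sum>l\<in>UNIV. ?a l k j m)"
        by (rule sum.cong[OF refl], rule sum.swap)
      also have "\<dots> = (\<Sum>m\<in>UNIV. \<Sum>k\<in>UNIV. (\<Sum>l\<in>UNIV. H l k * H' l j m) *
          ip H p (\<lambda>K. u (j # K)) (\<lambda>K. v (k # m # K)))"
        by (simp add: sum_distrib_right mult_ac)
      also have "\<dots> = 0"
        by (rule sum_sym_skew, rule S, rule sw)
      finally show ?thesis .
    qed
    then show ?thesis by (simp add: perm)
  qed
  have B: "(\<Sum>l\<in>UNIV. \<Sum>k\<in>UNIV. \<Sum>j\<in>UNIV. \<Sum>m\<in>UNIV. ?b l k j m) = 0"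
  proof -
    have "(\<Sum>l\<in>UNIV. \<Sum>k\<in>UNIV. ?b l k j m) =
      - H j m * (\<Sum>l\<in>UNIV. \<Sum>k\<in>UNIV. H l k * ipD H (H' l) p (\<lambda>K. u (j # K)) (\<lambda>K. v (m # k # K)))" for j m
      by (subst swD) (simp add: sum_distrib_left sum_negf mult_ac)
    then have "(\<Sum>l\<in>UNIV. \<Sum>k\<in>UNIV. ?b l k j m) = 0" for j m
      using Suc.IH[OF skew_Cons[OF Suc.prems], of "\<lambda>K. u (j # K)" m] by simp
    then show ?thesis by (simp add: perm)
  qed
  have "(\<Sum>l\<in>UNIV. \<Sum>k\<in>UNIV. H l k * ipD H (H' l) (Suc p) u (\<lambda>K. v (k # K))) =
    (\<Sum>l\<in>UNIV. \<Sum>k\<in>UNIV. \<Sum>j\<in>UNIV. \<Sum>m\<in>UNIV. ?a l k j m) + (\<Sum>l\<in>UNIV. \<Sum>k\<in>UNIV. \<Sum>j\<in>UNIV. \<Sum>m\<in>UNIV. ?b l k j m)"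
    by (simp add: distrib_left sum.distrib sum_distrib_left)
  then show ?case using A B by simp
qed simp

section \<open>Skew-symmetry under arbitrary permutations\<close>

definition perm_skew :: "nat \<Rightarrow> ('n list \<Rightarrow> complex) \<Rightarrow> bool" where
  "perm_skew p u \<longleftrightarrow> (\<forall>J\<in>multi_idx p. \<forall>\<sigma>. \<sigma> permutes {..<p} \<longrightarrow>
     u (permute_list \<sigma> J) = of_int (sign \<sigma>) * u J)"

lemma permute_list_adjacent:
  "permute_list (Transposition.transpose (length X) (Suc (length X))) (X @ x # y # Y) = X @ y # x # Y"
    (is "permute_list ?t ?L = ?R")
proof (rule nth_equalityI)
  fix i assume "i < length (permute_list ?t ?L)"
  then have i: "i < length ?L" by simp
  have "permute_list ?t ?L ! i = ?L ! ?t i"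
    using i by (simp add: permute_list_def del: length_append)
  also consider "i < length X" | "i = length X" | "i = Suc (length X)" | j where "i = length X + Suc (Suc j)"
    by (metis add_Suc_right less_iff_Suc_add linorder_neqE_nat not_less_eq)
  then have "?L ! ?t i = ?R ! i"
    by cases (simp_all add: Transposition.transpose_def nth_append)
  finally show "permute_list ?t ?L ! i = ?R ! i" .
qed simp

text \<open>Induction on the distance \<open>b - a\<close>: conjugation by the transposition of
  \<open>b - 1\<close> and \<open>b\<close> turns the transposition of \<open>a\<close> and
  \<open>b\<close> into that of \<open>a\<close> and \<open>b - 1\<close>, and three sign changes
  make one.\<close>

lemma perm_skew_transpose:
  assumes "skew p u" "length J = p" "a < b" "b < p"
  shows "u (permute_list (Transposition.transpose a b) J) = - u J"
  using assms(2-)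
proof (induction "b - a" arbitrary: a b J)
  case 0
  then show ?case by simp
next
  case (Suc d)
  let ?t = "Transposition.transpose (b - 1) b"
  show ?case
  proof (cases "b = Suc a")
    case True
    define X where "X = take a J"
    define Y where "Y = drop (Suc (Suc a)) J"
    have J: "J = X @ J ! a # J ! b # Y" "length X = a"
      using Suc.prems True unfolding X_def Y_def
      by (auto simp: Cons_nth_drop_Suc)
    have "permute_list (Transposition.transpose a b) J = X @ J ! b # J ! a # Y"
      using permute_list_adjacent[of X "J ! a" "J ! b" Y] J True by simp
    moreover have "length X + length Y + 2 = p" using Suc.prems J(2) True unfolding Y_def by simp
    ultimately show ?thesis using skewD[OF assms(1), of X Y] J(1) by metis
  next
    case False
    have adj: "u (permute_list ?t L) = - u L" if "length L = p" for L
    proof -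
      define X where "X = take (b - 1) L"
      define Y where "Y = drop (Suc b) L"
      have J: "L = X @ L ! (b - 1) # L ! b # Y" "length X = b - 1"
        using Suc.prems that Cons_nth_drop_Suc[of "b - 1" L] unfolding X_def Y_def
        by (auto simp: Cons_nth_drop_Suc)
      have "permute_list ?t L = X @ L ! b # L ! (b - 1) # Y"
        using permute_list_adjacent[of X "L ! (b - 1)" "L ! b" Y] J Suc.prems by simp
      moreover have "length X + length Y + 2 = p" using Suc.prems J(2) that unfolding Y_def by simp
      ultimately show ?thesis using skewD[OF assms(1), of X Y] J(1) by metis
    qed
    have tp: "?t permutes {..<length J}" "Transposition.transpose a (b - 1) permutes {..<length J}"
      using Suc.prems by (auto intro!: permutes_swap_id)
    have "Transposition.transpose a b = (?t \<circ> Transposition.transpose a (b - 1)) \<circ> ?t"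
      using Suc.prems False by (auto simp: fun_eq_iff Transposition.transpose_def)
    then have "permute_list (Transposition.transpose a b) J =
        permute_list ?t (permute_list (Transposition.transpose a (b - 1)) (permute_list ?t J))"
      using tp by (simp add: permute_list_compose)
    moreover have "u (permute_list (Transposition.transpose a (b - 1)) (permute_list ?t J)) =
        - u (permute_list ?t J)"
      using Suc.hyps Suc.prems False by (intro Suc.hyps(1)) auto
    ultimately show ?thesis
      using adj[OF Suc.prems(1)] adj[of "permute_list (Transposition.transpose a (b - 1)) (permute_list ?t J)"] Suc.prems(1)
      by simp
  qed
qed

lemma perm_skew_iff: "perm_skew p u \<longleftrightarrow> skew p u"
proof
  assume u: "perm_skew p u"
  show "skew p u" unfolding skew_def
  proof (intro allI impI)
    fix X Y :: "'a list" and x y assume l: "length X + length Y + 2 = p"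
    have "Transposition.transpose (length X) (Suc (length X)) permutes {..<p}"
      using l by (intro permutes_swap_id) auto
    then have "u (permute_list (Transposition.transpose (length X) (Suc (length X))) (X @ x # y # Y)) = - u (X @ x # y # Y)"
      using u l unfolding perm_skew_def multi_idx_def by (simp add: sign_swap_id)
    then show "u (X @ x # y # Y) = - u (X @ y # x # Y)"
      by (simp add: permute_list_adjacent)
  qed
next
  assume u: "skew p u"
  have "u (permute_list \<sigma> J) = of_int (sign \<sigma>) * u J" if "\<sigma> permutes {..<p}" "length J = p" for \<sigma> J
    using that(2)
  \<comment> \<open>Transpositions are multiplied on the right: \<open>permute_list\<close> reverses
    compositions, so a right factor acts last and \<open>perm_skew_transpose\<close> applies to
    it.\<close>
  proof (induction arbitrary: J rule: permutes_rev_induct[OF finite_lessThan that(1)])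
    case 1
    then show ?case by simp
  next
    case (2 a b q)
    have t: "Transposition.transpose a b permutes {..<p}" using 2 by (intro permutes_swap_id) auto
    have "u (permute_list (Transposition.transpose a b) L) = - u L" if "length L = p" for L
      using perm_skew_transpose[OF u that, of a b] perm_skew_transpose[OF u that, of b a] 2
      by (cases "a < b") (auto simp: Transposition.transpose_commute)
    moreover have "sign (q \<circ> Transposition.transpose a b) = - sign q"
      using 2 by (simp add: sign_compose permutes_imp_permutation[OF finite_lessThan] sign_swap_id permutation_swap_id)
    moreover have "permute_list (q \<circ> Transposition.transpose a b) J =
        permute_list (Transposition.transpose a b) (permute_list q J)"
      by (rule permute_list_compose) (use t 2 in auto)
    ultimately have "u (permute_list (q \<circ> Transposition.transpose a b) J) =
        of_int (sign (q \<circ> Transposition.transpose a b)) * u J"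
      using 2 by simp
    then show ?case by (simp add: o_def)
  qed
  then show "perm_skew p u" unfolding perm_skew_def multi_idx_def by blast
qed

text \<open>The skew-symmetric coefficients of the constant form \<open>dz^K\<close>; they vanish if
  an index is repeated in \<open>K\<close>.\<close>

definition alt_unit :: "'n list \<Rightarrow> 'n list \<Rightarrow> complex" where
  "alt_unit K J = (\<Sum>\<sigma> | \<sigma> permutes {..<length K}. of_int (sign \<sigma>) * of_bool (permute_list \<sigma> K = J))"

lemma skew_alt_unit: "skew (length K) (alt_unit K)"
  unfolding perm_skew_iff[symmetric] perm_skew_def
proof (intro ballI allI impI)
  fix J :: "'a list" and \<tau> assume J: "J \<in> multi_idx (length K)" and t: "\<tau> permutes {..<length K}"
  have l: "length J = length K" using J by (simp add: multi_idx_def)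
  have eq: "permute_list (\<sigma> \<circ> \<tau>) K = permute_list \<tau> J \<longleftrightarrow> permute_list \<sigma> K = J"
    if s: "\<sigma> permutes {..<length K}" for \<sigma>
  proof
    assume *: "permute_list (\<sigma> \<circ> \<tau>) K = permute_list \<tau> J"
    have inv: "permute_list (inv \<tau>) (permute_list \<tau> L) = L" if "length L = length K" for L :: "'a list"
      using permute_list_compose[of "inv \<tau>" L \<tau>] permutes_inv[OF t] that permutes_inv_o(1)[OF t] by simp
    have "permute_list \<tau> (permute_list \<sigma> K) = permute_list \<tau> J"
      using * t by (simp add: permute_list_compose)
    then show "permute_list \<sigma> K = J" using inv l by (metis length_permute_list)
  qed (use t in \<open>simp add: permute_list_compose\<close>)
  have "alt_unit K (permute_list \<tau> J) =
     (\<Sum>\<sigma> | \<sigma> permutes {..<length K}. of_int (sign (\<sigma> \<circ> \<tau>)) * of_bool (permute_list (\<sigma> \<circ> \<tau>) K = permute_list \<tau> J))"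
    unfolding alt_unit_def by (rule sum_permutations_compose_right[OF t])
  also have "\<dots> = (\<Sum>\<sigma> | \<sigma> permutes {..<length K}. of_int (sign \<tau>) * (of_int (sign \<sigma>) * of_bool (permute_list \<sigma> K = J)))"
    by (rule sum.cong[OF refl])
      (use t in \<open>auto simp: eq sign_compose permutes_imp_permutation[OF finite_lessThan]\<close>)
  finally show "alt_unit K (permute_list \<tau> J) = of_int (sign \<tau>) * alt_unit K J"
    unfolding alt_unit_def by (simp add: sum_distrib_left)
qed

text \<open>Every permutation contributes its sign twice, hence \<open>w K\<close> again. Pairing
  with \<open>dz^K\<close> thus reads off one coefficient of a skew family.\<close>

lemma sum_alt_unit:
  fixes K :: "'n::finite list"
  assumes "skew (length K) w"
  shows "(\<Sum>J\<in>multi_idx (length K). alt_unit K J * w J) = fact (length K) * w K"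
proof -
  have "(\<Sum>J\<in>multi_idx (length K). alt_unit K J * w J) =
    (\<Sum>J\<in>multi_idx (length K). \<Sum>\<sigma> | \<sigma> permutes {..<length K}.
       of_int (sign \<sigma>) * (if permute_list \<sigma> K = J then w J else 0))"
    unfolding alt_unit_def sum_distrib_right by (intro sum.cong) auto
  also have "\<dots> = (\<Sum>\<sigma> | \<sigma> permutes {..<length K}. of_int (sign \<sigma>) *
      (\<Sum>J\<in>multi_idx (length K). (if permute_list \<sigma> K = J then w J else 0)))"
    unfolding sum_distrib_left by (rule sum.swap)
  also have "\<dots> = (\<Sum>\<sigma> | \<sigma> permutes {..<length K}. w K)"
  proof (intro sum.cong refl)
    fix \<sigma> assume "\<sigma> \<in> {\<sigma>. \<sigma> permutes {..<length K}}"
    then have "w (permute_list \<sigma> K) = of_int (sign \<sigma>) * w K"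
      using assms unfolding perm_skew_iff[symmetric] perm_skew_def by (auto simp: multi_idx_def)
    moreover have "(of_int (sign \<sigma>) * of_int (sign \<sigma>) :: complex) = 1"
      by (metis of_int_1 of_int_mult sign_idempotent)
    ultimately show "of_int (sign \<sigma>) *
      (\<Sum>J\<in>multi_idx (length K). (if permute_list \<sigma> K = J then w J else 0)) = w K"
      unfolding sum.delta'[OF finite_multi_idx]
      by (simp add: multi_idx_def mult.assoc[symmetric])
  qed
  also have "\<dots> = fact (length K) * w K"
    using card_permutations[of "{..<length K}" "length K"] by simp
  finally show ?thesis .
qed

subsection \<open>Positive definite Hermitian matrices\<close>

text \<open>Induction on the index set, splitting off one index by a Schur complement. Working on
  subsets of the index type avoids matrices of changing size.\<close>

lemma cholesky_on:
  fixes H :: "'n \<Rightarrow> 'n \<Rightarrow> complex"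
  assumes "finite S"
    and "\<And>j k. H k j = cnj (H j k)"
    and "\<And>v. (\<exists>j\<in>S. v j \<noteq> 0) \<Longrightarrow> Re (\<Sum>j\<in>S. \<Sum>k\<in>S. H j k * v j * cnj (v k)) > 0"
  shows "\<exists>b. \<forall>j\<in>S. \<forall>k\<in>S. H j k = (\<Sum>r\<in>S. b r j * cnj (b r k))"
  using assms
proof (induction S arbitrary: H rule: finite_induct)
  case (insert s S)
  note herm = insert.prems(1)
  note pd = insert.prems(2)
  define d where "d = Re (H s s)"
  have Hss: "H s s = of_real d"
    using herm[of s s] unfolding d_def by (simp add: complex_eq_iff)
  have d: "d > 0"
  proof -
    have "(\<Sum>j\<in>insert s S. \<Sum>k\<in>insert s S. H j k * (if j = s then 1 else 0) * cnj (if k = s then 1 else 0)) = H s s"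
      (is "?l = _")
    proof -
      have "?l = (\<Sum>j\<in>insert s S. if j = s then (\<Sum>k\<in>insert s S. if k = s then H s s else 0) else 0)"
        by (intro sum.cong refl) (auto intro!: sum.cong)
      then show ?thesis using insert.hyps by (simp add: sum.delta del: sum.insert)
    qed
    then show ?thesis using pd[of "\<lambda>j. if j = s then 1 else 0"] unfolding d_def by simp
  qed
  \<comment> \<open>The Schur complement of the entry at \<open>s\<close>.\<close>
  define H' where "H' j k = H j k - H j s * H s k / of_real d" for j k
  have herm': "H' k j = cnj (H' j k)" for j k
    unfolding H'_def by (simp add: herm[of j k] herm[of s j] herm[of k s] mult.commute)
  have pd': "Re (\<Sum>j\<in>S. \<Sum>k\<in>S. H' j k * v j * cnj (v k)) > 0" if v: "\<exists>j\<in>S. v j \<noteq> 0" for v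
  proof -
    define B where "B = (\<Sum>j\<in>S. H j s * v j)"
    \<comment> \<open>Completing the square in the coordinate \<open>s\<close>: with this value the
      form of \<open>H\<close> at \<open>w\<close> equals the form of \<open>H'\<close> at
      \<open>v\<close>.\<close>
    define w where "w = v(s := - B / of_real d)"
    have wS: "w j = v j" if "j \<in> S" for j using that insert.hyps unfolding w_def by auto
    have ws: "w s = - B / of_real d" unfolding w_def by simp
    have cB: "(\<Sum>k\<in>S. H s k * cnj (v k)) = cnj B"
      unfolding B_def by (simp add: herm[of s])
    have "(\<Sum>j\<in>insert s S. \<Sum>k\<in>insert s S. H j k * w j * cnj (w k)) =
       H s s * w s * cnj (w s) + (\<Sum>k\<in>S. H s k * w s * cnj (w k)) +
       (\<Sum>j\<in>S. H j s * w j * cnj (w s)) + (\<Sum>j\<in>S. \<Sum>k\<in>S. H j k * w j * cnj (w k))"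
      using insert.hyps by (simp add: sum.distrib)
    also have "(\<Sum>k\<in>S. H s k * w s * cnj (w k)) = w s * cnj B"
      unfolding cB[symmetric] sum_distrib_left by (rule sum.cong) (auto simp: wS)
    also have "(\<Sum>j\<in>S. H j s * w j * cnj (w s)) = cnj (w s) * B"
      unfolding B_def sum_distrib_left by (rule sum.cong) (auto simp: wS)
    also have "(\<Sum>j\<in>S. \<Sum>k\<in>S. H j k * w j * cnj (w k)) = (\<Sum>j\<in>S. \<Sum>k\<in>S. H j k * v j * cnj (v k))"
      by (intro sum.cong) (auto simp: wS)
    also have "H s s * w s * cnj (w s) + w s * cnj B + cnj (w s) * B +
        (\<Sum>j\<in>S. \<Sum>k\<in>S. H j k * v j * cnj (v k)) =
        (\<Sum>j\<in>S. \<Sum>k\<in>S. H j k * v j * cnj (v k)) - B * cnj B / of_real d"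
      using d unfolding ws Hss by (simp add: field_simps)
    also have "B * cnj B / of_real d = (\<Sum>j\<in>S. \<Sum>k\<in>S. H j s * H s k / of_real d * v j * cnj (v k))"
      unfolding cB[symmetric] unfolding B_def sum_product sum_divide_distrib by (simp add: mult_ac)
    also have "(\<Sum>j\<in>S. \<Sum>k\<in>S. H j k * v j * cnj (v k)) - \<dots> = (\<Sum>j\<in>S. \<Sum>k\<in>S. H' j k * v j * cnj (v k))"
      unfolding H'_def by (simp add: sum_subtractf algebra_simps)
    finally show ?thesis
      using pd[of w] v wS by fastforce
  qed
  obtain b where b: "\<And>j k. j \<in> S \<Longrightarrow> k \<in> S \<Longrightarrow> H' j k = (\<Sum>r\<in>S. b r j * cnj (b r k))"
    using insert.IH[OF herm' pd'] by blast
  \<comment> \<open>Row \<open>s\<close> of the factor restores the rank one term subtracted in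
    \<open>H'\<close>; the other rows get the entry 0 at \<open>s\<close>.\<close>
  define c where "c r j = (if r = s then H j s / of_real (sqrt d) else if j = s then 0 else b r j)" for r j
  have sq: "(complex_of_real (sqrt d)) * of_real (sqrt d) = of_real d"
    using d by (simp flip: of_real_mult)
  have "H j k = (\<Sum>r\<in>insert s S. c r j * cnj (c r k))" if jk: "j \<in> insert s S" "k \<in> insert s S" for j k
  proof -
    have "(\<Sum>r\<in>insert s S. c r j * cnj (c r k)) = H j s * cnj (H k s) / (of_real (sqrt d) * of_real (sqrt d)) + (\<Sum>r\<in>S. c r j * cnj (c r k))"
      using insert.hyps by (simp add: c_def)
    also have "H j s * cnj (H k s) / (of_real (sqrt d) * of_real (sqrt d)) = H j s * H s k / of_real d"
      unfolding sq using herm[of s k] herm[of k s] by simp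
    also have "(\<Sum>r\<in>S. c r j * cnj (c r k)) = (if j = s \<or> k = s then 0 else H' j k)"
    proof (cases "j = s \<or> k = s")
      case True
      have "(\<Sum>r\<in>S. c r j * cnj (c r k)) = 0"
        by (rule sum.neutral) (use True insert.hyps in \<open>auto simp: c_def\<close>)
      then show ?thesis using True by simp
    next
      case False
      have "(\<Sum>r\<in>S. c r j * cnj (c r k)) = (\<Sum>r\<in>S. b r j * cnj (b r k))"
        by (rule sum.cong) (use False insert.hyps in \<open>auto simp: c_def\<close>)
      then show ?thesis using False b jk by auto
    qed
    also have "H j s * H s k / of_real d + \<dots> = H j k"
      using d Hss unfolding H'_def by auto
    finally show ?thesis ..
  qed
  then show ?case by (intro exI[of _ c] ballI)
next
  case empty
  show ?case by simp
qed

lemma matrix_inv_eqI: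
  fixes A B :: "'a::field^'n^'n"
  assumes "A ** B = mat 1" "B ** A = mat 1"
  shows "matrix_inv A = B"
proof -
  have "A ** matrix_inv A = mat 1 \<and> matrix_inv A ** A = mat 1"
    unfolding matrix_inv_def by (rule someI[of _ B]) (use assms in blast)
  then show ?thesis
    by (metis assms(2) matrix_mul_assoc matrix_mul_lid matrix_mul_rid)
qed

lemma det_cnj: "det (\<chi> i j. cnj (B $ i $ j)) = cnj (det (B :: complex^'n^'n))"
  unfolding det_def by (simp add: cnj_sum cnj_prod)

locale pos_def_hermitian =
  fixes G :: "complex^'n::finite^'n"
  assumes herm: "G $ k $ j = cnj (G $ j $ k)"
    and pd: "v \<noteq> 0 \<Longrightarrow> Re (\<Sum>j\<in>UNIV. \<Sum>k\<in>UNIV. G $ j $ k * v $ j * cnj (v $ k)) > 0"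
begin

text \<open>The inverse of a Gram matrix is again a Gram matrix, with \<open>C\<close> the inverse
  of \<open>B\<close>. The factor \<open>B\<close> gives the positivity of the determinant, the
  factor \<open>C\<close> the inner product on forms.\<close>

lemma cholesky:
  obtains B C :: "complex^'n^'n" where
    "B ** C = mat 1" "C ** B = mat 1"
    "\<And>j k. G $ j $ k = (\<Sum>r\<in>UNIV. B $ j $ r * cnj (B $ k $ r))"
    "\<And>j k. transpose (matrix_inv G) $ j $ k = (\<Sum>r\<in>UNIV. C $ r $ j * cnj (C $ r $ k))"
    "det G = of_real ((norm (det B))\<^sup>2)" "det B \<noteq> 0"
proof -
  have "\<exists>b :: 'n \<Rightarrow> 'n \<Rightarrow> complex. \<forall>j\<in>UNIV. \<forall>k\<in>UNIV. G $ j $ k = (\<Sum>r\<in>UNIV. b r j * cnj (b r k))"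
  proof (rule cholesky_on[where H = "\<lambda>j k. G $ j $ k"])
    show "finite (UNIV :: 'n set)" by simp
    show "G $ k $ j = cnj (G $ j $ k)" for j k by (rule herm)
    fix v :: "'n \<Rightarrow> complex" assume "\<exists>j\<in>UNIV. v j \<noteq> 0"
    then have "(\<chi> j. v j) \<noteq> 0" by (auto simp: vec_eq_iff)
    from pd[OF this] show "Re (\<Sum>j\<in>UNIV. \<Sum>k\<in>UNIV. G $ j $ k * v j * cnj (v k)) > 0"
      by simp
  qed
  then obtain b :: "'n \<Rightarrow> 'n \<Rightarrow> complex" where b: "\<And>j k. G $ j $ k = (\<Sum>r\<in>UNIV. b r j * cnj (b r k))" by blast
  define B :: "complex^'n^'n" where "B = (\<chi> j r. b r j)"
  define Bs :: "complex^'n^'n" where "Bs = (\<chi> r k. cnj (B $ k $ r))"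
  have GB: "G = B ** Bs"
    by (simp add: vec_eq_iff b B_def Bs_def matrix_matrix_mult_def)
  have dBs: "det Bs = cnj (det B)"
  proof -
    have "Bs = transpose (\<chi> i j. cnj (B $ i $ j))" by (simp add: Bs_def transpose_def)
    then show ?thesis by (simp add: det_cnj)
  qed
  \<comment> \<open>The transpose fits the convention for the form: the sum of
    \<open>G $ j $ k * v $ j\<close> over \<open>j\<close> is a component of
    \<open>transpose G *v v\<close>, so a kernel vector makes the form vanish.\<close>
  have "\<exists>X. X ** transpose G = mat 1"
    unfolding matrix_left_invertible_ker
  proof (intro allI impI)
    fix v assume v: "transpose G *v v = 0"
    have "(\<Sum>j\<in>UNIV. \<Sum>k\<in>UNIV. G $ j $ k * v $ j * cnj (v $ k)) =
      (\<Sum>k\<in>UNIV. (\<Sum>j\<in>UNIV. G $ j $ k * v $ j) * cnj (v $ k))"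
      by (subst sum.swap) (simp add: sum_distrib_right)
    also have "\<dots> = 0"
      using v by (simp add: matrix_vector_mult_def transpose_def vec_eq_iff)
    finally show "v = 0" using pd[of v] by auto
  qed
  then have "det G \<noteq> 0" by (metis det_transpose invertible_det_nz invertible_left_inverse)
  then have dB: "det B \<noteq> 0" unfolding GB det_mul by auto
  define C where "C = matrix_inv B"
  obtain B' where B': "B ** B' = mat 1" "B' ** B = mat 1"
    using dB invertible_det_nz invertible_def by metis
  then have "C = B'" unfolding C_def by (rule matrix_inv_eqI)
  with B' have BC: "B ** C = mat 1" "C ** B = mat 1" by auto
  define Cs :: "complex^'n^'n" where "Cs = (\<chi> k r. cnj (C $ r $ k))"
  have mul: "(\<chi> k r. cnj (X $ r $ k)) ** (\<chi> k r. cnj (Y $ r $ k)) = (\<chi> k r. cnj ((Y ** X) $ r $ k))"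
    for X Y :: "complex^'n^'n"
    by (simp add: vec_eq_iff matrix_matrix_mult_def mult.commute)
  have one: "(\<chi> k r. cnj ((mat 1 :: complex^'n^'n) $ r $ k)) = mat 1"
    by (simp add: vec_eq_iff mat_def)
  have C2: "Bs ** Cs = mat 1" "Cs ** Bs = mat 1"
    unfolding Bs_def Cs_def mul BC one by auto
  have "B ** Bs ** (Cs ** C) = B ** (Bs ** Cs) ** C"
    by (simp add: matrix_mul_assoc)
  then have 1: "B ** Bs ** (Cs ** C) = mat 1" using BC C2 by simp
  have "(Cs ** C) ** (B ** Bs) = Cs ** (C ** B) ** Bs"
    by (simp add: matrix_mul_assoc)
  then have 2: "(Cs ** C) ** (B ** Bs) = mat 1" using BC C2 by simp
  have inv: "matrix_inv G = Cs ** C" unfolding GB by (rule matrix_inv_eqI[OF 1 2])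
  show thesis
  proof (rule that[OF BC])
    show "G $ j $ k = (\<Sum>r\<in>UNIV. B $ j $ r * cnj (B $ k $ r))" for j k
      by (simp add: b B_def)
    show "transpose (matrix_inv G) $ j $ k = (\<Sum>r\<in>UNIV. C $ r $ j * cnj (C $ r $ k))" for j k
      by (simp add: inv transpose_def matrix_matrix_mult_def Cs_def mult.commute)
    show "det G = of_real ((norm (det B))\<^sup>2)"
      unfolding GB det_mul dBs complex_norm_square ..
    show "det B \<noteq> 0" by (rule dB)
  qed
qed

lemma det_pos: "Re (det G) > 0" and det_real: "det G = of_real (Re (det G))"
  and det_nz: "det G \<noteq> 0"
  using cholesky by (metis Re_complex_of_real zero_less_norm_iff zero_less_power, metis Re_complex_of_real,
    metis of_real_eq_0_iff norm_eq_zero power_not_zero)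

lemma inverse: "G ** matrix_inv G = mat 1" "matrix_inv G ** G = mat 1"
  using det_nz invertible_det_nz[of G] unfolding invertible_def
  by (metis matrix_inv_eqI)+

lemma inverse_hermitian: "transpose (matrix_inv G) $ k $ j = cnj (transpose (matrix_inv G) $ j $ k)"
proof -
  obtain C :: "complex^'n^'n" where C:
    "\<And>j k. transpose (matrix_inv G) $ j $ k = (\<Sum>r\<in>UNIV. C $ r $ j * cnj (C $ r $ k))"
    by (rule cholesky) blast
  show ?thesis unfolding C cnj_sum complex_cnj_mult complex_cnj_cnj by (simp only: mult.commute)
qed

lemma gram:
  obtains C M :: "'n \<Rightarrow> 'n \<Rightarrow> complex" where
    "\<And>j k. transpose (matrix_inv G) $ j $ k = (\<Sum>r\<in>UNIV. C r j * cnj (C r k))"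
    "\<And>l j. (\<Sum>r\<in>UNIV. M r l * C r j :: complex) = (if l = j then 1 else 0)"
proof -
  obtain B C :: "complex^'n^'n" where BC: "B ** C = mat 1" "C ** B = mat 1"
    and C: "\<And>j k. transpose (matrix_inv G) $ j $ k = (\<Sum>r\<in>UNIV. C $ r $ j * cnj (C $ r $ k))"
    by (rule cholesky) blast
  show thesis
  proof (rule that[of "\<lambda>r j. C $ r $ j" "\<lambda>r l. B $ l $ r"])
    have "(\<Sum>r\<in>UNIV. B $ l $ r * C $ r $ j) = (B ** C) $ l $ j" for l j
      by (simp add: matrix_matrix_mult_def)
    then show "(\<Sum>r\<in>UNIV. B $ l $ r * C $ r $ j) = (if l = j then 1 else 0)" for l j
      unfolding BC by (simp add: mat_def)
  qed (rule C)
qed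

abbreviation "Hi \<equiv> \<lambda>j k. transpose (matrix_inv G) $ j $ k"

text \<open>\<open>pull\<close> by the Gram factor passes to an orthonormal frame, where the inner
  product is a sum of products: nonnegativity is a sum of squares, definiteness comes back through
  the inverse factor \<open>M\<close>, and the bound is the inequality of arithmetic and geometric
  means in each coordinate.\<close>

lemma ip_nonneg: "Re (ip Hi p u u) \<ge> 0" "ip Hi p u u = of_real (Re (ip Hi p u u))"
  and ip_eq_0: "ip Hi p u u = 0 \<Longrightarrow> length J = p \<Longrightarrow> u J = 0"
  and ip_bound: "norm (ip Hi p u v) \<le> (Re (ip Hi p u u) + Re (ip Hi p v v)) / 2"
proof -
  obtain C M :: "'n \<Rightarrow> 'n \<Rightarrow> complex" where CM: "\<And>j k. Hi j k = (\<Sum>r\<in>UNIV. C r j * cnj (C r k))"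
    "\<And>l j. (\<Sum>r\<in>UNIV. M r l * C r j :: complex) = (if l = j then 1 else 0)"
    using gram by blast
  let ?P = "pull (\<lambda>j r. C r j)"
  have e: "ip Hi p u v = (\<Sum>R\<in>multi_idx p. ?P u R * cnj (?P v R))" for u v
    by (rule ip_gram[OF CM(1)])
  have e2: "ip Hi p u u = of_real (\<Sum>R\<in>multi_idx p. (norm (?P u R))\<^sup>2)" for u
    unfolding e of_real_sum complex_norm_square ..
  show "Re (ip Hi p u u) \<ge> 0" "ip Hi p u u = of_real (Re (ip Hi p u u))"
    unfolding e2 by (simp_all add: sum_nonneg)
  {
    assume "ip Hi p u u = 0" and J: "length J = p"
    then have z: "?P u R = 0" if "length R = p" for R
      using that unfolding e2 of_real_eq_0_iff
      by (subst (asm) sum_nonneg_eq_0_iff) (simp_all add: multi_idx_def[of p, symmetric], simp add: multi_idx_def)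
    have "u J = pull (\<lambda>l j. M l j) (?P u) J"
    proof -
      have "(\<lambda>k x. \<Sum>l\<in>UNIV. C l k * M l x) = (\<lambda>k x. if k = x then 1 else 0)"
      proof (intro ext)
        show "(\<Sum>l\<in>UNIV. C l k * M l x) = (if k = x then 1 else 0)" for k x
          using CM(2)[of x k] by (simp only: mult.commute eq_commute)
      qed
      then show ?thesis unfolding pull_compose by (simp add: pull_id)
    qed
    also have "\<dots> = pull (\<lambda>l j. M l j) (\<lambda>K. 0) J"
      by (rule pull_cong) (use z J in auto)
    finally show "u J = 0" by simp
  }
  have "norm (ip Hi p u v) \<le> (\<Sum>R\<in>multi_idx p. norm (?P u R) * norm (?P v R))"
    unfolding e by (rule order_trans[OF norm_sum]) (simp add: norm_mult)
  also have "\<dots> \<le> (\<Sum>R\<in>multi_idx p. ((norm (?P u R))\<^sup>2 + (norm (?P v R))\<^sup>2) / 2)"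
  proof (rule sum_mono)
    fix R
    show "norm (?P u R) * norm (?P v R) \<le> ((norm (?P u R))\<^sup>2 + (norm (?P v R))\<^sup>2) / 2"
      using sum_squares_bound[of "norm (?P u R)" "norm (?P v R)"] by simp
  qed
  also have "\<dots> = (Re (ip Hi p u u) + Re (ip Hi p v v)) / 2"
    unfolding e2 by (simp add: sum.distrib sum_divide_distrib add_divide_distrib)
  finally show "norm (ip Hi p u v) \<le> (Re (ip Hi p u u) + Re (ip Hi p v v)) / 2" .
qed

end

declare Ck_on.simps [simp del]

subsection \<open>Continuously differentiable functions\<close>

abbreviation C1_on :: "'a::real_normed_vector set \<Rightarrow> ('a \<Rightarrow> 'b::real_normed_vector) \<Rightarrow> bool" where
  "C1_on S f \<equiv> Ck_on (Suc 0) S f"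

lemma C1_onI:
  assumes "\<And>x. x \<in> S \<Longrightarrow> (f has_derivative f' x) (at x)"
    and "\<And>v. continuous_on S (\<lambda>x. f' x v)"
  shows "C1_on S f"
proof -
  have "frechet_derivative f (at x) = f' x" if "x \<in> S" for x
    using frechet_derivative_at[OF assms(1)[OF that]] by simp
  then have "continuous_on S (\<lambda>x. frechet_derivative f (at x) v)" for v
    using assms(2)[of v] by (simp cong: continuous_on_cong)
  then show ?thesis using assms(1) by (auto simp: differentiable_def Ck_on.simps)
qed

lemma C1_on_has_derivative:
  "C1_on S f \<Longrightarrow> x \<in> S \<Longrightarrow> (f has_derivative frechet_derivative f (at x)) (at x)"
  by (simp add: frechet_derivative_works[symmetric] Ck_on.simps)

lemma C1_on_differentiable: "C1_on S f \<Longrightarrow> x \<in> S \<Longrightarrow> f differentiable (at x)"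
  by (simp add: Ck_on.simps)

lemma C1_on_continuous_derivative: "C1_on S f \<Longrightarrow> continuous_on S (\<lambda>x. frechet_derivative f (at x) v)"
  by (simp add: Ck_on.simps)

lemma C1_on_continuous: "C1_on S f \<Longrightarrow> continuous_on S f"
  using C1_on_differentiable differentiable_imp_continuous_within continuous_at_imp_continuous_on by blast

lemma C1_on_subset: "C1_on S f \<Longrightarrow> T \<subseteq> S \<Longrightarrow> C1_on T f"
  unfolding Ck_on.simps by (meson continuous_on_subset subsetD)

lemma smooth_on_C1: "smooth_on S f \<Longrightarrow> C1_on S f"
  unfolding smooth_on_def by (rule spec)

lemma C1_on_const: "C1_on S (\<lambda>x. c)"
  by (rule C1_onI[of _ _ "\<lambda>x v. 0"]) auto

lemma C1_on_add: "C1_on S f \<Longrightarrow> C1_on S g \<Longrightarrow> C1_on S (\<lambda>x. f x + g x)"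
  by (rule C1_onI[where f' = "\<lambda>x v. frechet_derivative f (at x) v + frechet_derivative g (at x) v"])
    (intro has_derivative_add C1_on_has_derivative continuous_on_add C1_on_continuous_derivative; assumption)+

lemma C1_on_mult:
  fixes f g :: "'a::real_normed_vector \<Rightarrow> 'b::real_normed_algebra"
  shows "C1_on S f \<Longrightarrow> C1_on S g \<Longrightarrow> C1_on S (\<lambda>x. f x * g x)"
  by (rule C1_onI[where f' = "\<lambda>x v. f x * frechet_derivative g (at x) v + frechet_derivative f (at x) v * g x"])
    (intro has_derivative_mult C1_on_has_derivative continuous_on_add continuous_on_mult C1_on_continuous
      C1_on_continuous_derivative; assumption)+

lemma C1_on_linear_id: "bounded_linear L \<Longrightarrow> C1_on S L"
  by (rule C1_onI[where f' = "\<lambda>x. L"]) (auto intro!: bounded_linear_imp_has_derivative)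

lemma C1_on_linear:
  assumes L: "bounded_linear L" and f: "C1_on S f"
  shows "C1_on S (\<lambda>x. L (f x))"
proof (rule C1_onI[where f' = "\<lambda>x v. L (frechet_derivative f (at x) v)"])
  show "((\<lambda>x. L (f x)) has_derivative (\<lambda>v. L (frechet_derivative f (at x) v))) (at x)" if "x \<in> S" for x
    by (rule bounded_linear.has_derivative[OF L C1_on_has_derivative[OF f that]])
  show "continuous_on S (\<lambda>x. L (frechet_derivative f (at x) v))" for v
    by (rule bounded_linear.continuous_on[OF L C1_on_continuous_derivative[OF f]])
qed

lemma C1_on_sum:
  assumes "\<And>i. i \<in> I \<Longrightarrow> C1_on S (f i)"
  shows "C1_on S (\<lambda>x. \<Sum>i\<in>I. f i x)"
  using assms
proof (induction I rule: infinite_finite_induct)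
  case (insert i I)
  have "C1_on S (f i)" "C1_on S (\<lambda>x. \<Sum>i\<in>I. f i x)"
    using insert by auto
  from C1_on_add[OF this] show ?case using insert.hyps by simp
qed (simp_all add: C1_on_const)

lemma C1_on_prod:
  fixes f :: "'i \<Rightarrow> 'a::real_normed_vector \<Rightarrow> 'b::{real_normed_algebra_1, comm_ring_1}"
  assumes "\<And>i. i \<in> I \<Longrightarrow> C1_on S (f i)"
  shows "C1_on S (\<lambda>x. \<Prod>i\<in>I. f i x)"
  using assms
proof (induction I rule: infinite_finite_induct)
  case (insert i I)
  have "C1_on S (f i)" "C1_on S (\<lambda>x. \<Prod>i\<in>I. f i x)"
    using insert by auto
  from C1_on_mult[OF this] show ?case using insert.hyps by simp
qed (simp_all add: C1_on_const)

lemma C1_on_compose_field: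
  fixes f :: "'a::real_normed_vector \<Rightarrow> 'b::real_normed_field"
  assumes "C1_on S f" "\<And>y. y \<in> f ` S \<Longrightarrow> (g has_field_derivative g' y) (at y)"
    "continuous_on (f ` S) g'"
  shows "C1_on S (\<lambda>x. g (f x))"
proof (rule C1_onI[where f' = "\<lambda>x v. g' (f x) * frechet_derivative f (at x) v"])
  fix x assume x: "x \<in> S"
  have "(g has_derivative (*) (g' (f x))) (at (f x))"
    using assms(2) x by (auto simp: has_field_derivative_def)
  from has_derivative_compose[OF C1_on_has_derivative[OF assms(1) x] this]
  show "((\<lambda>x. g (f x)) has_derivative (\<lambda>v. g' (f x) * frechet_derivative f (at x) v)) (at x)" .
next
  fix v
  have "continuous_on S (\<lambda>x. g' (f x))"
    by (rule continuous_on_compose2[OF assms(3) C1_on_continuous[OF assms(1)]]) auto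
  then show "continuous_on S (\<lambda>x. g' (f x) * frechet_derivative f (at x) v)"
    using C1_on_continuous_derivative[OF assms(1)] by (rule continuous_on_mult)
qed

lemma C1_on_inverse:
  fixes f :: "'a::real_normed_vector \<Rightarrow> 'b::real_normed_field"
  assumes "C1_on S f" "\<And>x. x \<in> S \<Longrightarrow> f x \<noteq> 0"
  shows "C1_on S (\<lambda>x. inverse (f x))"
proof (rule C1_on_compose_field[OF assms(1)])
  show "(inverse has_field_derivative - (inverse y ^ Suc (Suc 0))) (at y)" if "y \<in> f ` S" for y
    using that assms(2) by (intro DERIV_inverse) auto
  show "continuous_on (f ` S) (\<lambda>y. - (inverse y ^ Suc (Suc 0)))"
    using assms(2) by (intro continuous_intros) auto
qed

lemma C1_on_divide:
  fixes f :: "'a::real_normed_vector \<Rightarrow> 'b::real_normed_field"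
  assumes "C1_on S f" "C1_on S g" "\<And>x. x \<in> S \<Longrightarrow> g x \<noteq> 0"
  shows "C1_on S (\<lambda>x. f x / g x)"
  unfolding divide_inverse by (intro C1_on_mult C1_on_inverse assms)

lemma C1_on_exp:
  fixes f :: "'a::real_normed_vector \<Rightarrow> 'b::{real_normed_field,banach}"
  shows "C1_on S f \<Longrightarrow> C1_on S (\<lambda>x. exp (f x))"
  by (rule C1_on_compose_field[where g' = exp]) (auto intro!: DERIV_exp continuous_intros)

lemma C1_on_locally:
  assumes "\<And>x. x \<in> S \<Longrightarrow> \<exists>U. open U \<and> x \<in> U \<and> C1_on U f"
  shows "C1_on S f"
proof -
  have "f differentiable (at x)" if "x \<in> S" for x
    using assms[OF that] C1_on_differentiable by blast
  moreover have "continuous (at x within S) (\<lambda>x. frechet_derivative f (at x) v)" if x: "x \<in> S" for x v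
  proof -
    obtain U where "open U" "x \<in> U" "C1_on U f" using assms[OF x] by blast
    then have "continuous (at x) (\<lambda>x. frechet_derivative f (at x) v)"
      using C1_on_continuous_derivative continuous_on_eq_continuous_at by blast
    then show ?thesis by (rule continuous_at_imp_continuous_at_within)
  qed
  ultimately show ?thesis by (auto simp: continuous_on_eq_continuous_within Ck_on.simps)
qed

lemma C1_on_cong:
  assumes "open S" "C1_on S f" "\<And>x. x \<in> S \<Longrightarrow> f x = g x"
  shows "C1_on S g"
proof (rule C1_onI)
  show "(g has_derivative frechet_derivative f (at x)) (at x)" if "x \<in> S" for x
    by (rule has_derivative_transform_within_open[OF C1_on_has_derivative[OF assms(2) that] assms(1) that assms(3)])
  show "continuous_on S (\<lambda>x. frechet_derivative f (at x) v)" for v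
    by (rule C1_on_continuous_derivative[OF assms(2)])
qed

text \<open>\<open>S\<close> and the complement of \<open>K\<close> are two open sets that cover the
  space; on the second the extension is 0.\<close>

lemma C1_on_extend_zero:
  fixes f :: "'a::real_normed_vector \<Rightarrow> 'b::real_normed_vector"
  assumes "open S" "closed K" "K \<subseteq> S" "C1_on S f" "\<And>x. x \<in> S - K \<Longrightarrow> f x = 0"
  shows "C1_on UNIV (\<lambda>x. if x \<in> S then f x else 0)"
proof (rule C1_on_locally)
  fix x
  show "\<exists>U. open U \<and> x \<in> U \<and> C1_on U (\<lambda>x. if x \<in> S then f x else 0)"
  proof (cases "x \<in> S")
    case True
    have "C1_on S (\<lambda>x. if x \<in> S then f x else 0)"
      by (rule C1_on_cong[OF assms(1,4)]) auto
    then show ?thesis using True assms(1) by blast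
  next
    case False
    have "C1_on (- K) (\<lambda>x. if x \<in> S then f x else 0)"
      by (rule C1_on_cong[OF _ C1_on_const[of _ 0]]) (use assms(2,5) in \<open>auto simp: open_Compl\<close>)
    then show ?thesis using False assms(2,3) by (intro exI[of _ "- K"]) (auto simp: open_Compl)
  qed
qed

text \<open>\<open>Ck_on\<close> asks for continuity in the base point for each fixed direction;
  expanding the direction in the finite basis makes the derivative jointly continuous, as the chain
  rule \<open>C1_on_compose\<close> demands.\<close>

lemma C1_on_joint_continuous:
  fixes f :: "'a::euclidean_space \<Rightarrow> 'b::real_normed_vector"
  assumes "C1_on S f" "continuous_on T a" "a ` T \<subseteq> S" "continuous_on T b"
  shows "continuous_on T (\<lambda>x. frechet_derivative f (at (a x)) (b x))"
proof -
  have "frechet_derivative f (at (a x)) (b x) =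
    (\<Sum>i\<in>Basis. (b x \<bullet> i) *\<^sub>R frechet_derivative f (at (a x)) i)" if "x \<in> T" for x
  proof -
    have "linear (frechet_derivative f (at (a x)))"
      using assms that by (intro linear_frechet_derivative C1_on_differentiable[of S]) auto
    then show ?thesis
      by (subst (1) euclidean_representation[of "b x", symmetric]) (simp add: linear_sum linear_scale)
  qed
  moreover have "continuous_on T (\<lambda>x. \<Sum>i\<in>Basis. (b x \<bullet> i) *\<^sub>R frechet_derivative f (at (a x)) i)"
    using assms
    by (intro continuous_intros continuous_on_compose2[OF C1_on_continuous_derivative assms(2,3)]) auto
  ultimately show ?thesis by (simp cong: continuous_on_cong)
qed

lemma C1_on_compose:
  fixes f :: "'a::euclidean_space \<Rightarrow> 'b::real_normed_vector"
  assumes "C1_on S f" "C1_on T a" "a ` T \<subseteq> S"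
  shows "C1_on T (\<lambda>x. f (a x))"
proof (rule C1_onI[where f' = "\<lambda>x v. frechet_derivative f (at (a x)) (frechet_derivative a (at x) v)"])
  fix x assume x: "x \<in> T"
  then have "a x \<in> S" using assms(3) by auto
  from has_derivative_compose[OF C1_on_has_derivative[OF assms(2) x] C1_on_has_derivative[OF assms(1) this]]
  show "((\<lambda>x. f (a x)) has_derivative (\<lambda>v. frechet_derivative f (at (a x)) (frechet_derivative a (at x) v))) (at x)" .
next
  fix v
  show "continuous_on T (\<lambda>x. frechet_derivative f (at (a x)) (frechet_derivative a (at x) v))"
    by (rule C1_on_joint_continuous[OF assms(1) C1_on_continuous[OF assms(2)] assms(3)
          C1_on_continuous_derivative[OF assms(2)]])
qed

subsection \<open>Integration by parts\<close>

lemma integrable_compact_support: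
  fixes g :: "'a::euclidean_space \<Rightarrow> 'b::{banach, second_countable_topology}"
  assumes "continuous_on UNIV g" "compact K" "\<And>x. x \<notin> K \<Longrightarrow> g x = 0"
  shows "integrable lborel g"
proof -
  have "(\<lambda>x. indicator K x *\<^sub>R g x) = g" using assms(3) by (auto simp: fun_eq_iff indicator_def)
  then show ?thesis
    using borel_integrable_compact[OF assms(2) continuous_on_subset[OF assms(1)]] by simp
qed

lemma integral_lborel_translate:
  fixes g :: "'a::euclidean_space \<Rightarrow> 'b::{banach, second_countable_topology}"
  assumes "g \<in> borel_measurable borel"
  shows "(LINT x|lborel. g (c + x)) = (LINT x|lborel. g x)"
proof -
  have "(LINT x|lborel. g x) = (LINT x|distr lborel borel ((+) c). g x)"
    by (simp add: lborel_distr_plus)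
  also have "\<dots> = (LINT x|lborel. g (c + x))"
    by (rule integral_distr) (use assms in auto)
  finally show ?thesis by simp
qed

text \<open>Translation invariance says that the integral of \<open>g (x + t v)\<close> does not depend on \<open>t\<close>; the
  lemma is its derivative at \<open>t = 0\<close>.\<close>

lemma integral_frechet_derivative_eq_0:
  fixes g :: "'a::euclidean_space \<Rightarrow> complex"
  assumes g: "C1_on UNIV g" and K: "compact K" and z: "\<And>x. x \<notin> K \<Longrightarrow> g x = 0"
  shows "integrable lborel (\<lambda>x. frechet_derivative g (at x) v)"
    and "(LINT x|lborel. frechet_derivative g (at x) v) = 0"
proof -
  define D where "D x = frechet_derivative g (at x) v" for x
  have gc: "continuous_on UNIV g" by (rule C1_on_continuous[OF g])
  have Dc: "continuous_on UNIV D" unfolding D_def by (rule C1_on_continuous_derivative[OF g])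
  have Dz: "D x = 0" if "x \<notin> K" for x
  proof -
    have "(g has_derivative (\<lambda>v. 0)) (at x)"
      by (rule has_derivative_transform_within_open[of "\<lambda>x. 0" _ _ _ "- K"])
        (use that z compact_imp_closed[OF K] in \<open>auto simp: open_Compl\<close>)
    then show ?thesis unfolding D_def by (metis frechet_derivative_at)
  qed
  show "integrable lborel (\<lambda>x. frechet_derivative g (at x) v)"
    using integrable_compact_support[OF Dc K Dz] unfolding D_def by simp
  have "bounded (D ` K)"
    by (intro compact_imp_bounded compact_continuous_image continuous_on_subset[OF Dc] K) auto
  then obtain B where B: "B > 0" "\<And>x. x \<in> K \<Longrightarrow> norm (D x) \<le> B"
    unfolding bounded_pos by auto
  have DB: "norm (D x) \<le> B" for x using B Dz[of x] by (cases "x \<in> K") auto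
  \<comment> \<open>Mean value inequality along the segment in direction \<open>v\<close>; it bounds
    all difference quotients by the same \<open>B\<close>.\<close>
  have lip: "norm (g (x + t *\<^sub>R v) - g x) \<le> B * t" if "t \<ge> 0" for x t
  proof -
    have d: "((\<lambda>s. g (x + s *\<^sub>R v)) has_derivative (\<lambda>h. h *\<^sub>R D (x + s *\<^sub>R v))) (at s within {0..t})" for s
    proof -
      have 1: "((\<lambda>s. x + s *\<^sub>R v) has_derivative (\<lambda>h. h *\<^sub>R v)) (at s within {0..t})"
        by (auto intro!: derivative_eq_intros)
      have 2: "(g has_derivative frechet_derivative g (at (x + s *\<^sub>R v))) (at (x + s *\<^sub>R v))"
        by (rule C1_on_has_derivative[OF g]) simp
      have "linear (frechet_derivative g (at (x + s *\<^sub>R v)))"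
        using 2 has_derivative_linear by blast
      then have "(\<lambda>h. frechet_derivative g (at (x + s *\<^sub>R v)) (h *\<^sub>R v)) = (\<lambda>h. h *\<^sub>R D (x + s *\<^sub>R v))"
        unfolding D_def by (simp add: linear_scale)
      with has_derivative_compose[OF 1 2] show ?thesis by simp
    qed
    have on: "onorm (\<lambda>h. h *\<^sub>R D (x + s *\<^sub>R v)) \<le> B" for s :: real
      by (rule onorm_bound) (use DB B in \<open>auto simp: mult.commute[of B] intro!: mult_left_mono\<close>)
    have "norm (g (x + t *\<^sub>R v) - g (x + 0 *\<^sub>R v)) \<le> B * norm (t - 0)"
      by (rule differentiable_bound[where S = "{0..t}" and f = "\<lambda>s. g (x + s *\<^sub>R v)", OF _ d on])
        (use that in auto)
    then show ?thesis using that by simp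
  qed
  define T where "T n = inverse (real (Suc n))" for n
  have T: "0 < T n" "T n \<le> 1" for n
    unfolding T_def by (simp_all add: field_simps)
  have Tlim: "T \<longlonglongrightarrow> 0" unfolding T_def by (rule LIMSEQ_inverse_real_of_nat)
  define F where "F n x = (g (x + T n *\<^sub>R v) - g x) /\<^sub>R T n" for n x
  \<comment> \<open>Swept out by moving \<open>K\<close> back along \<open>v\<close> by at most 1,
    this compact set contains the supports of all difference quotients \<open>F n\<close>, since
    \<open>T n\<close> is at most 1.\<close>
  define K' where "K' = (\<lambda>(y, t). y - t *\<^sub>R v) ` (K \<times> {0..1::real})"
  have K': "compact K'" unfolding K'_def
    by (intro compact_continuous_image compact_Times K compact_Icc)
      (auto simp: case_prod_unfold intro!: continuous_intros)
  have gi: "integrable lborel g" by (rule integrable_compact_support[OF gc K z])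
  have gb: "g \<in> borel_measurable borel"
    using gc by (rule borel_measurable_continuous_onI)
  have Fc: "continuous_on UNIV (F n)" for n
    unfolding F_def using gc
    by (intro continuous_intros continuous_on_compose2[OF gc]) auto
  have Fz: "F n x = 0" if "x \<notin> K'" for n x
  proof -
    have "x \<notin> K"
    proof
      assume "x \<in> K"
      then have "(\<lambda>(y, t). y - t *\<^sub>R v) (x, 0) \<in> K'"
        unfolding K'_def by (intro imageI) auto
      then show False using that by simp
    qed
    moreover have "x + T n *\<^sub>R v \<notin> K"
    proof
      assume "x + T n *\<^sub>R v \<in> K"
      then have "(\<lambda>(y, t). y - t *\<^sub>R v) (x + T n *\<^sub>R v, T n) \<in> K'"
        unfolding K'_def using T[of n] by (intro imageI) auto
      then show False using that by simp
    qed
    ultimately show ?thesis unfolding F_def by (simp add: z)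
  qed
  have F0: "(LINT x|lborel. F n x) = 0" for n
  proof -
    have i: "integrable lborel (\<lambda>x. g (T n *\<^sub>R v + x))"
    proof -
      have "integrable (distr lborel borel ((+) (T n *\<^sub>R v))) g" using gi by (simp add: lborel_distr_plus)
      then show ?thesis by (subst (asm) integrable_distr_eq) (use gb in auto)
    qed
    have "(LINT x|lborel. F n x) = ((LINT x|lborel. g (T n *\<^sub>R v + x)) - (LINT x|lborel. g x)) /\<^sub>R T n"
      unfolding F_def using i gi by (simp add: add.commute)
    then show ?thesis by (simp add: integral_lborel_translate[OF gb])
  qed
  have "(\<lambda>n. LINT x|lborel. F n x) \<longlonglongrightarrow> (LINT x|lborel. D x)"
  proof (rule integral_dominated_convergence[where w = "\<lambda>x. indicator K' x *\<^sub>R B"])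
    show "D \<in> borel_measurable lborel" using borel_measurable_continuous_onI[OF Dc] by simp
    show "F n \<in> borel_measurable lborel" for n using borel_measurable_continuous_onI[OF Fc] by simp
    show "integrable lborel (\<lambda>x. indicator K' x *\<^sub>R B)"
      by (rule borel_integrable_compact[OF K']) simp
    show "AE x in lborel. norm (F n x) \<le> indicator K' x *\<^sub>R B" for n
    proof (rule AE_I2)
      fix x
      have "norm (F n x) \<le> B"
        using lip[of "T n" x] T[of n] unfolding F_def norm_scaleR by (simp add: field_simps)
      then show "norm (F n x) \<le> indicator K' x *\<^sub>R B"
        using Fz[of x n] by (auto simp: indicator_def)
    qed
    show "AE x in lborel. (\<lambda>n. F n x) \<longlonglongrightarrow> D x"
    proof (rule AE_I2)
      fix x
      have 1: "((\<lambda>s. x + s *\<^sub>R v) has_derivative (\<lambda>h. h *\<^sub>R v)) (at 0)"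
        by (auto intro!: derivative_eq_intros)
      have 2: "(g has_derivative frechet_derivative g (at x)) (at (x + 0 *\<^sub>R v))"
        using C1_on_has_derivative[OF g, of x] by simp
      have "((\<lambda>s. g (x + s *\<^sub>R v)) has_derivative (\<lambda>h. h *\<^sub>R D x)) (at 0)"
        using has_derivative_compose[OF 1 2] linear_scale[OF has_derivative_linear[OF 2]] unfolding D_def by simp
      then have "((\<lambda>h. (g (x + h *\<^sub>R v) - g x - h *\<^sub>R D x) /\<^sub>R norm h) \<longlongrightarrow> 0) (at 0)"
        by (simp add: has_derivative_at_within)
      then have lim: "((\<lambda>n. (g (x + T n *\<^sub>R v) - g x - T n *\<^sub>R D x) /\<^sub>R norm (T n)) \<longlonglongrightarrow> 0)"
        by (rule filterlim_compose) (use Tlim T in \<open>auto simp: filterlim_at less_imp_neq[symmetric] intro!: always_eventually\<close>)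
      have "(\<lambda>n. F n x - D x) \<longlonglongrightarrow> 0"
      proof (rule Lim_transform_eventually[OF lim], rule always_eventually, rule allI)
        fix n
        have "T n \<noteq> 0" "norm (T n) = T n" using T(1)[of n] by auto
        then show "(g (x + T n *\<^sub>R v) - g x - T n *\<^sub>R D x) /\<^sub>R norm (T n) = F n x - D x"
          unfolding F_def by (simp add: scaleR_diff_right)
      qed
      then show "(\<lambda>n. F n x) \<longlonglongrightarrow> D x" by (simp add: LIM_zero_iff)
    qed
  qed
  then have "(LINT x|lborel. D x) = 0" unfolding F0 by (simp add: LIMSEQ_const_iff)
  then show "(LINT x|lborel. frechet_derivative g (at x) v) = 0" unfolding D_def .
qed

subsection \<open>The fundamental lemma of the calculus of variations\<close>

text \<open>Squaring removes the kink of the positive part: at 0 the difference quotient is at most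
  \<open>|h|\<close> in absolute value.\<close>

lemma has_field_derivative_max_square:
  "((\<lambda>t::real. (max 0 t)\<^sup>2) has_field_derivative 2 * max 0 t) (at t)"
proof -
  consider "t > 0" | "t < 0" | "t = 0" by linarith
  then show ?thesis
  proof cases
    case 1
    have "((\<lambda>t::real. t\<^sup>2) has_field_derivative 2 * t) (at t)"
      by (auto intro!: derivative_eq_intros)
    then have "((\<lambda>t::real. (max 0 t)\<^sup>2) has_field_derivative 2 * t) (at t)"
      by (rule has_field_derivative_transform_within_open[where S = "{0<..}"]) (use 1 in auto)
    then show ?thesis using 1 by simp
  next
    case 2
    have "((\<lambda>t::real. 0) has_field_derivative 0) (at t)"
      by (auto intro!: derivative_eq_intros)
    then have "((\<lambda>t::real. (max 0 t)\<^sup>2) has_field_derivative 0) (at t)"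
      by (rule has_field_derivative_transform_within_open[where S = "{..<0}"]) (use 2 in auto)
    then show ?thesis using 2 by simp
  next
    case 3
    have "((\<lambda>h::real. (max 0 h)\<^sup>2 / h) \<longlongrightarrow> 0) (at 0)"
    proof (rule Lim_null_comparison)
      have "norm ((max 0 h)\<^sup>2 / h) \<le> \<bar>h\<bar>" for h :: real
        by (auto simp: max_def power2_eq_square)
      then show "\<forall>\<^sub>F h in at 0. norm ((max 0 h)\<^sup>2 / h) \<le> \<bar>h::real\<bar>" by simp
      show "((\<lambda>h::real. \<bar>h\<bar>) \<longlongrightarrow> 0) (at 0)" by (rule tendsto_rabs_zero[OF tendsto_ident_at])
    qed
    then show ?thesis using 3 by (simp add: has_field_derivative_iff)
  qed
qed

text \<open>In each coordinate the positive part of a parabola with zeros at the two faces of the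
  box, squared to become C1. Such cut-offs are admissible because \<open>weak_del_C1\<close> accepts
  C1 forms.\<close>

definition bump :: "'a::euclidean_space \<Rightarrow> 'a \<Rightarrow> 'a \<Rightarrow> real" where
  "bump a b x = (\<Prod>i\<in>Basis. (max 0 ((x \<bullet> i - a \<bullet> i) * (b \<bullet> i - x \<bullet> i)))\<^sup>2)"

lemma bump_nonneg: "bump a b x \<ge> 0"
  unfolding bump_def by (intro prod_nonneg) auto

lemma bump_pos_iff:
  assumes "box a b \<noteq> {}"
  shows "bump a b x > 0 \<longleftrightarrow> x \<in> box a b"
proof -
  have ab: "a \<bullet> i < b \<bullet> i" if "i \<in> Basis" for i using assms that by (auto simp: box_ne_empty)
  have "bump a b x > 0 \<longleftrightarrow> bump a b x \<noteq> 0" using bump_nonneg[of a b x] by auto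
  also have "\<dots> \<longleftrightarrow> (\<forall>i\<in>Basis. (x \<bullet> i - a \<bullet> i) * (b \<bullet> i - x \<bullet> i) > 0)"
  proof -
    have "(max 0 t)\<^sup>2 \<noteq> 0 \<longleftrightarrow> t > 0" for t :: real by (auto simp: max_def)
    then show ?thesis unfolding bump_def by simp
  qed
  also have "\<dots> \<longleftrightarrow> x \<in> box a b"
    unfolding mem_box
  proof (intro ball_cong refl)
    fix i :: 'a assume "i \<in> Basis"
    from ab[OF this] show "(x \<bullet> i - a \<bullet> i) * (b \<bullet> i - x \<bullet> i) > 0 \<longleftrightarrow> a \<bullet> i < x \<bullet> i \<and> x \<bullet> i < b \<bullet> i"
      by (auto simp: zero_less_mult_iff)
  qed
  finally show ?thesis .
qed

lemma bump_zero: "box a b \<noteq> {} \<Longrightarrow> x \<notin> box a b \<Longrightarrow> bump a b x = 0"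
  using bump_pos_iff[of a b x] bump_nonneg[of a b x] by linarith

lemma C1_on_bump: "C1_on S (bump a b)"
proof -
  have 1: "C1_on S (\<lambda>x. (x \<bullet> i - a \<bullet> i) * (b \<bullet> i - x \<bullet> i))" for i :: 'a
  proof (rule C1_on_mult)
    have l: "C1_on S (\<lambda>x. x \<bullet> i)" by (rule C1_on_linear_id[OF bounded_linear_inner_left])
    show "C1_on S (\<lambda>x. x \<bullet> i - a \<bullet> i)"
      using C1_on_add[OF l C1_on_const[of S "- (a \<bullet> i)"]] by simp
    show "C1_on S (\<lambda>x. b \<bullet> i - x \<bullet> i)"
      using C1_on_add[OF C1_on_const[of S "b \<bullet> i"] C1_on_linear[OF bounded_linear_minus[OF bounded_linear_ident] l]] by simp
  qed
  have "C1_on S (\<lambda>x. \<Prod>i\<in>Basis. (max 0 ((x \<bullet> i - a \<bullet> i) * (b \<bullet> i - x \<bullet> i)))\<^sup>2)"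
    by (rule C1_on_prod, rule C1_on_compose_field[OF 1 has_field_derivative_max_square])
      (intro continuous_intros)
  then show ?thesis by (simp add: bump_def[abs_def])
qed

text \<open>\<open>ennreal\<close> cuts off negative values, so \<open>?P\<close> and
  \<open>?N\<close> have the positive and the negative part of \<open>g\<close> as densities. They
  are finite and equal on boxes, an intersection-stable generator of the Borel sets; hence they are
  equal, and so are their densities almost everywhere.\<close>

lemma AE_zero_of_box_integrals:
  fixes g :: "'a::euclidean_space \<Rightarrow> real"
  assumes g: "integrable lborel g" and z: "\<And>a b. (LINT x|lborel. g x * indicator (box a b) x) = 0"
  shows "AE x in lborel. g x = 0"
proof -
  let ?P = "density lborel (\<lambda>x. ennreal (g x))" and ?N = "density lborel (\<lambda>x. ennreal (- g x))"
  have gm [measurable]: "g \<in> borel_measurable borel" using g by auto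
  have split: "emeasure (density lborel (\<lambda>x. ennreal (f x))) (box a b) =
      ennreal (LINT x|lborel. max 0 (f x) * indicator (box a b) x)"
    if f: "integrable lborel f" for f :: "'a \<Rightarrow> real" and a b
  proof -
    have [measurable]: "f \<in> borel_measurable borel" using f by auto
    have "emeasure (density lborel (\<lambda>x. ennreal (f x))) (box a b) =
      (\<integral>\<^sup>+x. ennreal (max 0 (f x) * indicator (box a b) x) \<partial>lborel)"
      by (subst emeasure_density)
        (auto intro!: nn_integral_cong simp: indicator_def max_def ennreal_neg)
    also have "\<dots> = ennreal (LINT x|lborel. max 0 (f x) * indicator (box a b) x)"
      by (rule nn_integral_eq_integral)
        (auto intro!: integrable_real_mult_indicator integrable_max f)
    finally show ?thesis .
  qed
  have eq: "emeasure ?P (box a b) = emeasure ?N (box a b)" for a b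
  proof -
    have i: "integrable lborel (\<lambda>x. max 0 (g x) * indicator (box a b) x)"
      "integrable lborel (\<lambda>x. max 0 (- g x) * indicator (box a b) x)"
      by (auto intro!: integrable_real_mult_indicator integrable_max g)
    have "(LINT x|lborel. max 0 (g x) * indicator (box a b) x) - (LINT x|lborel. max 0 (- g x) * indicator (box a b) x) =
      (LINT x|lborel. max 0 (g x) * indicator (box a b) x - max 0 (- g x) * indicator (box a b) x)"
      using i by simp
    also have "\<dots> = (LINT x|lborel. g x * indicator (box a b) x)"
      by (rule Bochner_Integration.integral_cong) (auto simp: indicator_def max_def)
    finally have "(LINT x|lborel. max 0 (g x) * indicator (box a b) x) = (LINT x|lborel. max 0 (- g x) * indicator (box a b) x)"
      using z by simp
    then show ?thesis using split[of g a b] split[of "\<lambda>x. - g x" a b] g by simp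
  qed
  have "?P = ?N"
  proof (rule measure_eqI_generator_eq)
    let ?E = "range (\<lambda>(a, b). box a b::'a set)"
    show "Int_stable ?E"
      by (auto simp: Int_stable_def box_Int_box)
    show "?E \<subseteq> Pow UNIV" "sets ?P = sigma_sets UNIV ?E" "sets ?N = sigma_sets UNIV ?E"
      by (simp_all add: borel_eq_box)
    let ?A = "\<lambda>n::nat. box (- (real n *\<^sub>R One)) (real n *\<^sub>R One) :: 'a set"
    show "range ?A \<subseteq> ?E" "(\<Union>i. ?A i) = UNIV"
      unfolding UN_box_eq_UNIV by auto
    show "emeasure ?P (?A i) \<noteq> \<infinity>" for i
      unfolding split[OF g] by simp
    show "emeasure ?P X = emeasure ?N X" if "X \<in> ?E" for X
      using that eq by auto
  qed
  then have "AE x in lborel. ennreal (g x) = ennreal (- g x)"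
    by (subst (asm) sigma_finite_measure.density_unique_iff[OF sigma_finite_lborel]) auto
  then show ?thesis
  proof (rule AE_mp, intro AE_I2 impI)
    fix x assume "ennreal (g x) = ennreal (- g x)"
    then show "g x = 0"
      by (cases "g x \<ge> 0") (auto simp: ennreal_neg ennreal_eq_0_iff eq_commute[of "0::ennreal"])
  qed
qed

text \<open>Bounded C1 functions converge pointwise to the indicator of a box, so the box integrals
  of \<open>G\<close> vanish by dominated convergence. As \<open>G\<close> is integrable on the
  whole space, the tests \<open>\<omega>\<close> may have any support; the cut-off will be a part of
  \<open>G\<close>.\<close>

lemma AE_zero_of_C1_tests:
  fixes G :: "'a::euclidean_space \<Rightarrow> complex"
  assumes G: "integrable lborel G"
    and z: "\<And>\<omega>. C1_on UNIV \<omega> \<Longrightarrow> (LINT x|lborel. complex_of_real (\<omega> x) * G x) = 0"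
  shows "AE x in lborel. G x = 0"
proof -
  have Gm [measurable]: "G \<in> borel_measurable borel" using G by auto
  have box: "(LINT x|lborel. indicator (box a b) x * G x) = 0" for a b
  proof (cases "box a b = {}")
    case True
    then show ?thesis by simp
  next
    case False
    \<comment> \<open>Equal to 0 off the box for every \<open>n\<close>, and increasing to 1 inside
      it.\<close>
    define \<omega> where "\<omega> n x = 1 - inverse (1 + real n * bump a b x)" for n x
    have pos: "1 + real n * bump a b x > 0" for n x
      using bump_nonneg[of a b x] by (simp add: add_pos_nonneg)
    have C: "C1_on UNIV (\<omega> n)" for n
    proof -
      have "C1_on UNIV (\<lambda>x. 1 + real n * bump a b x)"
        by (rule C1_on_add[OF C1_on_const C1_on_mult[OF C1_on_const C1_on_bump]])
      then have "C1_on UNIV (\<lambda>x. inverse (1 + real n * bump a b x))"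
        by (rule C1_on_inverse) (metis pos less_irrefl)
      from C1_on_add[OF C1_on_const[of _ 1] C1_on_mult[OF C1_on_const[of _ "-1"] this]]
      show ?thesis unfolding \<omega>_def by simp
    qed
    have bd: "\<bar>\<omega> n x\<bar> \<le> 1" for n x
    proof -
      have "0 < inverse (1 + real n * bump a b x)" using pos by simp
      moreover have "inverse (1 + real n * bump a b x) \<le> 1"
        using bump_nonneg[of a b x] by (intro inverse_le_1_iff[THEN iffD2]) auto
      ultimately show ?thesis unfolding \<omega>_def by linarith
    qed
    have "(\<lambda>n. LINT x|lborel. complex_of_real (\<omega> n x) * G x) \<longlonglongrightarrow> (LINT x|lborel. indicator (box a b) x * G x)"
    proof (rule integral_dominated_convergence[where w = "\<lambda>x. norm (G x)"])
      show "(\<lambda>x. complex_of_real (\<omega> n x) * G x) \<in> borel_measurable lborel" for n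
      proof -
        have [measurable]: "\<omega> n \<in> borel_measurable borel"
          by (rule borel_measurable_continuous_onI[OF C1_on_continuous[OF C]])
        show ?thesis by measurable
      qed
      show "AE x in lborel. norm (complex_of_real (\<omega> n x) * G x) \<le> norm (G x)" for n
        using bd by (intro AE_I2) (auto simp: norm_mult intro!: mult_left_le_one_le)
      show "AE x in lborel. (\<lambda>n. complex_of_real (\<omega> n x) * G x) \<longlonglongrightarrow> indicator (box a b) x * G x"
      proof (rule AE_I2)
        fix x
        have "(\<lambda>n. \<omega> n x) \<longlonglongrightarrow> indicator (box a b) x"
        proof (cases "x \<in> box a b")
          case True
          then have "bump a b x > 0" using bump_pos_iff[OF False] by simp
          then have "filterlim (\<lambda>n. 1 + real n * bump a b x) at_top sequentially"
            by (intro filterlim_tendsto_add_at_top[OF tendsto_const]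
              filterlim_at_top_mult_tendsto_pos[OF tendsto_const _ filterlim_real_sequentially])
          then have "(\<lambda>n. 1 - inverse (1 + real n * bump a b x)) \<longlonglongrightarrow> 1 - 0"
            by (intro tendsto_diff tendsto_const tendsto_inverse_0_at_top)
          then show ?thesis using True unfolding \<omega>_def by simp
        next
          case f: False
          then have "bump a b x = 0" by (rule bump_zero[OF False])
          then show ?thesis using f unfolding \<omega>_def by simp
        qed
        then have "(\<lambda>n. complex_of_real (\<omega> n x) * G x) \<longlonglongrightarrow> complex_of_real (indicator (box a b) x) * G x"
          by (intro tendsto_intros)
        then show "(\<lambda>n. complex_of_real (\<omega> n x) * G x) \<longlonglongrightarrow> indicator (box a b) x * G x"
          by (cases "x \<in> box a b") simp_all
      qed
    qed (use G in \<open>auto intro: integrable_norm\<close>)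
    then show ?thesis by (simp add: z[OF C] LIMSEQ_const_iff)
  qed
  have ind: "integrable lborel (\<lambda>x. indicator (box a b) x * G x)" for a b
  proof -
    have "(\<lambda>x. indicator (box a b) x * G x) = (\<lambda>x. indicator (box a b) x *\<^sub>R G x)"
      by (auto simp: indicator_def fun_eq_iff)
    then show ?thesis using integrable_mult_indicator[of "box a b" lborel G] G by simp
  qed
  have "AE x in lborel. Re (G x) = 0"
  proof (rule AE_zero_of_box_integrals)
    fix a b
    have "(LINT x|lborel. Re (G x) * indicator (box a b) x) = (LINT x|lborel. Re (indicator (box a b) x * G x))"
      by (rule Bochner_Integration.integral_cong) (auto simp: indicator_def)
    then show "(LINT x|lborel. Re (G x) * indicator (box a b) x) = 0"
      using integral_Re[OF ind[of a b]] box[of a b] by simp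
  qed (use G in auto)
  moreover have "AE x in lborel. Im (G x) = 0"
  proof (rule AE_zero_of_box_integrals)
    fix a b
    have "(LINT x|lborel. Im (G x) * indicator (box a b) x) = (LINT x|lborel. Im (indicator (box a b) x * G x))"
      by (rule Bochner_Integration.integral_cong) (auto simp: indicator_def)
    then show "(LINT x|lborel. Im (G x) * indicator (box a b) x) = 0"
      using integral_Im[OF ind[of a b]] box[of a b] by simp
  qed (use G in auto)
  ultimately show ?thesis by eventually_elim (simp add: complex_eq_iff)
qed

subsection \<open>Wirtinger derivatives\<close>

lemma dz_has_derivative:
  "(f has_derivative f') (at z) \<Longrightarrow> dz j f z = (f' (axis j 1) - \<i> * f' (axis j \<i>)) / 2"
  unfolding dz_def by (simp add: frechet_derivative_at[symmetric])

lemma dzbar_has_derivative: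
  "(f has_derivative f') (at z) \<Longrightarrow> dzbar j f z = (f' (axis j 1) + \<i> * f' (axis j \<i>)) / 2"
  unfolding dzbar_def by (simp add: frechet_derivative_at[symmetric])

text \<open>\<open>frechet_derivative\<close> chooses among the maps that are a derivative at the
  point, and these are the same for both functions. So \<open>dz\<close> and \<open>dzbar\<close>
  can be rewritten locally without a proof of differentiability.\<close>

lemma frechet_derivative_cong_open:
  assumes "open S" "z \<in> S" "\<And>w. w \<in> S \<Longrightarrow> f w = g w"
  shows "frechet_derivative f (at z) = frechet_derivative g (at z)"
proof -
  have "(f has_derivative f') (at z) \<longleftrightarrow> (g has_derivative f') (at z)" for f'
    using has_derivative_transform_within_open[OF _ assms(1,2), of f f' UNIV g]
      has_derivative_transform_within_open[OF _ assms(1,2), of g f' UNIV f] assms(3) by auto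
  then show ?thesis unfolding frechet_derivative_def by simp
qed

lemma dz_cong_open:
  "open S \<Longrightarrow> z \<in> S \<Longrightarrow> (\<And>w. w \<in> S \<Longrightarrow> f w = g w) \<Longrightarrow> dz j f z = dz j g z"
  unfolding dz_def by (simp add: frechet_derivative_cong_open[of S z f g])

lemma dzbar_cong_open:
  "open S \<Longrightarrow> z \<in> S \<Longrightarrow> (\<And>w. w \<in> S \<Longrightarrow> f w = g w) \<Longrightarrow> dzbar j f z = dzbar j g z"
  unfolding dzbar_def by (simp add: frechet_derivative_cong_open[of S z f g])

lemma has_frechet_derivative: "f differentiable (at z) \<Longrightarrow> (f has_derivative frechet_derivative f (at z)) (at z)"
  by (simp add: frechet_derivative_works)

lemma dz_const [simp]: "dz j (\<lambda>w. c) z = 0"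
  unfolding dz_def by simp

lemma dz_add:
  "f differentiable (at z) \<Longrightarrow> g differentiable (at z) \<Longrightarrow> dz j (\<lambda>w. f w + g w) z = dz j f z + dz j g z"
  by (subst dz_has_derivative[OF has_derivative_add[OF has_frechet_derivative has_frechet_derivative]])
    (simp_all add: dz_def field_simps)

lemma dz_mult:
  "f differentiable (at z) \<Longrightarrow> g differentiable (at z) \<Longrightarrow>
    dz j (\<lambda>w. f w * g w) z = dz j f z * g z + f z * dz j g z"
  by (subst dz_has_derivative[OF has_derivative_mult[OF has_frechet_derivative has_frechet_derivative]])
    (simp_all add: dz_def field_simps)

lemma dz_sum:
  "(\<And>i. i \<in> I \<Longrightarrow> f i differentiable (at z)) \<Longrightarrow> dz j (\<lambda>w. \<Sum>i\<in>I. f i w) z = (\<Sum>i\<in>I. dz j (f i) z)"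
proof (induction I rule: infinite_finite_induct)
  case (insert i I)
  have d: "f i differentiable (at z)" "(\<lambda>w. \<Sum>i\<in>I. f i w) differentiable (at z)"
    using insert by (auto intro!: differentiable_sum)
  then show ?case using insert dz_add[OF d] by simp
qed simp_all

lemma differentiable_prod:
  fixes f :: "'i \<Rightarrow> 'a::real_normed_vector \<Rightarrow> complex"
  shows "(\<And>i. i \<in> I \<Longrightarrow> f i differentiable (at z)) \<Longrightarrow> (\<lambda>w. \<Prod>i\<in>I. f i w) differentiable (at z)"
  by (induction I rule: infinite_finite_induct) (auto intro!: differentiable_mult)

lemma dz_prod:
  "(\<And>i. i \<in> I \<Longrightarrow> f i differentiable (at z)) \<Longrightarrow>
    dz j (\<lambda>w. \<Prod>i\<in>I. f i w) z = (\<Sum>i\<in>I. dz j (f i) z * (\<Prod>k\<in>I - {i}. f k z))"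
proof (induction I rule: infinite_finite_induct)
  case (insert i I)
  have d: "f i differentiable (at z)" "(\<lambda>w. \<Prod>i\<in>I. f i w) differentiable (at z)"
    using insert by (auto intro!: differentiable_prod)
  have "dz j (f l) z * (\<Prod>k\<in>insert i I - {l}. f k z) = f i z * (dz j (f l) z * (\<Prod>k\<in>I - {l}. f k z))"
    if "l \<in> I" for l
  proof -
    have "insert i I - {l} = insert i (I - {l})" using that insert.hyps by auto
    then show ?thesis using insert.hyps by simp
  qed
  then have "(\<Sum>l\<in>I. dz j (f l) z * (\<Prod>k\<in>insert i I - {l}. f k z)) =
      f i z * (\<Sum>l\<in>I. dz j (f l) z * (\<Prod>k\<in>I - {l}. f k z))"
    unfolding sum_distrib_left by (rule sum.cong[OF refl])
  then show ?case using insert dz_mult[OF d] by simp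
qed simp_all

lemma dz_cmult: "f differentiable (at z) \<Longrightarrow> dz j (\<lambda>w. c * f w) z = c * dz j f z"
  using dz_mult[of "\<lambda>w. c" z f j] by simp

lemma dz_uminus: "f differentiable (at z) \<Longrightarrow> dz j (\<lambda>w. - f w) z = - dz j f z"
  using dz_cmult[of f z j "-1"] by simp

lemma dz_cnj: "f differentiable (at z) \<Longrightarrow> dz j (\<lambda>w. cnj (f w)) z = cnj (dzbar j f z)"
  using dz_has_derivative[OF bounded_linear.has_derivative[OF bounded_linear_cnj has_frechet_derivative], of f z j]
  unfolding dzbar_def by simp

lemma dz_exp:
  assumes "f differentiable (at z)"
  shows "dz j (\<lambda>w. exp (f w)) z = exp (f z) * dz j f z"
proof -
  have "((\<lambda>w. exp (f w)) has_derivative (\<lambda>v. exp (f z) * frechet_derivative f (at z) v)) (at z)"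
    using has_derivative_compose[OF has_frechet_derivative[OF assms], of exp "(*) (exp (f z))"]
      DERIV_exp[of "f z"] by (simp add: has_field_derivative_def)
  from dz_has_derivative[OF this] show ?thesis unfolding dz_def by (simp add: field_simps)
qed

lemma C1_on_continuous_dz: "C1_on S f \<Longrightarrow> continuous_on S (dz j f)"
  unfolding dz_def[abs_def] by (intro continuous_intros C1_on_continuous_derivative) auto

lemma differentiable_cnj:
  fixes f :: "'a::real_normed_vector \<Rightarrow> complex"
  shows "f differentiable (at z) \<Longrightarrow> (\<lambda>w. cnj (f w)) differentiable (at z)"
  unfolding differentiable_def using bounded_linear.has_derivative[OF bounded_linear_cnj] by blast

subsection \<open>Holomorphic functions of several variables\<close>

lemma axis_smult: "axis j (c::complex) = c *s axis j 1"
  by (simp add: vec_eq_iff axis_def)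

lemma complex_linear_expand:
  fixes f :: "complex^'n::finite \<Rightarrow> complex"
  assumes "linear f" "\<And>a v. f (a *s v) = a * f v"
  shows "f v = (\<Sum>j\<in>UNIV. v $ j * f (axis j 1))"
  by (subst basis_expansion[of v, symmetric]) (simp only: linear_sum[OF assms(1)] assms(2))

lemma holo_on_derivative:
  fixes f :: "complex^'n::finite \<Rightarrow> complex"
  assumes "holo_on S f" "z \<in> S"
  shows "(f has_derivative (\<lambda>v. \<Sum>j\<in>UNIV. v $ j * dz j f z)) (at z)"
proof -
  obtain f' where f': "(f has_derivative f') (at z)" "\<And>a v. f' (a *s v) = a * f' v"
    using assms unfolding holo_on_def by blast
  have dzf: "dz j f z = f' (axis j 1)" for j
    unfolding dz_has_derivative[OF f'(1)] axis_smult[of j \<i>] f'(2) by simp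
  have "f' = (\<lambda>v. \<Sum>j\<in>UNIV. v $ j * dz j f z)"
    unfolding dzf by (rule ext, rule complex_linear_expand[OF has_derivative_linear[OF f'(1)] f'(2)])
  then show ?thesis using f'(1) by simp
qed

lemma holo_on_differentiable: "holo_on S f \<Longrightarrow> z \<in> S \<Longrightarrow> f differentiable (at z)"
  unfolding holo_on_def differentiable_def by blast

lemma dz_linear_form:
  fixes f :: "complex^'n::finite \<Rightarrow> complex"
  assumes "(f has_derivative (\<lambda>v. \<Sum>l\<in>UNIV. v $ l * c l)) (at z)"
  shows "dz j f z = c j" "dzbar j f z = 0"
proof -
  have "(\<Sum>l\<in>UNIV. axis j a $ l * c l) = a * c j" for a
    by (simp add: axis_def if_distrib[of "\<lambda>x. x * _"] sum.delta cong: if_cong)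
  then show "dz j f z = c j" "dzbar j f z = 0"
    unfolding dz_has_derivative[OF assms] dzbar_has_derivative[OF assms] by simp_all
qed

lemma dzbar_holo: "holo_on S f \<Longrightarrow> z \<in> S \<Longrightarrow> dzbar j (f :: complex^'n::finite \<Rightarrow> complex) z = 0"
  by (rule dz_linear_form(2)[OF holo_on_derivative])

lemma holo_on_const: "holo_on S (\<lambda>z. c)"
  unfolding holo_on_def by (auto intro!: exI[of _ "\<lambda>v. 0"])

lemma holo_on_add: "holo_on S f \<Longrightarrow> holo_on S g \<Longrightarrow> holo_on S (\<lambda>z. f z + g z)"
  unfolding holo_on_def
proof
  fix z
  assume *: "\<forall>z\<in>S. \<exists>f'. (f has_derivative f') (at z) \<and> (\<forall>a v. f' (a *s v) = a * f' v)"
    "\<forall>z\<in>S. \<exists>f'. (g has_derivative f') (at z) \<and> (\<forall>a v. f' (a *s v) = a * f' v)" "z \<in> S"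
  obtain f' where f': "(f has_derivative f') (at z)" "\<And>a v. f' (a *s v) = a * f' v" using * by blast
  obtain g' where g': "(g has_derivative g') (at z)" "\<And>a v. g' (a *s v) = a * g' v" using * by blast
  show "\<exists>f'. ((\<lambda>z. f z + g z) has_derivative f') (at z) \<and> (\<forall>a v. f' (a *s v) = a * f' v)"
    using has_derivative_add[OF f'(1) g'(1)] f'(2) g'(2)
    by (intro exI[of _ "\<lambda>v. f' v + g' v"]) (simp add: distrib_left)
qed

lemma holo_on_mult: "holo_on S f \<Longrightarrow> holo_on S g \<Longrightarrow> holo_on S (\<lambda>z. f z * g z)"
  unfolding holo_on_def
proof
  fix z
  assume *: "\<forall>z\<in>S. \<exists>f'. (f has_derivative f') (at z) \<and> (\<forall>a v. f' (a *s v) = a * f' v)"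
    "\<forall>z\<in>S. \<exists>f'. (g has_derivative f') (at z) \<and> (\<forall>a v. f' (a *s v) = a * f' v)" "z \<in> S"
  obtain f' where f': "(f has_derivative f') (at z)" "\<And>a v. f' (a *s v) = a * f' v" using * by blast
  obtain g' where g': "(g has_derivative g') (at z)" "\<And>a v. g' (a *s v) = a * g' v" using * by blast
  show "\<exists>f'. ((\<lambda>z. f z * g z) has_derivative f') (at z) \<and> (\<forall>a v. f' (a *s v) = a * f' v)"
    using has_derivative_mult[OF f'(1) g'(1)] f'(2) g'(2)
    by (intro exI[of _ "\<lambda>v. f z * g' v + f' v * g z"]) (simp add: algebra_simps)
qed

lemma holo_on_sum: "(\<And>i. i \<in> I \<Longrightarrow> holo_on S (f i)) \<Longrightarrow> holo_on S (\<lambda>z. \<Sum>i\<in>I. f i z)"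
proof (induction I rule: infinite_finite_induct)
  case (insert i I)
  then show ?case using holo_on_add[of S "f i" "\<lambda>z. \<Sum>i\<in>I. f i z"] by simp
qed (simp_all add: holo_on_const)

lemma norm_axis_complex: "norm (axis j c :: complex^'n::finite) = norm c"
  by (simp add: norm_eq_sqrt_inner inner_axis_axis)

lemma linear_axis: "linear (axis j :: complex \<Rightarrow> complex^'n::finite)"
  by (rule linearI) (auto simp: vec_eq_iff axis_def)

text \<open>Cauchy's formula in the \<open>j\<close>-th variable, uniformly in the base point and in the function.\<close>

definition cauchy_kernel ::
    "(complex^'n::finite) set \<Rightarrow> 'n \<Rightarrow> complex^'n \<Rightarrow> real \<Rightarrow> (real \<Rightarrow> complex) \<Rightarrow> (real \<Rightarrow> complex^'n) \<Rightarrow> bool" where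
  "cauchy_kernel S j z0 r k e \<longleftrightarrow>
     r > 0 \<and> continuous_on {0..1} k \<and> continuous_on {0..1} e \<and>
     (\<forall>w\<in>ball z0 r. \<forall>t. w + e t \<in> S) \<and>
     (\<forall>f. holo_on S f \<longrightarrow> (\<forall>w\<in>ball z0 r. dz j f w = integral {0..1} (\<lambda>t. k t * f (w + e t))))"

lemma cauchy_kernelD:
  assumes "cauchy_kernel S j z0 r k e"
  shows "r > 0" "continuous_on {0..1} k" "continuous_on {0..1} e"
    "\<And>w t. w \<in> ball z0 r \<Longrightarrow> w + e t \<in> S"
    "\<And>f w. holo_on S f \<Longrightarrow> w \<in> ball z0 r \<Longrightarrow> dz j f w = integral {0..1} (\<lambda>t. k t * f (w + e t))"
  using assms unfolding cauchy_kernel_def by auto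

lemma cauchy_kernel_exists:
  fixes z0 :: "complex^'n::finite"
  assumes "open S" "z0 \<in> S"
  shows "\<exists>r k e. cauchy_kernel S j z0 r k e"
proof -
  obtain R where R: "R > 0" "ball z0 R \<subseteq> S"
    using assms openE by blast
  \<comment> \<open>Base points move by less than \<open>r\<close>, and the circle of radius
    \<open>r\<close> needs a larger disk, of radius \<open>2 * r\<close>, on which the function of
    one variable is holomorphic; together they stay within \<open>R\<close>.\<close>
  define r where "r = R / 3"
  have r: "r > 0" "R = 3 * r" using R unfolding r_def by auto
  have inS: "w + axis j u \<in> S" if "w \<in> ball z0 r" "norm u < 2 * r" for w u
  proof -
    have "dist z0 (w + axis j u) \<le> dist z0 w + norm (axis j u)"
      by (metis dist_triangle add_diff_cancel_left' dist_norm norm_minus_commute)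
    also have "\<dots> < R" using that r by (simp add: norm_axis_complex)
    finally show ?thesis using R by auto
  qed
  define \<gamma> where "\<gamma> = circlepath 0 r"
  define e :: "real \<Rightarrow> complex^'n" where "e t = axis j (\<gamma> t)" for t
  \<comment> \<open>The kernel of Cauchy's formula for the first derivative at the centre, including
    the velocity of the parametrised circle.\<close>
  define k where "k t = vector_derivative \<gamma> (at t) / (\<gamma> t)\<^sup>2 / (2 * pi * \<i>)" for t
  have n\<gamma>: "norm (\<gamma> t) = r" for t
    using r unfolding \<gamma>_def circlepath by (simp add: norm_mult)
  have \<gamma>0: "\<gamma> t \<noteq> 0" for t using n\<gamma>[of t] r by auto
  have \<gamma>c: "continuous_on {0..1} \<gamma>"
    unfolding \<gamma>_def circlepath by (intro continuous_intros)
  have kc: "continuous_on {0..1} k"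
    unfolding k_def \<gamma>_def vector_derivative_circlepath
    by (intro continuous_intros continuous_on_divide) (use \<gamma>c \<gamma>0 in \<open>auto simp: \<gamma>_def\<close>)
  have ec: "continuous_on {0..1} e"
    unfolding e_def by (rule linear_continuous_on_compose[OF \<gamma>c linear_axis])
  have "cauchy_kernel S j z0 r k e"
    unfolding cauchy_kernel_def
  proof (intro conjI ballI allI impI r(1) kc ec)
    show "w + e t \<in> S" if "w \<in> ball z0 r" for w t
      unfolding e_def by (rule inS[OF that]) (use n\<gamma> r in auto)
    fix f and w :: "complex^'n" assume f: "holo_on S f" and w: "w \<in> ball z0 r"
    define g where "g u = f (w + axis j u)" for u
    have gd: "(g has_field_derivative dz j f (w + axis j u)) (at u)" if "norm u < 2 * r" for u
    proof -
      have 1: "((\<lambda>u. w + axis j u) has_derivative axis j) (at u)"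
        using has_derivative_add[OF has_derivative_const linear_imp_has_derivative[OF linear_axis]] by simp
      have "(g has_derivative (\<lambda>h. \<Sum>l\<in>UNIV. axis j h $ l * dz l f (w + axis j u))) (at u)"
        unfolding g_def by (rule has_derivative_compose[OF 1 holo_on_derivative[OF f inS[OF w that]]])
      moreover have "(\<lambda>h. \<Sum>l\<in>UNIV. axis j h $ l * dz l f (w + axis j u)) = (*) (dz j f (w + axis j u))"
        by (auto simp: axis_def if_distrib[of "\<lambda>x. x * _"] sum.delta cong: if_cong)
      ultimately show ?thesis by (simp add: has_field_derivative_def)
    qed
    have hol: "g holomorphic_on ball 0 (2 * r)"
      unfolding holomorphic_on_open[OF open_ball] using gd by (metis mem_ball_0)
    have c: "continuous_on (cball 0 r) g"
      by (rule continuous_on_subset[OF holomorphic_on_imp_continuous_on[OF hol]]) (use r in auto)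
    have h: "g holomorphic_on ball 0 r"
      by (rule holomorphic_on_subset[OF hol]) (use r in auto)
    have "2 * pi * \<i> * deriv g 0 = contour_integral \<gamma> (\<lambda>u. g u / (u - 0)\<^sup>2)"
      unfolding \<gamma>_def using Cauchy_contour_integral_circlepath_2[OF c h, of 0] r by simp
    also have "\<dots> = integral {0..1} (\<lambda>t. 2 * pi * \<i> * (k t * f (w + e t)))"
      unfolding contour_integral_integral g_def e_def k_def by (simp add: field_simps)
    also have "\<dots> = 2 * pi * \<i> * integral {0..1} (\<lambda>t. k t * f (w + e t))"
      by (rule integral_mult_right)
    finally have "deriv g 0 = integral {0..1} (\<lambda>t. k t * f (w + e t))" by simp
    moreover have "deriv g 0 = dz j f w"
      using DERIV_imp_deriv[OF gd[of 0]] r linear_0[OF linear_axis[of j]] by simp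
    ultimately show "dz j f w = integral {0..1} (\<lambda>t. k t * f (w + e t))" by simp
  qed
  then show ?thesis by blast
qed

text \<open>\<open>holo_on\<close> asks for a derivative at each point and says nothing about its
  continuity. But near any point \<open>dz j f\<close> is an integral over a fixed circle of values
  of \<open>f\<close> itself, and \<open>f\<close> is continuous.\<close>

lemma holo_on_C1:
  fixes f :: "complex^'n::finite \<Rightarrow> complex"
  assumes S: "open S" and f: "holo_on S f"
  shows "C1_on S f"
proof -
  have fc: "continuous_on S f"
    using holo_on_differentiable[OF f] differentiable_imp_continuous_within continuous_at_imp_continuous_on by blast
  have "continuous_on S (dz j f)" for j
    unfolding continuous_on_eq_continuous_at[OF S]
  proof
    fix z0 assume "z0 \<in> S"
    obtain r k e where "cauchy_kernel S j z0 r k e"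
      using cauchy_kernel_exists[OF S \<open>z0 \<in> S\<close>] by blast
    note K = cauchy_kernelD[OF this]
    have "continuous_on (ball z0 r) (\<lambda>w. integral (cbox 0 1) (\<lambda>t. k t * f (w + e t)))"
    proof (rule integral_continuous_on_param)
      show "continuous_on (ball z0 r \<times> cbox 0 1) (\<lambda>(w, t). k t * f (w + e t))"
        unfolding case_prod_unfold
        by (intro continuous_intros continuous_on_compose2[OF K(2)] continuous_on_compose2[OF fc]
            continuous_on_compose2[OF K(3)]) (use K(4) in auto)
    qed
    then have "continuous_on (ball z0 r) (dz j f)"
      by (rule continuous_on_eq) (use K(5)[OF f] in auto)
    then show "isCont (dz j f) z0"
      using K(1) by (simp add: continuous_on_eq_continuous_at)
  qed
  then show ?thesis
    by (intro C1_onI[OF holo_on_derivative[OF f]] continuous_intros)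
qed

text \<open>Cauchy's formula for \<open>dz j f\<close> is differentiated under the integral sign,
  which gives the \<open>c l\<close> as integrals of \<open>dz l f\<close>. The same kernel turns
  these into \<open>dz j (dz l f)\<close> once \<open>dz l f\<close> is known to be holomorphic. The
  second clause is conditional because that fact, \<open>holo_on_dz\<close>, is drawn from the
  first.\<close>

lemma dz_dz_derivative:
  fixes f :: "complex^'n::finite \<Rightarrow> complex"
  assumes S: "open S" and f: "holo_on S f" and z0: "z0 \<in> S"
  shows "\<exists>c. (dz j f has_derivative (\<lambda>v. \<Sum>l\<in>UNIV. v $ l * c l)) (at z0) \<and>
    (\<forall>l. holo_on S (dz l f) \<longrightarrow> c l = dz j (dz l f) z0)"
proof -
  note C1 = holo_on_C1[OF S f]
  obtain r k e where "cauchy_kernel S j z0 r k e"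
    using cauchy_kernel_exists[OF S z0] by blast
  note K = cauchy_kernelD[OF this]
  let ?U = "ball z0 r"
  define F where "F x t v = k t * (\<Sum>l\<in>UNIV. v $ l * dz l f (x + e t))" for x t and v :: "complex^'n"
  have Fl: "bounded_linear (F x t)" for x t
    unfolding linear_conv_bounded_linear[symmetric]
    by (rule linearI) (auto simp: F_def algebra_simps sum.distrib sum_distrib_left scaleR_sum_right)
  have Fa: "blinfun_apply (Blinfun (F x t)) = F x t" for x t
    by (rule bounded_linear_Blinfun_apply[OF Fl])
  have Fc: "continuous_on (?U \<times> cbox 0 1) (\<lambda>(x, t). Blinfun (F x t))"
    unfolding case_prod_unfold
  proof (rule continuous_on_blinfun_componentwise)
    fix i :: "complex^'n"
    show "continuous_on (?U \<times> cbox 0 1) (\<lambda>p. blinfun_apply (Blinfun (F (fst p) (snd p))) i)"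
      unfolding Fa F_def
      by (intro continuous_intros continuous_on_compose2[OF K(2)]
          continuous_on_compose2[OF C1_on_continuous_dz[OF C1]]
          continuous_on_compose2[OF K(3)]) (use K(4) in auto)
  qed
  have der: "((\<lambda>x. k t * f (x + e t)) has_derivative blinfun_apply (Blinfun (F x t))) (at x within ?U)"
    if x: "x \<in> ?U" for x t
  proof -
    have 1: "((\<lambda>x. x + e t) has_derivative (\<lambda>v. v)) (at x within ?U)"
      by (auto intro!: derivative_eq_intros)
    have "((\<lambda>x. f (x + e t)) has_derivative (\<lambda>v. \<Sum>l\<in>UNIV. v $ l * dz l f (x + e t))) (at x within ?U)"
      by (rule has_derivative_compose[OF 1 holo_on_derivative[OF f K(4)[OF x]]])
    from has_derivative_mult_right[OF this, of "k t"] show ?thesis unfolding Fa F_def .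
  qed
  have int: "(\<lambda>t. k t * f (x + e t)) integrable_on cbox 0 1" if x: "x \<in> ?U" for x
    by (intro integrable_continuous continuous_intros continuous_on_compose2[OF C1_on_continuous[OF C1]])
      (use K x in auto)
  have z0U: "z0 \<in> ?U" using K(1) by simp
  have L: "((\<lambda>x. integral (cbox 0 1) (\<lambda>t. k t * f (x + e t))) has_derivative
      blinfun_apply (integral (cbox 0 1) (\<lambda>t. Blinfun (F z0 t)))) (at z0 within ?U)"
    by (rule leibniz_rule[OF der int Fc z0U convex_ball])
  define c where "c l = integral {0..1} (\<lambda>t. k t * dz l f (z0 + e t))" for l
  have ki: "(\<lambda>t. k t * dz l f (z0 + e t)) integrable_on {0..1}" for l
    using K z0U
    by (intro integrable_continuous_interval continuous_intros continuous_on_compose2[OF C1_on_continuous_dz[OF C1]]) auto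
  have "blinfun_apply (integral (cbox 0 1) (\<lambda>t. Blinfun (F z0 t))) v = (\<Sum>l\<in>UNIV. v $ l * c l)" for v
  proof -
    have "continuous_on (cbox 0 1) (\<lambda>t. (z0, t))" by (intro continuous_intros)
    from continuous_on_compose2[OF Fc this] z0U
    have "continuous_on (cbox 0 1) (\<lambda>t. Blinfun (F z0 t))" by (auto simp: image_subset_iff)
    note bi = integrable_continuous[OF this]
    have "blinfun_apply (integral (cbox 0 1) (\<lambda>t. Blinfun (F z0 t))) v = integral (cbox 0 1) (\<lambda>t. F z0 t v)"
      unfolding blinfun_apply_integral[OF bi] Fa ..
    also have "\<dots> = integral {0..1} (\<lambda>t. \<Sum>l\<in>UNIV. v $ l * (k t * dz l f (z0 + e t)))"
      by (simp add: F_def sum_distrib_left mult_ac)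
    also have "\<dots> = (\<Sum>l\<in>UNIV. v $ l * c l)"
      unfolding c_def using ki by (subst integral_sum) (auto intro!: integrable_on_mult_right)
    finally show ?thesis .
  qed
  then have "blinfun_apply (integral (cbox 0 1) (\<lambda>t. Blinfun (F z0 t))) = (\<lambda>v. \<Sum>l\<in>UNIV. v $ l * c l)"
    by (rule ext)
  then have "((\<lambda>x. integral (cbox 0 1) (\<lambda>t. k t * f (x + e t))) has_derivative (\<lambda>v. \<Sum>l\<in>UNIV. v $ l * c l)) (at z0)"
    using L by (simp only: at_within_open[OF z0U open_ball])
  then have "(dz j f has_derivative (\<lambda>v. \<Sum>l\<in>UNIV. v $ l * c l)) (at z0)"
    by (rule has_derivative_transform_within_open[OF _ open_ball z0U]) (use K(5)[OF f] in auto)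
  moreover have "c l = dz j (dz l f) z0" if "holo_on S (dz l f)" for l
    unfolding c_def K(5)[OF that z0U] ..
  ultimately show ?thesis by blast
qed

lemma holo_on_dz:
  fixes f :: "complex^'n::finite \<Rightarrow> complex"
  assumes "open S" "holo_on S f"
  shows "holo_on S (dz j f)"
  unfolding holo_on_def
proof
  fix z assume "z \<in> S"
  then obtain c where "(dz j f has_derivative (\<lambda>v. \<Sum>l\<in>UNIV. v $ l * c l)) (at z)"
    using dz_dz_derivative[OF assms, of z j] by blast
  then show "\<exists>f'. (dz j f has_derivative f') (at z) \<and> (\<forall>a v. f' (a *s v) = a * f' v)"
    by (intro exI[of _ "\<lambda>v. \<Sum>l\<in>UNIV. v $ l * c l"]) (simp add: sum_distrib_left mult_ac)
qed

lemma dz_commute: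
  fixes f :: "complex^'n::finite \<Rightarrow> complex"
  assumes "open S" "holo_on S f" "z \<in> S"
  shows "dz i (dz j f) z = dz j (dz i f) z"
proof -
  obtain c where c: "(dz j f has_derivative (\<lambda>v. \<Sum>l\<in>UNIV. v $ l * c l)) (at z)"
    "\<And>l. holo_on S (dz l f) \<Longrightarrow> c l = dz j (dz l f) z"
    using dz_dz_derivative[OF assms, of j] by blast
  show ?thesis using dz_linear_form(1)[OF c(1), of i] c(2)[OF holo_on_dz[OF assms(1,2)], of i] by simp
qed

text \<open>The chain rule for a holomorphic inner map: \<open>v \<mapsto> g' v - \<i> g' (\<i> v)\<close> is complex linear.\<close>

lemma dz_compose:
  fixes T :: "complex^'n::finite \<Rightarrow> complex^'m::finite" and g :: "complex^'m \<Rightarrow> complex"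
  assumes T: "\<And>l. holo_on S (\<lambda>w. T w $ l)" and z: "z \<in> S" and g: "g differentiable (at (T z))"
  shows "dz j (\<lambda>w. g (T w)) z = (\<Sum>l\<in>UNIV. dz j (\<lambda>w. T w $ l) z * dz l g (T z))"
    and "dzbar j (\<lambda>w. g (T w)) z = (\<Sum>l\<in>UNIV. cnj (dz j (\<lambda>w. T w $ l) z) * dzbar l g (T z))"
    and "(\<lambda>w. g (T w)) differentiable (at z)"
proof -
  define T' where "T' v = (\<chi> l. \<Sum>i\<in>UNIV. v $ i * dz i (\<lambda>w. T w $ l) z)" for v :: "complex^'n"
  define g' where "g' = frechet_derivative g (at (T z))"
  have g': "(g has_derivative g') (at (T z))" unfolding g'_def by (rule has_frechet_derivative[OF g])
  have Td: "(T has_derivative T') (at z)"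
    unfolding has_derivative_componentwise_within[of T]
  proof
    fix b :: "complex^'m" assume "b \<in> Basis"
    then obtain l c where b: "b = axis l c" by (auto simp: Basis_vec_def)
    have "((\<lambda>x. (T x $ l) \<bullet> c) has_derivative (\<lambda>v. (T' v $ l) \<bullet> c)) (at z)"
      using has_derivative_inner_left[OF holo_on_derivative[OF T z]] unfolding T'_def by simp
    then show "((\<lambda>x. T x \<bullet> b) has_derivative (\<lambda>x. T' x \<bullet> b)) (at z)"
      by (simp add: b inner_axis)
  qed
  have comp: "((\<lambda>w. g (T w)) has_derivative (\<lambda>v. g' (T' v))) (at z)"
    by (rule has_derivative_compose[OF Td g'])
  then show "(\<lambda>w. g (T w)) differentiable (at z)" unfolding differentiable_def by blast
  have lin: "linear g'" using g' has_derivative_linear by blast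
  have ii: "g' (\<i> *s (\<i> *s v)) = - g' v" for v
  proof -
    have "\<i> *s (\<i> *s v) = - v" by (simp add: vec_eq_iff)
    then show ?thesis by (simp add: linear_neg[OF lin])
  qed
  have gs: "g' (a *s v) = of_real (Re a) * g' v + of_real (Im a) * g' (\<i> *s v)" for a v
  proof -
    have "a *s v = Re a *\<^sub>R v + Im a *\<^sub>R (\<i> *s v)"
      by (simp add: vec_eq_iff complex_eq_iff)
    then have "g' (a *s v) = Re a *\<^sub>R g' v + Im a *\<^sub>R g' (\<i> *s v)"
      by (simp only: linear_add[OF lin] linear_scale[OF lin])
    then show ?thesis by (simp only: scaleR_conv_of_real)
  qed
  define L where "L v = g' v - \<i> * g' (\<i> *s v)" for v
  \<comment> \<open>Twice the complex antilinear part of \<open>g'\<close>, the counterpart of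
    \<open>L\<close>; on unit vectors it gives the \<open>dzbar\<close> derivatives, and
    antilinearity conjugates the Jacobian.\<close>
  define N where "N v = g' v + \<i> * g' (\<i> *s v)" for v
  have comm: "\<i> *s (a *s v) = a *s (\<i> *s v)" for a v by (simp add: vec_eq_iff)
  have Ls: "L (a *s v) = a * L v" for a v
  proof -
    have "L (a *s v) = (of_real (Re a) + \<i> * of_real (Im a)) * L v"
      unfolding L_def comm[of a v] gs[of a] ii by (simp add: algebra_simps)
    then show ?thesis by (simp flip: complex_eq)
  qed
  have Ns: "N (a *s v) = cnj a * N v" for a v
  proof -
    have "N (a *s v) = cnj (of_real (Re a) + \<i> * of_real (Im a)) * N v"
      unfolding N_def comm[of a v] gs[of a] ii by (simp add: algebra_simps)
    then show ?thesis by (simp flip: complex_eq)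
  qed
  have add: "L (v + w) = L v + L w" "N (v + w) = N v + N w" for v w
    unfolding L_def N_def by (simp_all add: linear_add[OF lin] vector_add_ldistrib algebra_simps)
  have z0: "L 0 = 0" "N 0 = 0" using Ls[of 0 0] Ns[of 0 0] by simp_all
  have Lsum: "L (\<Sum>i\<in>I. f i) = (\<Sum>i\<in>I. L (f i))" for I :: "'m set" and f
    by (induction I rule: infinite_finite_induct) (simp_all add: z0 add)
  have Nsum: "N (\<Sum>i\<in>I. f i) = (\<Sum>i\<in>I. N (f i))" for I :: "'m set" and f
    by (induction I rule: infinite_finite_induct) (simp_all add: z0 add)
  have T'a: "T' (axis j a) = a *s T' (axis j 1)" for a
    by (simp add: T'_def vec_eq_iff axis_def if_distrib[of "\<lambda>x. x * _"] sum.delta cong: if_cong)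
  have T'1: "T' (axis j 1) $ l = dz j (\<lambda>w. T w $ l) z" for l
    by (simp add: T'_def axis_def if_distrib[of "\<lambda>x. x * _"] sum.delta cong: if_cong)
  have Le: "L v = (\<Sum>l\<in>UNIV. v $ l * L (axis l 1))" and Ne: "N v = (\<Sum>l\<in>UNIV. cnj (v $ l) * N (axis l 1))" for v
    by (subst basis_expansion[of v, symmetric], simp only: Lsum Nsum Ls Ns)+
  have Lz: "L (axis l 1) = 2 * dz l g (T z)" and Nz: "N (axis l 1) = 2 * dzbar l g (T z)" for l
    unfolding L_def N_def dz_has_derivative[OF g'] dzbar_has_derivative[OF g'] axis_smult[of l \<i>] by simp_all
  have "dz j (\<lambda>w. g (T w)) z = L (T' (axis j 1)) / 2"
    unfolding dz_has_derivative[OF comp] L_def T'a[of \<i>] by simp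
  also have "\<dots> = (\<Sum>l\<in>UNIV. dz j (\<lambda>w. T w $ l) z * dz l g (T z))"
    unfolding Le[of "T' _"] T'1 Lz by (simp add: sum_divide_distrib)
  finally show "dz j (\<lambda>w. g (T w)) z = (\<Sum>l\<in>UNIV. dz j (\<lambda>w. T w $ l) z * dz l g (T z))" .
  have "dzbar j (\<lambda>w. g (T w)) z = N (T' (axis j 1)) / 2"
    unfolding dzbar_has_derivative[OF comp] N_def T'a[of \<i>] by simp
  also have "\<dots> = (\<Sum>l\<in>UNIV. cnj (dz j (\<lambda>w. T w $ l) z) * dzbar l g (T z))"
    unfolding Ne[of "T' _"] T'1 Nz by (simp add: sum_divide_distrib)
  finally show "dzbar j (\<lambda>w. g (T w)) z = (\<Sum>l\<in>UNIV. cnj (dz j (\<lambda>w. T w $ l) z) * dzbar l g (T z))" .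
qed

subsection \<open>Determinants and inverses of matrix functions\<close>

lemma differentiable_det:
  fixes N :: "complex^'n::finite \<Rightarrow> complex^'m::finite^'m"
  assumes "\<And>i k. (\<lambda>z. N z $ i $ k) differentiable (at z0)"
  shows "(\<lambda>z. det (N z)) differentiable (at z0)"
  unfolding det_def
  by (intro differentiable_sum differentiable_mult differentiable_prod ballI differentiable_const assms) simp

text \<open>A permutation other than the identity moves at least two indices, so after the product
  rule has removed one factor an off-diagonal entry of the identity matrix is left.\<close>

lemma dz_det_at_one:
  fixes N :: "complex^'n::finite \<Rightarrow> complex^'m::finite^'m"
  assumes d: "\<And>i k. (\<lambda>z. N z $ i $ k) differentiable (at z0)" and one: "N z0 = mat 1"
  shows "dz l (\<lambda>z. det (N z)) z0 = (\<Sum>i\<in>UNIV. dz l (\<lambda>z. N z $ i $ i) z0)"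
proof -
  let ?P = "{p. p permutes (UNIV :: 'm set)}"
  have "dz l (\<lambda>z. det (N z)) z0 = (\<Sum>p\<in>?P. dz l (\<lambda>z. of_int (sign p) * (\<Prod>i\<in>UNIV. N z $ i $ p i)) z0)"
    unfolding det_def
    by (intro dz_sum differentiable_mult differentiable_const differentiable_prod d)
  also have "\<dots> = (\<Sum>p\<in>?P. of_int (sign p) *
      (\<Sum>i\<in>UNIV. dz l (\<lambda>z. N z $ i $ p i) z0 * (\<Prod>k\<in>UNIV - {i}. N z0 $ k $ p k)))"
    by (intro sum.cong refl, subst dz_cmult[OF differentiable_prod[OF d]], subst dz_prod[OF d]) simp
  also have "\<dots> = (\<Sum>p\<in>?P. if p = id then (\<Sum>i\<in>UNIV. dz l (\<lambda>z. N z $ i $ i) z0) else 0)"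
  proof (intro sum.cong refl)
    fix p assume p: "p \<in> ?P"
    show "of_int (sign p) * (\<Sum>i\<in>UNIV. dz l (\<lambda>z. N z $ i $ p i) z0 * (\<Prod>k\<in>UNIV - {i}. N z0 $ k $ p k)) =
      (if p = id then (\<Sum>i\<in>UNIV. dz l (\<lambda>z. N z $ i $ i) z0) else 0)"
    proof (cases "p = id")
      case True
      then show ?thesis by (simp add: one mat_def)
    next
      case False
      have zero: "(\<Prod>k\<in>UNIV - {i}. N z0 $ k $ p k) = 0" for i
      proof -
        obtain a where a: "p a \<noteq> a" using False by (auto simp: fun_eq_iff)
        have "inj p" using p permutes_inj by auto
        then have "p (p a) \<noteq> p a" using a by (simp add: inj_eq)
        then obtain b where "b \<noteq> i" "p b \<noteq> b" using a by metis
        then show ?thesis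
          by (intro prod_zero bexI[of _ b]) (auto simp: one mat_def)
      qed
      show ?thesis using False by (simp only: zero) simp
    qed
  qed
  also have "\<dots> = (\<Sum>i\<in>UNIV. dz l (\<lambda>z. N z $ i $ i) z0)"
    using permutes_id[of "UNIV :: 'm set"] by (simp add: sum.delta finite_permutations)
  finally show ?thesis .
qed

text \<open>Jacobi's formula. Multiplication by the constant matrix \<open>I\<close> reduces it to a
  matrix function with value 1 at \<open>z0\<close>.\<close>

lemma dz_det:
  fixes G :: "complex^'n::finite \<Rightarrow> complex^'m::finite^'m"
  assumes d: "\<And>i k. (\<lambda>z. G z $ i $ k) differentiable (at z0)"
    and inv: "G z0 ** I = mat 1" "I ** G z0 = mat 1"
  shows "dz l (\<lambda>z. det (G z)) z0 = det (G z0) * (\<Sum>i\<in>UNIV. \<Sum>k\<in>UNIV. I $ i $ k * dz l (\<lambda>z. G z $ k $ i) z0)"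
proof -
  define N where "N z = I ** G z" for z
  have Nc: "N z $ i $ j = (\<Sum>k\<in>UNIV. I $ i $ k * G z $ k $ j)" for z i j
    by (simp add: N_def matrix_matrix_mult_def)
  have dN: "(\<lambda>z. N z $ i $ k) differentiable (at z0)" for i k
    unfolding Nc by (intro differentiable_sum differentiable_mult differentiable_const ballI d) simp
  have "det (G z) = det (G z0) * det (N z)" for z
    using arg_cong[OF inv(1), of det] by (simp add: N_def det_mul mult.assoc[symmetric])
  then have "(\<lambda>z. det (G z)) = (\<lambda>z. det (G z0) * det (N z))" by (rule ext)
  then have "dz l (\<lambda>z. det (G z)) z0 = dz l (\<lambda>z. det (G z0) * det (N z)) z0"
    by (rule arg_cong)
  also have "\<dots> = det (G z0) * dz l (\<lambda>z. det (N z)) z0"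
    by (rule dz_cmult[OF differentiable_det[OF dN]])
  also have "dz l (\<lambda>z. det (N z)) z0 = (\<Sum>i\<in>UNIV. dz l (\<lambda>z. N z $ i $ i) z0)"
    by (rule dz_det_at_one[OF dN]) (simp add: N_def inv)
  also have "\<dots> = (\<Sum>i\<in>UNIV. \<Sum>k\<in>UNIV. I $ i $ k * dz l (\<lambda>z. G z $ k $ i) z0)"
    unfolding Nc
    by (intro sum.cong refl, subst dz_sum)
      (auto intro!: differentiable_mult d sum.cong dz_cmult)
  finally show ?thesis .
qed

lemma C1_on_det:
  fixes G :: "'a::real_normed_vector \<Rightarrow> complex^'m::finite^'m"
  assumes "\<And>i k. C1_on S (\<lambda>z. G z $ i $ k)"
  shows "C1_on S (\<lambda>z. det (G z))"
  unfolding det_def by (intro C1_on_sum C1_on_mult C1_on_const C1_on_prod assms)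

text \<open>Cramer's rule; as quotients of determinants the entries of the inverse are of class C1
  when those of the matrix are.\<close>

lemma matrix_inv_component:
  fixes A :: "complex^'m::finite^'m"
  assumes "det A \<noteq> 0"
  shows "matrix_inv A $ k $ l = det (\<chi> i j. if j = k then axis l 1 $ i else A $ i $ j) / det A"
proof -
  obtain B where B: "A ** B = mat 1" "B ** A = mat 1"
    using assms unfolding invertible_det_nz[symmetric] invertible_def by blast
  have inv: "matrix_inv A = B" by (rule matrix_inv_eqI[OF B])
  have "A *v (matrix_inv A *v axis l 1) = axis l 1"
    unfolding inv by (simp add: matrix_vector_mul_assoc B)
  then have "matrix_inv A *v axis l 1 = (\<chi> k. det (\<chi> i j. if j = k then axis l 1 $ i else A $ i $ j) / det A)"
    using cramer[OF assms] by blast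
  moreover have "(matrix_inv A *v axis l 1) $ k = matrix_inv A $ k $ l"
    by (simp add: matrix_vector_mult_def axis_def if_distrib[of "\<lambda>x. _ * x"] sum.delta cong: if_cong)
  ultimately show ?thesis by simp
qed

lemma C1_on_matrix_inv:
  fixes G :: "'a::real_normed_vector \<Rightarrow> complex^'m::finite^'m"
  assumes S: "open S" and G: "\<And>i k. C1_on S (\<lambda>z. G z $ i $ k)" and nz: "\<And>z. z \<in> S \<Longrightarrow> det (G z) \<noteq> 0"
  shows "C1_on S (\<lambda>z. matrix_inv (G z) $ k $ l)"
proof (rule C1_on_cong[OF S])
  show "C1_on S (\<lambda>z. det (\<chi> i j. if j = k then axis l 1 $ i else G z $ i $ j) / det (G z))"
  proof (rule C1_on_divide[OF C1_on_det C1_on_det[OF G] nz])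
    fix i j
    show "C1_on S (\<lambda>z. (\<chi> i j. if j = k then axis l 1 $ i else G z $ i $ j) $ i $ j :: complex)"
      by (cases "j = k") (simp_all add: C1_on_const G)
  qed
  show "det (\<chi> i j. if j = k then axis l 1 $ i else G z $ i $ j) / det (G z) = matrix_inv (G z) $ k $ l"
    if "z \<in> S" for z by (simp add: matrix_inv_component[OF nz[OF that]])
qed

subsection \<open>Derivative of the pointwise inner product\<close>

lemma C1_on_cnj: "C1_on S f \<Longrightarrow> C1_on S (\<lambda>z. cnj (f z))"
  by (rule C1_on_linear[OF bounded_linear_cnj])

lemma C1_on_of_real: "C1_on S f \<Longrightarrow> C1_on S (\<lambda>z. complex_of_real (f z))"
  by (rule C1_on_linear[OF bounded_linear_of_real])

lemma C1_on_ip: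
  assumes "\<And>j k. C1_on S (\<lambda>z. H z j k)"
    and "\<And>J. length J = p \<Longrightarrow> C1_on S (\<lambda>z. u z J)" "\<And>J. length J = p \<Longrightarrow> C1_on S (\<lambda>z. v z J)"
  shows "C1_on S (\<lambda>z. ip (H z) p (u z) (v z))"
  unfolding ip_eq
  by (intro C1_on_sum C1_on_mult C1_on_prod C1_on_cnj assms) (auto simp: multi_idx_def)

lemma differentiable_ip:
  fixes H :: "complex^'m::finite \<Rightarrow> 'n::finite \<Rightarrow> 'n \<Rightarrow> complex"
  assumes "\<And>j k. (\<lambda>z. H z j k) differentiable (at z)"
    and "\<And>J. length J = p \<Longrightarrow> (\<lambda>z. u z J) differentiable (at z)"
    and "\<And>J. length J = p \<Longrightarrow> (\<lambda>z. v z J) differentiable (at z)"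
  shows "(\<lambda>z. ip (H z) p (u z) (v z)) differentiable (at z)"
  unfolding ip_eq
  by (intro differentiable_sum differentiable_mult differentiable_prod differentiable_cnj ballI assms)
    (auto simp: multi_idx_def[of p, symmetric], auto simp: multi_idx_def)

text \<open>The second argument enters conjugated, so its \<open>dz\<close> becomes the conjugate of
  a \<open>dzbar\<close>; for holomorphic \<open>v\<close> this term is 0.\<close>

lemma dz_ip:
  fixes H :: "complex^'m::finite \<Rightarrow> 'n::finite \<Rightarrow> 'n \<Rightarrow> complex"
  assumes H: "\<And>j k. (\<lambda>z. H z j k) differentiable (at z)"
  shows "(\<And>J. length J = p \<Longrightarrow> (\<lambda>z. u z J) differentiable (at z)) \<Longrightarrow>
    (\<And>J. length J = p \<Longrightarrow> (\<lambda>z. v z J) differentiable (at z)) \<Longrightarrow>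
    dz l (\<lambda>z. ip (H z) p (u z) (v z)) z =
      ipD (H z) (\<lambda>j k. dz l (\<lambda>z. H z j k) z) p (u z) (v z)
      + ip (H z) p (\<lambda>J. dz l (\<lambda>z. u z J) z) (v z) + ip (H z) p (u z) (\<lambda>J. dzbar l (\<lambda>z. v z J) z)"
proof (induction p arbitrary: u v)
  case 0
  then show ?case by (simp add: dz_mult dz_cnj differentiable_cnj)
next
  case (Suc p)
  let ?u = "\<lambda>j z K. u z (j # K)" and ?v = "\<lambda>k z K. v z (k # K)"
  have d: "(\<lambda>z. ip (H z) p (?u j z) (?v k z)) differentiable (at z)" for j k
    by (rule differentiable_ip) (use H Suc.prems in auto)
  have IH: "dz l (\<lambda>z. ip (H z) p (?u j z) (?v k z)) z =
      ipD (H z) (\<lambda>j k. dz l (\<lambda>z. H z j k) z) p (?u j z) (?v k z)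
      + ip (H z) p (\<lambda>J. dz l (\<lambda>z. ?u j z J) z) (?v k z) + ip (H z) p (?u j z) (\<lambda>J. dzbar l (\<lambda>z. ?v k z J) z)" for j k
    by (rule Suc.IH) (use Suc.prems in auto)
  have "dz l (\<lambda>z. ip (H z) (Suc p) (u z) (v z)) z =
    (\<Sum>j\<in>UNIV. \<Sum>k\<in>UNIV. dz l (\<lambda>z. H z j k * ip (H z) p (?u j z) (?v k z)) z)"
    unfolding ip.simps
    by (subst dz_sum, intro differentiable_sum ballI differentiable_mult H d, simp)
      (intro sum.cong refl dz_sum differentiable_mult H d)
  also have "\<dots> = (\<Sum>j\<in>UNIV. \<Sum>k\<in>UNIV. dz l (\<lambda>z. H z j k) z * ip (H z) p (?u j z) (?v k z)
      + H z j k * dz l (\<lambda>z. ip (H z) p (?u j z) (?v k z)) z)"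
    by (intro sum.cong refl dz_mult H d)
  also have "\<dots> = ipD (H z) (\<lambda>j k. dz l (\<lambda>z. H z j k) z) (Suc p) (u z) (v z)
      + ip (H z) (Suc p) (\<lambda>J. dz l (\<lambda>z. u z J) z) (v z) + ip (H z) (Suc p) (u z) (\<lambda>J. dzbar l (\<lambda>z. v z J) z)"
    unfolding IH by (simp add: sum.distrib algebra_simps)
  finally show ?case .
qed

subsection \<open>The formal adjoint of \<open>\<partial>\<close> on holomorphic forms over a Kaehler chart\<close>

locale kaehler_chart =
  fixes \<Omega> :: "(complex^'n::finite) set" and G :: "complex^'n \<Rightarrow> complex^'n^'n" and \<psi> :: "complex^'n \<Rightarrow> real"
  assumes \<Omega>: "open \<Omega>"
    and G_C1: "C1_on \<Omega> (\<lambda>z. G z $ j $ k)"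
    and G_pd: "z \<in> \<Omega> \<Longrightarrow> pos_def_hermitian (G z)"
    and kaehler: "z \<in> \<Omega> \<Longrightarrow> dz l (\<lambda>w. G w $ j $ k) z = dz j (\<lambda>w. G w $ l $ k) z"
    and \<psi>_C1: "C1_on \<Omega> \<psi>"
begin

definition H where "H z j k = transpose (matrix_inv (G z)) $ j $ k"

text \<open>The density of the weighted volume with respect to Lebesgue measure in the
  chart.\<close>

definition \<rho> where "\<rho> z = exp (- \<psi> z) * Re (det (G z))"

text \<open>The coefficients of the field \<open>(\<partial>bar \<psi>)^\<sharp>\<close>;
  \<open>X_eq\<close> identifies them with \<open>dbar_sharp\<close>.\<close>

definition X where "X z k = (\<Sum>l\<in>UNIV. H z k l * dzbar l (\<lambda>w. complex_of_real (\<psi> w)) z)"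

lemma det_nz: "z \<in> \<Omega> \<Longrightarrow> det (G z) \<noteq> 0"
  by (rule pos_def_hermitian.det_nz[OF G_pd])

lemma H_C1: "C1_on \<Omega> (\<lambda>z. H z j k)"
  unfolding H_def by (simp add: transpose_def C1_on_matrix_inv[OF \<Omega> G_C1 det_nz])

lemma G_diff: "z \<in> \<Omega> \<Longrightarrow> (\<lambda>z. G z $ j $ k) differentiable (at z)"
  by (rule C1_on_differentiable[OF G_C1])

lemma H_diff: "z \<in> \<Omega> \<Longrightarrow> (\<lambda>z. H z j k) differentiable (at z)"
  by (rule C1_on_differentiable[OF H_C1])

lemma GH: "z \<in> \<Omega> \<Longrightarrow> (\<Sum>k\<in>UNIV. H z j k * G z $ l $ k) = (if j = l then 1 else 0)"
  "z \<in> \<Omega> \<Longrightarrow> (\<Sum>a\<in>UNIV. G z $ a $ k * H z a m) = (if k = m then 1 else 0)"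
proof -
  assume "z \<in> \<Omega>"
  note inv = pos_def_hermitian.inverse[OF G_pd[OF this]]
  show "(\<Sum>k\<in>UNIV. H z j k * G z $ l $ k) = (if j = l then 1 else 0)"
    using arg_cong[OF inv(1), of "\<lambda>A. A $ l $ j"]
    by (simp add: H_def transpose_def matrix_matrix_mult_def mat_def mult.commute eq_commute)
  show "(\<Sum>a\<in>UNIV. G z $ a $ k * H z a m) = (if k = m then 1 else 0)"
    using arg_cong[OF inv(2), of "\<lambda>A. A $ m $ k"]
    by (simp add: H_def transpose_def matrix_matrix_mult_def mat_def mult.commute eq_commute)
qed

lemma H_hermitian: "z \<in> \<Omega> \<Longrightarrow> H z k j = cnj (H z j k)"
  unfolding H_def by (rule pos_def_hermitian.inverse_hermitian[OF G_pd])

text \<open>Differentiation of \<open>GH(1)\<close>, whose right-hand side is constant, followed by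
  multiplication with \<open>H\<close>.\<close>

lemma dz_H:
  assumes z: "z \<in> \<Omega>"
  shows "dz l (\<lambda>w. H w j m) z = - (\<Sum>a\<in>UNIV. \<Sum>b\<in>UNIV. H z j b * dz l (\<lambda>w. G w $ a $ b) z * H z a m)"
proof -
  let ?dG = "\<lambda>a b. dz l (\<lambda>w. G w $ a $ b) z" and ?dH = "\<lambda>k. dz l (\<lambda>w. H w j k) z"
  have e: "(\<Sum>k\<in>UNIV. ?dH k * G z $ a $ k) = - (\<Sum>k\<in>UNIV. H z j k * ?dG a k)" for a
  proof -
    have "dz l (\<lambda>w. \<Sum>k\<in>UNIV. H w j k * G w $ a $ k) z = dz l (\<lambda>w. if j = a then 1 else 0) z"
      by (rule dz_cong_open[OF \<Omega> z]) (rule GH(1))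
    then have "dz l (\<lambda>w. \<Sum>k\<in>UNIV. H w j k * G w $ a $ k) z = 0" by simp
    also have "dz l (\<lambda>w. \<Sum>k\<in>UNIV. H w j k * G w $ a $ k) z =
        (\<Sum>k\<in>UNIV. ?dH k * G z $ a $ k + H z j k * ?dG a k)"
      by (subst dz_sum) (auto intro!: differentiable_mult H_diff G_diff z sum.cong dz_mult)
    finally show ?thesis by (simp add: sum.distrib eq_neg_iff_add_eq_0)
  qed
  have "?dH m = (\<Sum>k\<in>UNIV. ?dH k * (\<Sum>a\<in>UNIV. G z $ a $ k * H z a m))"
    unfolding GH(2)[OF z] by (simp add: if_distrib[of "\<lambda>x. _ * x"] sum.delta' cong: if_cong)
  also have "\<dots> = (\<Sum>a\<in>UNIV. (\<Sum>k\<in>UNIV. ?dH k * G z $ a $ k) * H z a m)"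
    unfolding sum_distrib_left sum_distrib_right mult.assoc by (rule sum.swap)
  also have "\<dots> = - (\<Sum>a\<in>UNIV. \<Sum>b\<in>UNIV. H z j b * ?dG a b * H z a m)"
    unfolding e by (simp add: sum_distrib_right sum_negf)
  finally show ?thesis .
qed

text \<open>By \<open>dz_H\<close> only derivatives of \<open>G\<close> remain, and the Kaehler
  condition exchanges the direction \<open>l\<close> with the first index \<open>a\<close>; this
  exchanges \<open>k\<close> and \<open>m\<close>. The result is the hypothesis of
  \<open>ipD_skew\<close>.\<close>

lemma H_dz_H_symmetric:
  assumes z: "z \<in> \<Omega>"
  shows "(\<Sum>l\<in>UNIV. H z l k * dz l (\<lambda>w. H w j m) z) = (\<Sum>l\<in>UNIV. H z l m * dz l (\<lambda>w. H w j k) z)"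
proof -
  have e: "(\<Sum>l\<in>UNIV. H z l k * dz l (\<lambda>w. H w j m) z) =
    - (\<Sum>l\<in>UNIV. \<Sum>a\<in>UNIV. \<Sum>b\<in>UNIV. H z l k * (H z j b * dz l (\<lambda>w. G w $ a $ b) z * H z a m))" for k m
    unfolding dz_H[OF z] by (simp add: sum_distrib_left sum_negf)
  have "(\<Sum>l\<in>UNIV. \<Sum>a\<in>UNIV. \<Sum>b\<in>UNIV. H z l k * (H z j b * dz l (\<lambda>w. G w $ a $ b) z * H z a m)) =
    (\<Sum>a\<in>UNIV. \<Sum>l\<in>UNIV. \<Sum>b\<in>UNIV. H z l k * (H z j b * dz l (\<lambda>w. G w $ a $ b) z * H z a m))"
    by (rule sum.swap)
  also have "\<dots> = (\<Sum>a\<in>UNIV. \<Sum>l\<in>UNIV. \<Sum>b\<in>UNIV. H z a m * (H z j b * dz a (\<lambda>w. G w $ l $ b) z * H z l k))"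
    by (intro sum.cong refl) (subst kaehler[OF z], simp add: mult_ac)
  finally show ?thesis unfolding e by simp
qed

lemma det_real: "z \<in> \<Omega> \<Longrightarrow> complex_of_real (Re (det (G z))) = det (G z)"
  using pos_def_hermitian.det_real[OF G_pd] by simp

lemma \<rho>_C1: "C1_on \<Omega> \<rho>"
proof -
  have "C1_on \<Omega> (\<lambda>z. exp (-1 * \<psi> z))"
    by (intro C1_on_exp C1_on_mult[OF C1_on_const \<psi>_C1])
  from C1_on_mult[OF this C1_on_linear[OF bounded_linear_Re C1_on_det[OF G_C1]]]
  show ?thesis unfolding \<rho>_def[abs_def] by simp
qed

lemma \<rho>_pos: "z \<in> \<Omega> \<Longrightarrow> \<rho> z > 0"
  unfolding \<rho>_def using pos_def_hermitian.det_pos[OF G_pd] by simp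

lemma \<psi>c_diff: "z \<in> \<Omega> \<Longrightarrow> (\<lambda>w. complex_of_real (\<psi> w)) differentiable (at z)"
  by (rule C1_on_differentiable[OF C1_on_of_real[OF \<psi>_C1]])

lemma dz_\<rho>:
  assumes z: "z \<in> \<Omega>"
  shows "dz l (\<lambda>w. complex_of_real (\<rho> w)) z = \<rho> z *
    ((\<Sum>a\<in>UNIV. \<Sum>b\<in>UNIV. H z a b * dz l (\<lambda>w. G w $ a $ b) z) - dz l (\<lambda>w. complex_of_real (\<psi> w)) z)"
proof -
  have dE: "(\<lambda>w. - complex_of_real (\<psi> w)) differentiable (at z)"
    using \<psi>c_diff[OF z] by (rule differentiable_minus)
  have dexp: "(\<lambda>w. exp (- complex_of_real (\<psi> w))) differentiable (at z)"
  proof -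
    have "C1_on \<Omega> (\<lambda>w. exp (-1 * complex_of_real (\<psi> w)))"
      by (intro C1_on_exp C1_on_mult C1_on_const C1_on_of_real \<psi>_C1)
    from C1_on_differentiable[OF this z] show ?thesis by simp
  qed
  have "dz l (\<lambda>w. complex_of_real (\<rho> w)) z = dz l (\<lambda>w. exp (- complex_of_real (\<psi> w)) * det (G w)) z"
    by (rule dz_cong_open[OF \<Omega> z]) (simp add: \<rho>_def det_real flip: exp_of_real)
  also have "\<dots> = exp (- complex_of_real (\<psi> z)) * dz l (\<lambda>w. - complex_of_real (\<psi> w)) z * det (G z)
      + exp (- complex_of_real (\<psi> z)) * dz l (\<lambda>w. det (G w)) z"
    unfolding dz_mult[OF dexp differentiable_det[OF G_diff[OF z]]] dz_exp[OF dE] ..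
  also have "dz l (\<lambda>w. - complex_of_real (\<psi> w)) z = - dz l (\<lambda>w. complex_of_real (\<psi> w)) z"
    by (rule dz_uminus[OF \<psi>c_diff[OF z]])
  also have "dz l (\<lambda>w. det (G w)) z = det (G z) * (\<Sum>i\<in>UNIV. \<Sum>k\<in>UNIV. matrix_inv (G z) $ i $ k * dz l (\<lambda>z. G z $ k $ i) z)"
    by (rule dz_det[OF G_diff[OF z] pos_def_hermitian.inverse[OF G_pd[OF z]]])
  also have "(\<Sum>i\<in>UNIV. \<Sum>k\<in>UNIV. matrix_inv (G z) $ i $ k * dz l (\<lambda>z. G z $ k $ i) z) =
      (\<Sum>a\<in>UNIV. \<Sum>b\<in>UNIV. H z a b * dz l (\<lambda>w. G w $ a $ b) z)"
    unfolding H_def transpose_def by (subst sum.swap) simp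
  finally show ?thesis
    by (simp add: \<rho>_def det_real[OF z] algebra_simps flip: exp_of_real)
qed

text \<open>The derivative of \<open>det G\<close> by Jacobi's formula and that of \<open>H\<close>
  by \<open>dz_H\<close> lead to the same contraction of derivatives of \<open>G\<close>, with
  opposite signs, once the Kaehler condition has exchanged two indices. Only the derivative of the
  weight is left.\<close>

lemma divergence_free:
  assumes z: "z \<in> \<Omega>"
  shows "(\<Sum>l\<in>UNIV. dz l (\<lambda>w. H w l k) z * \<rho> z + H z l k * dz l (\<lambda>w. complex_of_real (\<rho> w)) z) =
    - (\<Sum>l\<in>UNIV. H z l k * dz l (\<lambda>w. complex_of_real (\<psi> w)) z) * \<rho> z"
proof -
  let ?dG = "\<lambda>l a b. dz l (\<lambda>w. G w $ a $ b) z"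
  have "(\<Sum>l\<in>UNIV. \<Sum>a\<in>UNIV. \<Sum>b\<in>UNIV. H z l b * ?dG l a b * H z a k) =
      (\<Sum>a\<in>UNIV. \<Sum>l\<in>UNIV. \<Sum>b\<in>UNIV. H z l b * ?dG l a b * H z a k)"
    by (rule sum.swap)
  also have "\<dots> = (\<Sum>a\<in>UNIV. \<Sum>l\<in>UNIV. \<Sum>b\<in>UNIV. H z a k * (H z l b * ?dG a l b))"
    by (intro sum.cong refl) (subst kaehler[OF z], simp add: mult_ac)
  finally have "(\<Sum>l\<in>UNIV. dz l (\<lambda>w. H w l k) z) = - (\<Sum>l\<in>UNIV. H z l k * (\<Sum>a\<in>UNIV. \<Sum>b\<in>UNIV. H z a b * ?dG l a b))"
    unfolding dz_H[OF z] by (simp add: sum_distrib_left sum_negf)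
  moreover have "(\<Sum>l\<in>UNIV. dz l (\<lambda>w. H w l k) z * \<rho> z + H z l k * dz l (\<lambda>w. complex_of_real (\<rho> w)) z) =
      (\<Sum>l\<in>UNIV. dz l (\<lambda>w. H w l k) z) * \<rho> z + (\<Sum>l\<in>UNIV. H z l k * (\<Sum>a\<in>UNIV. \<Sum>b\<in>UNIV. H z a b * ?dG l a b)) * \<rho> z
      - (\<Sum>l\<in>UNIV. H z l k * dz l (\<lambda>w. complex_of_real (\<psi> w)) z) * \<rho> z"
    unfolding dz_\<rho>[OF z] sum_distrib_right sum.distrib[symmetric] sum_subtractf[symmetric]
    by (intro sum.cong refl) (simp add: algebra_simps)
  ultimately show ?thesis by simp
qed

text \<open>The field stands in the antilinear slot of the inner product and therefore appears
  conjugated; \<open>H\<close> is Hermitian and \<open>\<psi>\<close> is real.\<close>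

lemma cnj_X: "z \<in> \<Omega> \<Longrightarrow> cnj (X z k) = (\<Sum>l\<in>UNIV. H z l k * dz l (\<lambda>w. complex_of_real (\<psi> w)) z)"
proof -
  assume z: "z \<in> \<Omega>"
  have "cnj (dzbar l (\<lambda>w. complex_of_real (\<psi> w)) z) = dz l (\<lambda>w. complex_of_real (\<psi> w)) z" for l
    using dz_cnj[OF \<psi>c_diff[OF z], of l] by simp
  then show ?thesis unfolding X_def by (simp add: H_hermitian[OF z, symmetric])
qed

text \<open>The product rule yields four kinds of terms: derivatives of \<open>H w l k\<close> and
  \<open>\<rho>\<close>, left to \<open>divergence_free\<close>; of the metric inside the inner
  product, removed by \<open>ipD_skew\<close>; of \<open>u\<close>; and of \<open>\<eta>\<close>,
  which vanish by holomorphy.\<close>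

lemma divergence:
  assumes z: "z \<in> \<Omega>"
    and u: "\<And>J. length J = p \<Longrightarrow> (\<lambda>w. u w J) differentiable (at z)"
    and \<eta>: "\<And>J. length J = Suc p \<Longrightarrow> holo_on \<Omega> (\<lambda>w. \<eta> w J)" and sk: "skew (Suc p) (\<eta> z)"
  shows "(\<Sum>l\<in>UNIV. dz l (\<lambda>w. (\<Sum>k\<in>UNIV. H w l k * ip (H w) p (u w) (\<lambda>L. \<eta> w (k # L))) * \<rho> w) z) =
    (\<Sum>l\<in>UNIV. \<Sum>k\<in>UNIV. H z l k * ip (H z) p (\<lambda>J. dz l (\<lambda>w. u w J) z) (\<lambda>L. \<eta> z (k # L))) * \<rho> z
    - ip (H z) p (u z) (\<lambda>L. \<Sum>k\<in>UNIV. X z k * \<eta> z (k # L)) * \<rho> z"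
proof -
  let ?I = "\<lambda>k. ip (H z) p (u z) (\<lambda>L. \<eta> z (k # L))"
  let ?d\<rho> = "\<lambda>l. dz l (\<lambda>w. complex_of_real (\<rho> w)) z"
  let ?dI = "\<lambda>l k. dz l (\<lambda>w. ip (H w) p (u w) (\<lambda>L. \<eta> w (k # L))) z"
  have dI: "(\<lambda>w. ip (H w) p (u w) (\<lambda>L. \<eta> w (k # L))) differentiable (at z)" for k
    by (rule differentiable_ip[OF H_diff[OF z] u]) (use holo_on_differentiable[OF \<eta> z] in auto)
  have d\<rho>: "(\<lambda>w. complex_of_real (\<rho> w)) differentiable (at z)"
    by (rule C1_on_differentiable[OF C1_on_of_real[OF \<rho>_C1] z])
  have dI_eq: "?dI l k = ipD (H z) (\<lambda>j k. dz l (\<lambda>w. H w j k) z) p (u z) (\<lambda>L. \<eta> z (k # L))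
      + ip (H z) p (\<lambda>J. dz l (\<lambda>w. u w J) z) (\<lambda>L. \<eta> z (k # L))" for l k
  proof -
    have "ip (H z) p (u z) (\<lambda>J. dzbar l (\<lambda>w. \<eta> w (k # J)) z) = ip (H z) p (u z) (\<lambda>J. 0)"
      by (rule ip_cong[OF refl]) (use dzbar_holo[OF \<eta> z] in auto)
    then show ?thesis
      by (subst dz_ip[OF H_diff[OF z] u]) (use holo_on_differentiable[OF \<eta> z] in auto)
  qed
  have "dz l (\<lambda>w. (\<Sum>k\<in>UNIV. H w l k * ip (H w) p (u w) (\<lambda>L. \<eta> w (k # L))) * \<rho> w) z =
      (\<Sum>k\<in>UNIV. (dz l (\<lambda>w. H w l k) z * \<rho> z + H z l k * ?d\<rho> l) * ?I k) + (\<Sum>k\<in>UNIV. H z l k * ?dI l k) * \<rho> z" for l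
  proof -
    have "dz l (\<lambda>w. (\<Sum>k\<in>UNIV. H w l k * ip (H w) p (u w) (\<lambda>L. \<eta> w (k # L))) * \<rho> w) z =
      dz l (\<lambda>w. (\<Sum>k\<in>UNIV. H w l k * ip (H w) p (u w) (\<lambda>L. \<eta> w (k # L)))) z * \<rho> z
      + (\<Sum>k\<in>UNIV. H z l k * ?I k) * ?d\<rho> l"
      by (intro dz_mult differentiable_sum ballI differentiable_mult H_diff z dI d\<rho>) simp
    also have "dz l (\<lambda>w. (\<Sum>k\<in>UNIV. H w l k * ip (H w) p (u w) (\<lambda>L. \<eta> w (k # L)))) z =
      (\<Sum>k\<in>UNIV. dz l (\<lambda>w. H w l k) z * ?I k + H z l k * ?dI l k)"
      by (subst dz_sum) (auto intro!: differentiable_mult H_diff z dI sum.cong dz_mult)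
    finally show ?thesis
      unfolding sum_distrib_right sum.distrib[symmetric] by (auto intro!: sum.cong simp: algebra_simps)
  qed
  then have "(\<Sum>l\<in>UNIV. dz l (\<lambda>w. (\<Sum>k\<in>UNIV. H w l k * ip (H w) p (u w) (\<lambda>L. \<eta> w (k # L))) * \<rho> w) z) =
     (\<Sum>l\<in>UNIV. \<Sum>k\<in>UNIV. (dz l (\<lambda>w. H w l k) z * \<rho> z + H z l k * ?d\<rho> l) * ?I k)
     + (\<Sum>l\<in>UNIV. \<Sum>k\<in>UNIV. H z l k * ?dI l k) * \<rho> z"
    by (simp only: sum.distrib sum_distrib_right)
  also have "(\<Sum>l\<in>UNIV. \<Sum>k\<in>UNIV. H z l k * ?dI l k) =
     (\<Sum>l\<in>UNIV. \<Sum>k\<in>UNIV. H z l k * ip (H z) p (\<lambda>J. dz l (\<lambda>w. u w J) z) (\<lambda>L. \<eta> z (k # L)))"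
    using ipD_skew[of "H z" "\<lambda>l j k. dz l (\<lambda>w. H w j k) z", OF H_dz_H_symmetric[OF z] sk, of "u z"]
    unfolding dI_eq distrib_left sum.distrib by simp
  also have "(\<Sum>l\<in>UNIV. \<Sum>k\<in>UNIV. (dz l (\<lambda>w. H w l k) z * \<rho> z + H z l k * ?d\<rho> l) * ?I k) =
     (\<Sum>k\<in>UNIV. (\<Sum>l\<in>UNIV. dz l (\<lambda>w. H w l k) z * \<rho> z + H z l k * ?d\<rho> l) * ?I k)"
    by (subst sum.swap) (simp add: sum_distrib_right)
  also have "\<dots> = - ip (H z) p (u z) (\<lambda>L. \<Sum>k\<in>UNIV. X z k * \<eta> z (k # L)) * \<rho> z"
  proof -
    have "(\<Sum>k\<in>UNIV. - S k * r * I k) = - (\<Sum>k\<in>UNIV. S k * I k) * r" for S I :: "'n \<Rightarrow> complex" and r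
      by (simp add: sum_distrib_left sum_negf mult_ac)
    then show ?thesis unfolding divergence_free[OF z] ip_sum_right cnj_X[OF z] .
  qed
  finally show ?thesis by simp
qed

lemma integral_dz_eq_0:
  assumes K: "compact K" "K \<subseteq> \<Omega>" and g: "C1_on \<Omega> g" "\<And>z. z \<in> \<Omega> - K \<Longrightarrow> g z = (0::complex)"
  shows "integrable lborel (\<lambda>z. indicator \<Omega> z *\<^sub>R dz l g z)" "(LINT z|lborel. indicator \<Omega> z *\<^sub>R dz l g z) = 0"
proof -
  define f where "f z = (if z \<in> \<Omega> then g z else 0)" for z
  have f: "C1_on UNIV f" unfolding f_def
    by (rule C1_on_extend_zero[OF \<Omega> compact_imp_closed[OF K(1)] K(2) g])
  have fz: "f z = 0" if "z \<notin> K" for z using g(2) that K(2) unfolding f_def by auto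
  have e: "indicator \<Omega> z *\<^sub>R dz l g z = dz l f z" for z
  proof (cases "z \<in> \<Omega>")
    case True
    have "dz l f z = dz l g z" by (rule dz_cong_open[OF \<Omega> True]) (simp add: f_def)
    then show ?thesis using True by simp
  next
    case False
    have "dz l f z = dz l (\<lambda>w. 0) z"
      by (rule dz_cong_open[of "- K"]) (use False K compact_imp_closed fz in \<open>auto simp: open_Compl\<close>)
    then show ?thesis using False by simp
  qed
  note I = integral_frechet_derivative_eq_0[OF f K(1) fz]
  show "integrable lborel (\<lambda>z. indicator \<Omega> z *\<^sub>R dz l g z)" "(LINT z|lborel. indicator \<Omega> z *\<^sub>R dz l g z) = 0"
    unfolding e unfolding dz_def using I by simp_all
qed

lemma integrable_on_chart:
  assumes K: "compact K" "K \<subseteq> \<Omega>" and g: "continuous_on \<Omega> g" "\<And>z. z \<in> \<Omega> - K \<Longrightarrow> g z = (0::complex)"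
  shows "integrable lborel (\<lambda>z. indicator \<Omega> z *\<^sub>R g z)"
proof -
  have "(\<lambda>z. indicator \<Omega> z *\<^sub>R g z) = (\<lambda>z. indicator K z *\<^sub>R g z)"
    using g(2) K(2) by (auto simp: indicator_def fun_eq_iff)
  then show ?thesis using borel_integrable_compact[OF K(1) continuous_on_subset[OF g(1) K(2)]] by simp
qed

text \<open>The total divergence integrates to 0, and \<open>ip_altd\<close> recognises the terms
  with derivatives of \<open>u\<close> as the pairing with \<partial>u. The factor
  \<open>Suc p\<close> is the quotient of the factorials by which \<open>ip\<close> exceeds
  \<open>form_inner\<close> in the two degrees.\<close>

theorem integral_ip_altd:
  assumes K: "compact K" "K \<subseteq> \<Omega>"
    and u: "\<And>J. length J = p \<Longrightarrow> C1_on \<Omega> (\<lambda>w. u w J)"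
    and uz: "\<And>J z. length J = p \<Longrightarrow> z \<in> \<Omega> - K \<Longrightarrow> u z J = 0"
    and \<eta>: "\<And>J. length J = Suc p \<Longrightarrow> holo_on \<Omega> (\<lambda>w. \<eta> w J)" and sk: "\<And>z. z \<in> \<Omega> \<Longrightarrow> skew (Suc p) (\<eta> z)"
  shows "(LINT z|lborel. indicator \<Omega> z *\<^sub>R (ip (H z) (Suc p) (altd (\<lambda>j L. dz j (\<lambda>w. u w L) z)) (\<eta> z) * \<rho> z)) =
    of_nat (Suc p) * (LINT z|lborel. indicator \<Omega> z *\<^sub>R (ip (H z) p (u z) (\<lambda>L. \<Sum>k\<in>UNIV. X z k * \<eta> z (k # L)) * \<rho> z))"
proof -
  define g where "g l w = (\<Sum>k\<in>UNIV. H w l k * ip (H w) p (u w) (\<lambda>L. \<eta> w (k # L))) * complex_of_real (\<rho> w)" for l w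
  define B where "B z = ip (H z) p (u z) (\<lambda>L. \<Sum>k\<in>UNIV. X z k * \<eta> z (k # L)) * complex_of_real (\<rho> z)" for z
  define C where "C z = (\<Sum>l\<in>UNIV. \<Sum>k\<in>UNIV. H z l k * ip (H z) p (\<lambda>J. dz l (\<lambda>w. u w J) z) (\<lambda>L. \<eta> z (k # L))) * complex_of_real (\<rho> z)" for z
  have \<eta>C: "C1_on \<Omega> (\<lambda>w. \<eta> w (k # L))" if "length L = p" for k L
    by (rule holo_on_C1[OF \<Omega> \<eta>]) (use that in simp)
  have gC: "C1_on \<Omega> (g l)" for l
    unfolding g_def by (intro C1_on_mult C1_on_sum H_C1 C1_on_ip u \<eta>C C1_on_of_real \<rho>_C1)
  have ip0: "ip (H z) p (u z) v = 0" if "z \<in> \<Omega> - K" for z v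
  proof -
    have "ip (H z) p (u z) v = ip (H z) p (\<lambda>J. 0) v" by (rule ip_cong) (use uz that in auto)
    then show ?thesis by simp
  qed
  have gz: "g l z = 0" if "z \<in> \<Omega> - K" for l z using ip0[OF that] by (simp add: g_def)
  have Xc: "continuous_on \<Omega> (\<lambda>z. X z k)" for k
  proof -
    have "continuous_on \<Omega> (\<lambda>z. cnj (\<Sum>l\<in>UNIV. H z l k * dz l (\<lambda>w. complex_of_real (\<psi> w)) z))"
      by (intro continuous_intros C1_on_continuous[OF H_C1] C1_on_continuous_dz C1_on_of_real \<psi>_C1)
    then show ?thesis by (rule continuous_on_eq) (metis cnj_X complex_cnj_cnj)
  qed
  have Bc: "continuous_on \<Omega> B"
    unfolding B_def ip_eq
    by (intro continuous_intros C1_on_continuous[OF H_C1] C1_on_continuous[OF u] C1_on_continuous[OF \<eta>C] Xc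
        C1_on_continuous[OF \<rho>_C1]) (auto simp: multi_idx_def)
  have Bz: "B z = 0" if "z \<in> \<Omega> - K" for z using ip0[OF that] by (simp add: B_def)
  have Bi: "integrable lborel (\<lambda>z. indicator \<Omega> z *\<^sub>R B z)" by (rule integrable_on_chart[OF K Bc Bz])
  have div: "indicator \<Omega> z *\<^sub>R C z = (\<Sum>l\<in>UNIV. indicator \<Omega> z *\<^sub>R dz l (g l) z) + indicator \<Omega> z *\<^sub>R B z" for z
  proof (cases "z \<in> \<Omega>")
    case True
    have "(\<Sum>l\<in>UNIV. dz l (g l) z) = C z - B z"
      unfolding g_def B_def C_def by (rule divergence[OF True C1_on_differentiable[OF u True] \<eta> sk[OF True]])
    then show ?thesis using True by simp
  qed simp
  note I = integral_dz_eq_0[OF K gC gz]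
  have "(LINT z|lborel. indicator \<Omega> z *\<^sub>R C z) = (LINT z|lborel. indicator \<Omega> z *\<^sub>R B z)"
  proof -
    have I1: "integrable lborel (\<lambda>z. indicator \<Omega> z *\<^sub>R dz l (g l) z)" for l by (rule I(1))
    have "(LINT z|lborel. indicator \<Omega> z *\<^sub>R C z) =
        (LINT z|lborel. (\<Sum>l\<in>UNIV. indicator \<Omega> z *\<^sub>R dz l (g l) z)) + (LINT z|lborel. indicator \<Omega> z *\<^sub>R B z)"
      unfolding div by (rule Bochner_Integration.integral_add[OF Bochner_Integration.integrable_sum[OF I1] Bi])
    also have "(LINT z|lborel. (\<Sum>l\<in>UNIV. indicator \<Omega> z *\<^sub>R dz l (g l) z)) = 0"
      by (subst Bochner_Integration.integral_sum[OF I1]) (simp only: I(2) sum.neutral_const)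
    finally show ?thesis by simp
  qed
  note e1 = this
  have e2: "indicator \<Omega> z *\<^sub>R (ip (H z) (Suc p) (altd (\<lambda>j L. dz j (\<lambda>w. u w L) z)) (\<eta> z) * \<rho> z) =
      of_nat (Suc p) * (indicator \<Omega> z *\<^sub>R C z)" for z
    by (cases "z \<in> \<Omega>") (simp_all add: ip_altd[OF sk] C_def del: ip.simps)
  show ?thesis unfolding e2 Bochner_Integration.integral_mult_right_zero e1 unfolding B_def ..
qed

end

subsection \<open>Charts\<close>

lemma measurable_restrict_lborel: "measurable (restrict_space lborel S) M = measurable (restrict_space borel S) M"
  by (rule measurable_cong_sets) (simp_all add: sets_restrict_space)

locale kaehler_setup =
  fixes A :: "('a::{t2_space,second_countable_topology}, 'n::finite) chart set"
    and h :: "('a, 'n) metric" and V :: "'a measure" and \<psi> :: "'a \<Rightarrow> real"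
  assumes atlas: "complex_atlas A" and herm: "hermitian_metric A h"
    and closed: "fundamental_form_closed A h" and dvol: "is_dvol A h V" and smooth: "smooth_fun A \<psi>"
begin

lemma chart:
  assumes "c \<in> A"
  shows open_cdom: "open (cdom c)" and open_cimg: "open (cimg c)"
    and continuous_cmap: "continuous_on (cdom c) (cmap c)" and continuous_cinv: "continuous_on (cimg c) (cinv c)"
    and cmap_in: "x \<in> cdom c \<Longrightarrow> cmap c x \<in> cimg c" and cinv_in: "z \<in> cimg c \<Longrightarrow> cinv c z \<in> cdom c"
    and cinv_cmap: "x \<in> cdom c \<Longrightarrow> cinv c (cmap c x) = x" and cmap_cinv: "z \<in> cimg c \<Longrightarrow> cmap c (cinv c z) = z"
proof -
  have *: "open (cdom c)" "open (cimg c)" and hom: "homeomorphism (cdom c) (cimg c) (cmap c) (cinv c)"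
    using atlas assms unfolding complex_atlas_def by blast+
  then show "open (cdom c)" "open (cimg c)" by blast+
  show "continuous_on (cdom c) (cmap c)" "continuous_on (cimg c) (cinv c)"
    using hom unfolding homeomorphism_def by blast+
  show "x \<in> cdom c \<Longrightarrow> cmap c x \<in> cimg c" by (simp add: cimg_def)
  show "z \<in> cimg c \<Longrightarrow> cinv c z \<in> cdom c"
    using hom unfolding homeomorphism_def by blast
  show "x \<in> cdom c \<Longrightarrow> cinv c (cmap c x) = x" "z \<in> cimg c \<Longrightarrow> cmap c (cinv c z) = z"
    using hom unfolding homeomorphism_def by blast+
qed

lemma chart_at: "chart_at A x \<in> A" "x \<in> cdom (chart_at A x)"
proof -
  have "x \<in> (\<Union>c\<in>A. cdom c)" using atlas unfolding complex_atlas_def by simp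
  then have "\<exists>c. c \<in> A \<and> x \<in> cdom c" by blast
  from someI_ex[OF this] show "chart_at A x \<in> A" "x \<in> cdom (chart_at A x)"
    unfolding chart_at_def by auto
qed

lemma open_preimage:
  assumes c: "c \<in> A" and U: "open U"
  shows "open {z \<in> cimg c. cinv c z \<in> U}"
proof -
  have "open (cinv c -` U \<inter> cimg c)"
    using continuous_on_open_vimage[OF open_cimg[OF c], of "cinv c"] continuous_cinv[OF c] U by blast
  moreover have "cinv c -` U \<inter> cimg c = {z \<in> cimg c. cinv c z \<in> U}" by auto
  ultimately show ?thesis by simp
qed

lemma overlap_eq:
  assumes "c \<in> A"
  shows "cmap c ` (cdom c \<inter> U) = {z \<in> cimg c. cinv c z \<in> U}"
proof (intro set_eqI iffI)
  fix z assume "z \<in> cmap c ` (cdom c \<inter> U)"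
  then show "z \<in> {z \<in> cimg c. cinv c z \<in> U}" by (auto simp: cmap_in[OF assms] cinv_cmap[OF assms])
next
  fix z assume z: "z \<in> {z \<in> cimg c. cinv c z \<in> U}"
  then have "z = cmap c (cinv c z)" "cinv c z \<in> cdom c \<inter> U" by (simp_all add: cmap_cinv[OF assms] cinv_in[OF assms])
  then show "z \<in> cmap c ` (cdom c \<inter> U)" by (rule image_eqI)
qed

lemma trans_holo:
  assumes "c \<in> A" "d \<in> A"
  shows "holo_on {z \<in> cimg c. cinv c z \<in> cdom d} (\<lambda>z. trans_map c d z $ l)"
  using atlas assms unfolding complex_atlas_def overlap_eq[OF assms(1), symmetric] by blast

lemma open_overlap: "c \<in> A \<Longrightarrow> d \<in> A \<Longrightarrow> open {z \<in> cimg c. cinv c z \<in> cdom d}"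
  by (rule open_preimage[OF _ open_cdom])

lemma jac_self:
  assumes c: "c \<in> A" and z: "z \<in> cimg c"
  shows "jac c c z $ l $ j = (if l = j then 1 else 0)"
proof -
  have "dz j (\<lambda>w. trans_map c c w $ l) z = dz j (\<lambda>w. w $ l) z"
    by (rule dz_cong_open[OF open_cimg[OF c] z]) (simp add: trans_map_def cmap_cinv[OF c])
  also have "\<dots> = (if l = j then 1 else 0)"
    by (subst dz_has_derivative[OF bounded_linear_imp_has_derivative[OF bounded_linear_vec_nth]])
      (simp add: axis_def)
  finally show ?thesis by (simp add: jac_def)
qed

text \<open>Chain rule on the triple overlap: the cocycle identity of the coordinate
  changes.\<close>

lemma jac_compose:
  assumes "c \<in> A" "d \<in> A" "e \<in> A" and x: "x \<in> cdom c" "x \<in> cdom d" "x \<in> cdom e"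
  shows "jac c e (cmap c x) $ k $ j = (\<Sum>m\<in>UNIV. jac d e (cmap d x) $ k $ m * jac c d (cmap c x) $ m $ j)"
proof -
  let ?S = "{z \<in> cimg c. cinv c z \<in> cdom d}" and ?z = "cmap c x"
  let ?U = "{z \<in> cimg c. cinv c z \<in> cdom d \<inter> cdom e}"
  have z: "?z \<in> ?S" "?z \<in> ?U" using assms by (auto simp: cmap_in cinv_cmap)
  have T: "trans_map c d ?z = cmap d x" using assms by (simp add: trans_map_def cinv_cmap)
  have oU: "open ?U" using assms by (intro open_preimage open_Int open_cdom) auto
  have "dz j (\<lambda>w. trans_map c e w $ k) ?z = dz j (\<lambda>w. trans_map d e (trans_map c d w) $ k) ?z"
    by (rule dz_cong_open[OF oU z(2)]) (use assms in \<open>auto simp: trans_map_def cinv_cmap\<close>)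
  also have "\<dots> = (\<Sum>m\<in>UNIV. dz j (\<lambda>w. trans_map c d w $ m) ?z * dz m (\<lambda>w. trans_map d e w $ k) (trans_map c d ?z))"
  proof (rule dz_compose(1)[OF trans_holo z(1)])
    show "(\<lambda>w. trans_map d e w $ k) differentiable at (trans_map c d ?z)"
      unfolding T by (rule holo_on_differentiable[OF trans_holo[of d e]]) (use assms in \<open>auto simp: cmap_in cinv_cmap\<close>)
  qed (use assms in auto)
  finally show ?thesis by (simp add: jac_def T mult.commute)
qed

lemma pos_def: "c \<in> A \<Longrightarrow> z \<in> cimg c \<Longrightarrow> pos_def_hermitian (h c z)"
proof
  assume c: "c \<in> A" "z \<in> cimg c"
  show "h c z $ k $ j = cnj (h c z $ j $ k)" for k j
    using herm c unfolding hermitian_metric_def by blast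
  show "Re (\<Sum>j\<in>UNIV. \<Sum>k\<in>UNIV. h c z $ j $ k * v $ j * cnj (v $ k)) > 0" if "v \<noteq> 0" for v
    using herm c that unfolding hermitian_metric_def by blast
qed

lemma kaehler_chart:
  assumes c: "c \<in> A"
  shows "kaehler_chart (cimg c) (h c) (\<lambda>z. \<psi> (cinv c z))"
  unfolding kaehler_chart_def
proof (intro conjI allI impI)
  show "open (cimg c)" by (rule open_cimg[OF c])
  show "C1_on (cimg c) (\<lambda>z. h c z $ j $ k)" for j k
    using herm c unfolding hermitian_metric_def by (intro smooth_on_C1) blast
  show "pos_def_hermitian (h c z)" if "z \<in> cimg c" for z by (rule pos_def[OF c that])
  show "dz l (\<lambda>w. h c w $ j $ k) z = dz j (\<lambda>w. h c w $ l $ k) z" if "z \<in> cimg c" for l j k z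
  proof -
    have "dz l (\<lambda>w. h c w $ j $ k) z - dz j (\<lambda>w. h c w $ l $ k) z = 0"
      using closed c that unfolding fundamental_form_closed_def by blast
    then show ?thesis by simp
  qed
  show "C1_on (cimg c) (\<lambda>z. \<psi> (cinv c z))"
    using smooth c unfolding smooth_fun_def by (intro smooth_on_C1) blast
qed

abbreviation "Hc c z \<equiv> (\<lambda>j k. hinv h c z $ j $ k)"

lemma H_hinv: "c \<in> A \<Longrightarrow> kaehler_chart.H (h c) z = Hc c z"
  using kaehler_chart.H_def[OF kaehler_chart] by (simp add: hinv_def fun_eq_iff)

lemma hinv_transform:
  assumes "c \<in> A" "d \<in> A" "x \<in> cdom c" "x \<in> cdom d"
  shows "hinv h d (cmap d x) $ l $ m =
    (\<Sum>j\<in>UNIV. \<Sum>k\<in>UNIV. hinv h c (cmap c x) $ j $ k * jac c d (cmap c x) $ l $ j * cnj (jac c d (cmap c x) $ m $ k))"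
proof -
  define J where "J = jac c d (cmap c x)"
  define Jb where "Jb = (\<chi> m k. cnj (J $ m $ k))"
  let ?c = "h c (cmap c x)" and ?d = "h d (cmap d x)"
  interpret c: pos_def_hermitian ?c by (rule pos_def) (use assms in \<open>auto simp: cmap_in\<close>)
  have "?c $ j $ k = (\<Sum>l\<in>UNIV. \<Sum>m\<in>UNIV. J $ l $ j * cnj (J $ m $ k) * ?d $ l $ m)" for j k
    using herm assms unfolding hermitian_metric_def J_def by blast
  then have hc: "?c = transpose J ** (?d ** Jb)"
    by (simp add: vec_eq_iff matrix_matrix_mult_def transpose_def Jb_def sum_distrib_left mult_ac)
  have "transpose J ** (?d ** Jb ** I) = ?c ** I" for I :: "complex^'n^'n"
  proof -
    have "transpose J ** (?d ** Jb ** I) = (transpose J ** (?d ** Jb)) ** I"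
      by (simp only: matrix_mul_assoc)
    then show ?thesis unfolding hc[symmetric] .
  qed
  then have "transpose J ** (?d ** Jb ** matrix_inv ?c) = mat 1"
    using c.inverse(1) by simp
  \<comment> \<open>A one-sided inverse of a square matrix is two-sided, so the factor
    \<open>transpose J\<close> can be moved to the other end.\<close>
  then have "(?d ** Jb ** matrix_inv ?c) ** transpose J = mat 1"
    using matrix_left_right_inverse by blast
  then have "?d ** (Jb ** matrix_inv ?c ** transpose J) = mat 1"
    by (simp add: matrix_mul_assoc)
  then have "matrix_inv ?d = Jb ** matrix_inv ?c ** transpose J"
    using matrix_left_right_inverse matrix_inv_eqI by blast
  then have "hinv h d (cmap d x) $ l $ m = (Jb ** matrix_inv ?c ** transpose J) $ m $ l"
    by (simp add: hinv_def transpose_def)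
  also have "\<dots> = (\<Sum>j\<in>UNIV. \<Sum>k\<in>UNIV. hinv h c (cmap c x) $ j $ k * J $ l $ j * cnj (J $ m $ k))"
    by (simp add: matrix_matrix_mult_def transpose_def Jb_def hinv_def sum_distrib_left sum_distrib_right mult_ac)
  finally show ?thesis by (simp add: J_def)
qed

subsection \<open>Forms\<close>

abbreviation "Jc c d z \<equiv> (\<lambda>k j. jac c d z $ k $ j)"

text \<open>Exchanges the explicit sums and permutations of \<open>p0_form\<close> for
  \<open>pull\<close> and \<open>skew\<close>, once and for all.\<close>

lemma p0_form_iff:
  "p0_form A p u \<longleftrightarrow> (\<forall>c\<in>A. \<forall>z\<in>cimg c. skew p (u c z)) \<and>
    (\<forall>c\<in>A. \<forall>d\<in>A. \<forall>x\<in>cdom c \<inter> cdom d. \<forall>J. length J = p \<longrightarrow>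
       u c (cmap c x) J = pull (Jc c d (cmap c x)) (u d (cmap d x)) J)"
proof -
  have "(\<forall>J\<in>multi_idx p. u c (cmap c x) J =
      (\<Sum>K\<in>multi_idx p. (\<Prod>i<p. jac c d (cmap c x) $ (K ! i) $ (J ! i)) * u d (cmap d x) K)) \<longleftrightarrow>
    (\<forall>J. length J = p \<longrightarrow> u c (cmap c x) J = pull (Jc c d (cmap c x)) (u d (cmap d x)) J)" for c d x
  proof (intro iffI ballI allI impI)
    fix J :: "'n list" assume J: "length J = p"
      and *: "\<forall>J\<in>multi_idx p. u c (cmap c x) J =
        (\<Sum>K\<in>multi_idx p. (\<Prod>i<p. jac c d (cmap c x) $ (K ! i) $ (J ! i)) * u d (cmap d x) K)"
    have "J \<in> multi_idx p" using J by (simp add: multi_idx_def)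
    from bspec[OF * this] show "u c (cmap c x) J = pull (Jc c d (cmap c x)) (u d (cmap d x)) J"
      unfolding pull_eq[OF J] .
  next
    fix J :: "'n list" assume "J \<in> multi_idx p"
      and *: "\<forall>J. length J = p \<longrightarrow> u c (cmap c x) J = pull (Jc c d (cmap c x)) (u d (cmap d x)) J"
    then have J: "length J = p" by (simp add: multi_idx_def)
    from *[rule_format, OF J] show "u c (cmap c x) J =
        (\<Sum>K\<in>multi_idx p. (\<Prod>i<p. jac c d (cmap c x) $ (K ! i) $ (J ! i)) * u d (cmap d x) K)"
      unfolding pull_eq[OF J] .
  qed
  then show ?thesis unfolding p0_form_def perm_skew_iff[symmetric] perm_skew_def by (simp only:)
qed

lemma p0_form_skew: "p0_form A p u \<Longrightarrow> c \<in> A \<Longrightarrow> z \<in> cimg c \<Longrightarrow> skew p (u c z)"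
  unfolding p0_form_iff by blast

lemma p0_form_pull:
  "p0_form A p u \<Longrightarrow> c \<in> A \<Longrightarrow> d \<in> A \<Longrightarrow> x \<in> cdom c \<Longrightarrow> x \<in> cdom d \<Longrightarrow> length J = p \<Longrightarrow>
     u c (cmap c x) J = pull (Jc c d (cmap c x)) (u d (cmap d x)) J"
  unfolding p0_form_iff by blast

lemma p0_form_diff:
  assumes "p0_form A p u" "p0_form A p v"
  shows "p0_form A p (\<lambda>c z J. u c z J - v c z J)"
  unfolding p0_form_iff
  using assms by (auto intro!: skew_diff p0_form_skew simp: pull_diff p0_form_pull)

text \<open>\<open>form_inner\<close> is evaluated in the chart picked by \<open>chart_at\<close>;
  the choice drops out because the coefficients are pulled back by the Jacobian and
  \<open>ip_pull\<close> moves that Jacobian into the inverse metric.\<close>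

lemma form_inner_chart:
  assumes u: "p0_form A p u" and v: "p0_form A p v" and d: "d \<in> A" "x \<in> cdom d"
  shows "form_inner A h p u v x = ip (Hc d (cmap d x)) p (u d (cmap d x)) (v d (cmap d x)) / fact p"
proof -
  let ?c = "chart_at A x"
  note c = chart_at[of x]
  have "form_inner A h p u v x = ip (Hc ?c (cmap ?c x)) p (u ?c (cmap ?c x)) (v ?c (cmap ?c x)) / fact p"
    by (simp add: form_inner_def Let_def ip_eq)
  also have "ip (Hc ?c (cmap ?c x)) p (u ?c (cmap ?c x)) (v ?c (cmap ?c x)) =
    ip (Hc ?c (cmap ?c x)) p (pull (Jc ?c d (cmap ?c x)) (u d (cmap d x))) (pull (Jc ?c d (cmap ?c x)) (v d (cmap d x)))"
    by (rule ip_cong[OF p0_form_pull[OF u c(1) d(1) c(2) d(2)] p0_form_pull[OF v c(1) d(1) c(2) d(2)]])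
  also have "\<dots> = ip (Hc d (cmap d x)) p (u d (cmap d x)) (v d (cmap d x))"
    unfolding ip_pull hinv_transform[OF c(1) d(1) c(2) d(2)] ..
  finally show ?thesis .
qed

lemma form_inner_self:
  assumes u: "p0_form A p u"
  shows "Re (form_inner A h p u u x) \<ge> 0" "form_inner A h p u u x = of_real (Re (form_inner A h p u u x))"
proof -
  interpret c: pos_def_hermitian "h (chart_at A x) (cmap (chart_at A x) x)"
    by (rule pos_def) (simp_all add: chart_at cmap_in)
  obtain r where r: "ip (Hc (chart_at A x) (cmap (chart_at A x) x)) p (u (chart_at A x) (cmap (chart_at A x) x))
      (u (chart_at A x) (cmap (chart_at A x) x)) = complex_of_real r" "r \<ge> 0"
    using c.ip_nonneg[of p "u (chart_at A x) (cmap (chart_at A x) x)"] unfolding hinv_def by blast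
  have e: "form_inner A h p u u x = complex_of_real (r / fact p)" "r / fact p \<ge> 0"
    unfolding form_inner_chart[OF u u chart_at] r(1) using r(2) by simp_all
  then show "Re (form_inner A h p u u x) \<ge> 0" "form_inner A h p u u x = of_real (Re (form_inner A h p u u x))"
    unfolding e(1) Re_complex_of_real using e(2) by (simp_all only:)
qed

lemma fact_re: "Re (z / fact p) = Re z / fact p"
proof -
  have "z / fact p = z / complex_of_real (fact p)" by simp
  then show ?thesis by (simp only: Re_divide_of_real)
qed

lemma norm_form_inner_le:
  assumes u: "p0_form A p u" and v: "p0_form A p v"
  shows "norm (form_inner A h p u v x) \<le> (Re (form_inner A h p u u x) + Re (form_inner A h p v v x)) / 2"
proof -
  interpret c: pos_def_hermitian "h (chart_at A x) (cmap (chart_at A x) x)"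
    by (rule pos_def) (simp_all add: chart_at cmap_in)
  show ?thesis
    unfolding form_inner_chart[OF u v chart_at] form_inner_chart[OF u u chart_at] form_inner_chart[OF v v chart_at] hinv_def
    using c.ip_bound[of p "u (chart_at A x) (cmap (chart_at A x) x)" "v (chart_at A x) (cmap (chart_at A x) x)"]
    by (simp add: norm_divide fact_re field_simps)
qed

lemma form_inner_eq_0D:
  assumes u: "p0_form A p u" and 0: "form_inner A h p u u x = 0" and c: "c \<in> A" "x \<in> cdom c" "length J = p"
  shows "u c (cmap c x) J = 0"
proof -
  interpret c: pos_def_hermitian "h c (cmap c x)" by (rule pos_def) (use c in \<open>auto simp: cmap_in\<close>)
  show ?thesis
  proof (rule c.ip_eq_0[OF _ c(3)])
    have "ip (Hc c (cmap c x)) p (u c (cmap c x)) (u c (cmap c x)) / fact p = 0"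
      using 0 unfolding form_inner_chart[OF u u c(1,2)] .
    then show "ip c.Hi p (u c (cmap c x)) (u c (cmap c x)) = 0"
      unfolding hinv_def divide_eq_0_iff by (metis fact_nonzero)
  qed
qed

lemma form_inner_diff_right:
  "form_inner A h p u (\<lambda>c z J. v c z J - w c z J) x = form_inner A h p u v x - form_inner A h p u w x"
  unfolding form_inner_def Let_def
  by (simp add: algebra_simps sum_subtractf diff_divide_distrib)

lemma form_inner_diff_left:
  "form_inner A h p (\<lambda>c z J. v c z J - w c z J) u x = form_inner A h p v u x - form_inner A h p w u x"
  unfolding form_inner_def Let_def
  by (simp add: algebra_simps sum_subtractf diff_divide_distrib)

subsection \<open>Integration in charts\<close>

text \<open>The atlas may be uncountable; a countable subcover, from second countability, makes
  measurability and statements almost everywhere local.\<close>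

lemma countable_charts: obtains F where "countable F" "F \<subseteq> A" "(\<Union>c\<in>F. cdom c) = UNIV"
proof -
  have "\<And>U. U \<in> cdom ` A \<Longrightarrow> open U" using open_cdom by auto
  then obtain G where G: "G \<subseteq> cdom ` A" "countable G" "\<Union>G = \<Union>(cdom ` A)" by (rule Lindelof)
  then obtain F where F: "countable F" "F \<subseteq> A" "G = cdom ` F"
    by (metis countable_subset_image)
  then show thesis using that[of F] G(3) atlas unfolding complex_atlas_def by simp
qed

lemma sets_V [simp]: "sets V = sets borel" and space_V [simp]: "space V = UNIV"
  using dvol sets_eq_imp_space_eq[of V borel] unfolding is_dvol_def by auto

lemma measurable_V [simp]: "measurable V M = measurable borel M"
  by (rule measurable_cong_sets) simp_all

lemma AE_V:
  assumes "\<And>c. c \<in> A \<Longrightarrow> AE x in V. x \<in> cdom c \<longrightarrow> P x"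
  shows "AE x in V. P x"
proof -
  obtain F where F: "countable F" "F \<subseteq> A" "(\<Union>c\<in>F. cdom c) = UNIV" by (rule countable_charts)
  have "AE x in V. \<forall>c\<in>F. x \<in> cdom c \<longrightarrow> P x"
    using F assms by (subst AE_ball_countable) auto
  then show ?thesis by eventually_elim (use F(3) in auto)
qed

lemma borel_measurable_V:
  fixes f :: "'a \<Rightarrow> 'b::topological_space"
  assumes "\<And>c. c \<in> A \<Longrightarrow> f \<in> borel_measurable (restrict_space borel (cdom c))"
  shows "f \<in> borel_measurable borel"
proof (rule measurableI)
  fix B :: "'b set" assume B: "B \<in> sets borel"
  obtain F where F: "countable F" "F \<subseteq> A" "(\<Union>c\<in>F. cdom c) = UNIV" by (rule countable_charts)
  have "f -` B \<inter> cdom c \<in> sets borel" if "c \<in> F" for c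
  proof -
    have c: "c \<in> A" using F that by auto
    have "f -` B \<inter> space (restrict_space borel (cdom c)) \<in> sets (restrict_space borel (cdom c))"
      by (rule measurable_sets[OF assms[OF c] B])
    then show ?thesis using open_cdom[OF c] by (simp add: space_restrict_space sets_restrict_space_iff)
  qed
  then have "(\<Union>c\<in>F. f -` B \<inter> cdom c) \<in> sets borel" by (intro sets.countable_UN''[OF F(1)])
  moreover have "(\<Union>c\<in>F. f -` B \<inter> cdom c) = f -` B \<inter> space borel" using F(3) by auto
  ultimately show "f -` B \<inter> space borel \<in> sets borel" by simp
qed auto

lemma cmap_measurable:
  assumes "c \<in> A"
  shows "cmap c \<in> measurable (restrict_space borel (cdom c)) (restrict_space lborel (cimg c))"
proof (rule measurable_restrict_space2)
  show "cmap c \<in> space (restrict_space borel (cdom c)) \<rightarrow> cimg c"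
    using cmap_in[OF assms] by (auto simp: space_restrict_space)
  have "cmap c \<in> borel_measurable (restrict_space borel (cdom c))"
    by (rule borel_measurable_continuous_on_restrict[OF continuous_cmap[OF assms]])
  then show "cmap c \<in> measurable (restrict_space borel (cdom c)) lborel" by simp
qed

lemma cinv_measurable:
  assumes "c \<in> A"
  shows "cinv c \<in> measurable (restrict_space lborel (cimg c)) borel"
  by (simp add: measurable_restrict_lborel borel_measurable_continuous_on_restrict[OF continuous_cinv[OF assms]])

text \<open>The volume of a set in the chart is an integral over its image, and the image of
  \<open>B\<close> lies in a Lebesgue null set.\<close>

lemma AE_chart:
  assumes c: "c \<in> A" and P: "AE z in lborel. z \<in> cimg c \<longrightarrow> P z"
  shows "AE x in V. x \<in> cdom c \<longrightarrow> P (cmap c x)"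
proof -
  obtain N where N: "{z \<in> space lborel. \<not> (z \<in> cimg c \<longrightarrow> P z)} \<subseteq> N" "emeasure lborel N = 0" "N \<in> sets lborel"
    by (rule AE_E[OF P])
  define B where "B = cmap c -` N \<inter> cdom c"
  have Bb: "B \<in> sets borel"
  proof -
    have "N \<inter> cimg c \<in> sets (restrict_space lborel (cimg c))"
      using N(3) open_cimg[OF c] by (simp add: sets_restrict_space_iff)
    then have "cmap c -` (N \<inter> cimg c) \<inter> space (restrict_space borel (cdom c)) \<in> sets (restrict_space borel (cdom c))"
      by (rule measurable_sets[OF cmap_measurable[OF c]])
    moreover have "cmap c -` (N \<inter> cimg c) \<inter> space (restrict_space borel (cdom c)) = B"
      using cmap_in[OF c] by (auto simp: B_def space_restrict_space)
    ultimately show ?thesis using open_cdom[OF c] by (simp add: sets_restrict_space_iff)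
  qed
  have "emeasure V B = (\<integral>\<^sup>+ z \<in> cmap c ` B. ennreal (Re (det (h c z))) \<partial>lborel)"
    using dvol c Bb unfolding is_dvol_def B_def by blast
  also have "\<dots> = (\<integral>\<^sup>+ z. 0 \<partial>(lborel :: (complex^'n) measure))"
  proof (rule nn_integral_cong_AE)
    have "AE z in lborel. z \<notin> N" using N(2,3) by (intro AE_not_in) auto
    then show "AE z in lborel. ennreal (Re (det (h c z))) * indicator (cmap c ` B) z = 0"
      by eventually_elim (auto simp: B_def indicator_def)
  qed
  finally have "B \<in> null_sets V" using Bb by (simp add: null_sets_def)
  then have "AE x in V. x \<notin> B" by (rule AE_not_in)
  then show ?thesis
  proof eventually_elim
    fix x assume "x \<notin> B"
    then show "x \<in> cdom c \<longrightarrow> P (cmap c x)"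
      using N(1) cmap_in[OF c] by (auto simp: B_def)
  qed
qed

lemma continuous_det: "c \<in> A \<Longrightarrow> continuous_on (cimg c) (\<lambda>z. Re (det (h c z)))"
  using C1_on_continuous[OF C1_on_det[OF kaehler_chart.G_C1[OF kaehler_chart]]]
  by (intro continuous_on_Re)

lemma chart_det_pos: "c \<in> A \<Longrightarrow> z \<in> cimg c \<Longrightarrow> Re (det (h c z)) > 0"
  by (rule pos_def_hermitian.det_pos[OF pos_def])

text \<open>\<open>is_dvol\<close> speaks of the volume of sets. As an identity of measures it
  transfers integrals too, through \<open>distr\<close> and \<open>density\<close>.\<close>

lemma V_chart:
  assumes c: "c \<in> A"
  shows "distr (density (restrict_space lborel (cimg c)) (\<lambda>z. ennreal (Re (det (h c z))))) borel (cinv c)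
    = density V (indicator (cdom c))" (is "?N = ?W")
proof (rule measure_eqI)
  have dm: "(\<lambda>z. Re (det (h c z))) \<in> borel_measurable (restrict_space lborel (cimg c))"
    by (simp add: measurable_restrict_lborel borel_measurable_continuous_on_restrict[OF continuous_det[OF c]])
  show "sets ?N = sets ?W" by simp
  fix B assume "B \<in> sets ?N"
  then have B: "B \<in> sets borel" by simp
  have BU: "cdom c \<inter> B \<in> sets borel" "cdom c \<inter> B \<subseteq> cdom c" using B open_cdom[OF c] by auto
  have cm: "cinv c \<in> measurable (density (restrict_space lborel (cimg c)) (\<lambda>z. ennreal (Re (det (h c z))))) borel"
    using cinv_measurable[OF c] by simp
  have vs: "cinv c -` B \<inter> space (restrict_space lborel (cimg c)) \<in> sets (restrict_space lborel (cimg c))"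
    by (rule measurable_sets[OF cinv_measurable[OF c] B])
  have "emeasure ?N B = emeasure (density (restrict_space lborel (cimg c)) (\<lambda>z. ennreal (Re (det (h c z)))))
      (cinv c -` B \<inter> space (restrict_space lborel (cimg c)))"
    by (subst emeasure_distr[OF cm B]) simp
  also have "\<dots> = (\<integral>\<^sup>+ z. ennreal (Re (det (h c z))) * indicator (cinv c -` B \<inter> space (restrict_space lborel (cimg c))) z
      \<partial>restrict_space lborel (cimg c))"
    by (rule emeasure_density[OF _ vs]) (use dm in measurable)
  also have "\<dots> = (\<integral>\<^sup>+ z. ennreal (Re (det (h c z))) * indicator (cinv c -` B \<inter> space (restrict_space lborel (cimg c))) z
      * indicator (cimg c) z \<partial>lborel)"
    by (rule nn_integral_restrict_space) (simp add: open_cimg[OF c])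
  also have "\<dots> = (\<integral>\<^sup>+ z \<in> cmap c ` (cdom c \<inter> B). ennreal (Re (det (h c z))) \<partial>lborel)"
    unfolding overlap_eq[OF c] by (intro nn_integral_cong) (auto simp: indicator_def space_restrict_space)
  also have "\<dots> = emeasure V (cdom c \<inter> B)"
  proof -
    have "\<forall>B \<in> sets borel. B \<subseteq> cdom c \<longrightarrow>
        emeasure V B = (\<integral>\<^sup>+ z \<in> cmap c ` B. ennreal (Re (det (h c z))) \<partial>lborel)"
      using dvol c unfolding is_dvol_def by blast
    from this[rule_format, OF BU] show ?thesis by simp
  qed
  also have "\<dots> = (\<integral>\<^sup>+ x. indicator (cdom c) x * indicator B x \<partial>V)"
  proof -
    have "(\<integral>\<^sup>+ x. indicator (cdom c) x * indicator B x \<partial>V) = (\<integral>\<^sup>+ x. indicator (cdom c \<inter> B) x \<partial>V)"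
      by (simp only: indicator_inter_arith)
    also have "\<dots> = emeasure V (cdom c \<inter> B)" by (rule nn_integral_indicator) (simp add: BU(1))
    finally show ?thesis by simp
  qed
  also have "\<dots> = emeasure ?W B"
    by (rule emeasure_density[symmetric], rule borel_measurable_indicator)
      (simp_all add: B open_cdom[OF c])
  finally show "emeasure ?N B = emeasure ?W B" .
qed

lemma integral_chart:
  fixes f :: "'a \<Rightarrow> complex"
  assumes c: "c \<in> A" and f: "f \<in> borel_measurable borel" and z: "\<And>x. x \<notin> cdom c \<Longrightarrow> f x = 0"
  shows "integrable V f \<longleftrightarrow> integrable lborel (\<lambda>z. indicator (cimg c) z *\<^sub>R (f (cinv c z) * Re (det (h c z))))"
    and "integral\<^sup>L V f = (LINT z|lborel. indicator (cimg c) z *\<^sub>R (f (cinv c z) * Re (det (h c z))))"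
proof -
  let ?R = "restrict_space lborel (cimg c)"
  let ?D = "density ?R (\<lambda>z. ennreal (Re (det (h c z))))"
  have dm: "(\<lambda>z. Re (det (h c z))) \<in> borel_measurable ?R"
    by (simp add: measurable_restrict_lborel borel_measurable_continuous_on_restrict[OF continuous_det[OF c]])
  have cm: "cinv c \<in> measurable ?D borel" using cinv_measurable[OF c] by simp
  have fc: "(\<lambda>z. f (cinv c z)) \<in> borel_measurable ?R"
    by (rule measurable_compose[OF cinv_measurable[OF c] f])
  have nn: "AE z in ?R. 0 \<le> Re (det (h c z))"
    by (rule AE_I2) (use chart_det_pos[OF c] in \<open>auto simp: space_restrict_space intro: less_imp_le\<close>)
  have ind: "(\<lambda>x. ennreal (indicator (cdom c) x)) = indicator (cdom c)"
    by (auto simp: indicator_def fun_eq_iff)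
  have W: "density V (\<lambda>x. ennreal (indicator (cdom c) x)) = distr ?D borel (cinv c)"
    unfolding ind V_chart[OF c] ..
  have im: "(indicator (cdom c) :: 'a \<Rightarrow> real) \<in> borel_measurable V"
    by (rule borel_measurable_indicator) (simp add: open_cdom[OF c])
  have fV: "f \<in> borel_measurable V" using f by simp
  have fe: "(\<lambda>x. indicator (cdom c) x *\<^sub>R f x) = f" using z by (auto simp: indicator_def fun_eq_iff)
  have e: "Re (det (h c w)) *\<^sub>R f (cinv c w) = f (cinv c w) * Re (det (h c w))" for w
    by (simp add: scaleR_conv_of_real)
  have om: "cimg c \<inter> space lborel \<in> sets lborel" using open_cimg[OF c] by simp
  have "integrable V f \<longleftrightarrow> integrable (density V (\<lambda>x. ennreal (indicator (cdom c) x))) f"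
    by (subst integrable_density[OF fV im]) (simp_all add: fe)
  also have "\<dots> \<longleftrightarrow> integrable ?D (\<lambda>z. f (cinv c z))"
    unfolding W by (rule integrable_distr_eq[OF cm f])
  also have "\<dots> \<longleftrightarrow> integrable ?R (\<lambda>z. f (cinv c z) * Re (det (h c z)))"
    unfolding integrable_density[OF fc dm nn] e ..
  finally show "integrable V f \<longleftrightarrow> integrable lborel (\<lambda>z. indicator (cimg c) z *\<^sub>R (f (cinv c z) * Re (det (h c z))))"
    unfolding integrable_restrict_space[OF om] .
  have "integral\<^sup>L V f = integral\<^sup>L (density V (\<lambda>x. ennreal (indicator (cdom c) x))) f"
    by (subst integral_density[OF fV im]) (simp_all add: fe)
  also have "\<dots> = integral\<^sup>L ?D (\<lambda>z. f (cinv c z))"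
    unfolding W by (rule integral_distr[OF cm f])
  also have "\<dots> = integral\<^sup>L ?R (\<lambda>z. f (cinv c z) * Re (det (h c z)))"
    unfolding integral_density[OF fc dm nn] e ..
  finally show "integral\<^sup>L V f = (LINT z|lborel. indicator (cimg c) z *\<^sub>R (f (cinv c z) * Re (det (h c z))))"
    unfolding integral_restrict_space[OF om] .
qed

definition coeff_measurable :: "nat \<Rightarrow> ('a, 'n) form \<Rightarrow> bool" where
  "coeff_measurable p u \<longleftrightarrow>
     (\<forall>c\<in>A. \<forall>J\<in>multi_idx p. set_borel_measurable lborel (cimg c) (\<lambda>z. u c z J))"

text \<open>The choice made by \<open>chart_at\<close> need not depend measurably on the point. On a
  fixed chart \<open>form_inner_chart\<close> replaces it by that chart, and
  \<open>borel_measurable_V\<close> glues.\<close>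

lemma measurable_form_inner:
  assumes u: "p0_form A p u" "coeff_measurable p u" and v: "p0_form A p v" "coeff_measurable p v"
  shows "form_inner A h p u v \<in> borel_measurable borel"
proof (rule borel_measurable_V)
  fix c assume c: "c \<in> A"
  let ?R = "restrict_space lborel (cimg c)"
  have om: "cimg c \<inter> space lborel \<in> sets lborel" using open_cimg[OF c] by simp
  have wm: "(\<lambda>z. w c z J) \<in> borel_measurable ?R"
    if "coeff_measurable p w" "J \<in> multi_idx p" for w :: "('a, 'n) form" and J
    using that c unfolding coeff_measurable_def set_borel_measurable_def borel_measurable_restrict_space_iff[OF om]
    by blast
  have H: "(\<lambda>z. hinv h c z $ j $ k) \<in> borel_measurable ?R" for j k
  proof -
    have "continuous_on (cimg c) (\<lambda>z. hinv h c z $ j $ k)"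
      using C1_on_continuous[OF kaehler_chart.H_C1[OF kaehler_chart[OF c]]] by (simp add: H_hinv[OF c])
    from borel_measurable_continuous_on_restrict[OF this]
    show ?thesis by (simp add: measurable_restrict_lborel)
  qed
  have cn: "(\<lambda>z. cnj (v c z J)) \<in> borel_measurable ?R" if "J \<in> multi_idx p" for J
    by (rule measurable_compose[OF wm[OF v(2) that]], rule borel_measurable_continuous_onI, intro continuous_intros)
  have "(\<lambda>z. ip (Hc c z) p (u c z) (v c z) / fact p) \<in> borel_measurable ?R"
    unfolding ip_eq
    by (intro borel_measurable_divide borel_measurable_sum borel_measurable_times borel_measurable_prod H
        borel_measurable_const wm[OF u(2)] cn)
  from measurable_compose[OF cmap_measurable[OF c] this]
  have "(\<lambda>x. ip (Hc c (cmap c x)) p (u c (cmap c x)) (v c (cmap c x)) / fact p) \<in> borel_measurable (restrict_space borel (cdom c))" .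
  then show "form_inner A h p u v \<in> borel_measurable (restrict_space borel (cdom c))"
    by (rule measurable_cong[THEN iffD1, rotated]) (simp add: space_restrict_space form_inner_chart[OF u(1) v(1) c])
qed

lemma measurable_weight: "(\<lambda>x. exp (- \<psi> x)) \<in> borel_measurable borel"
proof (rule borel_measurable_V)
  fix c assume c: "c \<in> A"
  have "continuous_on (cdom c) (\<lambda>x. \<psi> (cinv c (cmap c x)))"
    by (rule continuous_on_compose2[OF C1_on_continuous[OF kaehler_chart.\<psi>_C1[OF kaehler_chart[OF c]]] continuous_cmap[OF c]])
      (auto simp: cmap_in[OF c])
  then have "continuous_on (cdom c) \<psi>" by (rule continuous_on_eq) (simp add: cinv_cmap[OF c])
  then show "(\<lambda>x. exp (- \<psi> x)) \<in> borel_measurable (restrict_space borel (cdom c))"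
    by (intro borel_measurable_continuous_on_restrict continuous_intros)
qed

lemma L2_iff:
  "u \<in> L2 A h V \<psi> p \<longleftrightarrow> p0_form A p u \<and> coeff_measurable p u \<and>
     integrable V (\<lambda>x. Re (form_inner A h p u u x) * exp (- \<psi> x))"
  unfolding L2_def coeff_measurable_def by blast

lemma L2_integrable:
  assumes u: "u \<in> L2 A h V \<psi> p" and v: "v \<in> L2 A h V \<psi> p"
  shows "integrable V (\<lambda>x. form_inner A h p u v x * complex_of_real (exp (- \<psi> x)))"
proof (rule Bochner_Integration.integrable_bound)
  note u' = u[unfolded L2_iff] and v' = v[unfolded L2_iff]
  show "integrable V (\<lambda>x. (Re (form_inner A h p u u x) * exp (- \<psi> x) + Re (form_inner A h p v v x) * exp (- \<psi> x)) / 2)"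
    using u' v' by auto
  have [measurable]: "form_inner A h p u v \<in> borel_measurable V" "(\<lambda>x. exp (- \<psi> x)) \<in> borel_measurable V"
    using measurable_form_inner[of p u v] measurable_weight u' v' by auto
  show "(\<lambda>x. form_inner A h p u v x * complex_of_real (exp (- \<psi> x))) \<in> borel_measurable V" by measurable
  show "AE x in V. norm (form_inner A h p u v x * complex_of_real (exp (- \<psi> x))) \<le>
      norm ((Re (form_inner A h p u u x) * exp (- \<psi> x) + Re (form_inner A h p v v x) * exp (- \<psi> x)) / 2)"
  proof (rule AE_I2)
    fix x
    have "norm (form_inner A h p u v x) * exp (- \<psi> x) \<le>
        (Re (form_inner A h p u u x) + Re (form_inner A h p v v x)) / 2 * exp (- \<psi> x)"
      by (rule mult_right_mono[OF norm_form_inner_le]) (use u' v' in auto)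
    also have "\<dots> = norm ((Re (form_inner A h p u u x) * exp (- \<psi> x) + Re (form_inner A h p v v x) * exp (- \<psi> x)) / 2)"
      using form_inner_self(1)[of p u x] form_inner_self(1)[of p v x] u' v' by (simp add: distrib_right add_divide_distrib)
    finally show "norm (form_inner A h p u v x * complex_of_real (exp (- \<psi> x))) \<le>
        norm ((Re (form_inner A h p u u x) * exp (- \<psi> x) + Re (form_inner A h p v v x) * exp (- \<psi> x)) / 2)"
      by (simp add: norm_mult)
  qed
qed

end

section \<open>Pullbacks along holomorphic coordinate changes\<close>

lemma differentiable_pull:
  fixes M :: "complex^'m::finite \<Rightarrow> 'n::finite \<Rightarrow> 'n \<Rightarrow> complex"
  assumes M: "\<And>k y. (\<lambda>w. M w k y) differentiable (at z)"
  shows "(\<And>K. length K = length J \<Longrightarrow> (\<lambda>w. u w K) differentiable (at z)) \<Longrightarrow>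
    (\<lambda>w. pull (M w) (u w) J) differentiable (at z)"
proof (induction J arbitrary: u)
  case (Cons x J)
  have "(\<lambda>w. pull (M w) (\<lambda>K. u w (k # K)) J) differentiable (at z)" for k
    by (rule Cons.IH) (use Cons.prems in auto)
  then show ?case unfolding pull.simps
    by (intro differentiable_sum differentiable_mult M ballI) simp_all
qed simp

lemma dz_pull:
  fixes M :: "complex^'m::finite \<Rightarrow> 'n::finite \<Rightarrow> 'n \<Rightarrow> complex"
  assumes M: "\<And>k y. (\<lambda>w. M w k y) differentiable (at z)"
  shows "(\<And>K. length K = length J \<Longrightarrow> (\<lambda>w. u w K) differentiable (at z)) \<Longrightarrow>
    dz j (\<lambda>w. pull (M w) (u w) J) z =
      pullD (M z) (\<lambda>k y. dz j (\<lambda>w. M w k y) z) (u z) J + pull (M z) (\<lambda>K. dz j (\<lambda>w. u w K) z) J"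
proof (induction J arbitrary: u)
  case (Cons x J)
  have d: "(\<lambda>w. pull (M w) (\<lambda>K. u w (k # K)) J) differentiable (at z)" for k
    by (rule differentiable_pull[OF M]) (use Cons.prems in auto)
  have IH: "dz j (\<lambda>w. pull (M w) (\<lambda>K. u w (k # K)) J) z =
      pullD (M z) (\<lambda>k y. dz j (\<lambda>w. M w k y) z) (\<lambda>K. u z (k # K)) J
      + pull (M z) (\<lambda>K. dz j (\<lambda>w. u w (k # K)) z) J" for k
    by (rule Cons.IH) (use Cons.prems in auto)
  have "dz j (\<lambda>w. pull (M w) (u w) (x # J)) z =
      (\<Sum>k\<in>UNIV. dz j (\<lambda>w. M w k x * pull (M w) (\<lambda>K. u w (k # K)) J) z)"
    unfolding pull.simps by (intro dz_sum differentiable_mult M d)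
  also have "\<dots> = (\<Sum>k\<in>UNIV. dz j (\<lambda>w. M w k x) z * pull (M z) (\<lambda>K. u z (k # K)) J +
      M z k x * dz j (\<lambda>w. pull (M w) (\<lambda>K. u w (k # K)) J) z)"
    by (intro sum.cong refl dz_mult M d)
  finally show ?case unfolding IH by (simp add: sum.distrib algebra_simps)
qed simp

lemma C1_on_pull:
  assumes M: "\<And>k y. C1_on S (\<lambda>w. M w k y)"
  shows "(\<And>K. length K = length J \<Longrightarrow> C1_on S (\<lambda>w. u w K)) \<Longrightarrow> C1_on S (\<lambda>w. pull (M w) (u w) J)"
proof (induction J arbitrary: u)
  case (Cons x J)
  have "C1_on S (\<lambda>w. pull (M w) (\<lambda>K. u w (k # K)) J)" for k
    by (rule Cons.IH) (use Cons.prems in auto)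
  then show ?case unfolding pull.simps by (intro C1_on_sum C1_on_mult M)
qed simp

lemma continuous_on_pull:
  assumes M: "\<And>k y. continuous_on S (\<lambda>w. M w k y)"
  shows "(\<And>K. length K = length J \<Longrightarrow> continuous_on S (\<lambda>w. u w K)) \<Longrightarrow> continuous_on S (\<lambda>w. pull (M w) (u w) J)"
proof (induction J arbitrary: u)
  case (Cons x J)
  have "continuous_on S (\<lambda>w. pull (M w) (\<lambda>K. u w (k # K)) J)" for k
    by (rule Cons.IH) (use Cons.prems in auto)
  then show ?case unfolding pull.simps by (intro continuous_intros M)
qed simp

text \<open>The second derivatives of \<open>T\<close> drop out because they are symmetric.\<close>

lemma altd_dz_pull:
  fixes T :: "complex^'n::finite \<Rightarrow> complex^'n"
  assumes S: "open S" and T: "\<And>l. holo_on S (\<lambda>w. T w $ l)" and z: "z \<in> S"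
    and a: "\<And>K. length K = p \<Longrightarrow> (\<lambda>w. a w K) differentiable (at (T z))"
    and sk: "skew p (a (T z))" and J: "length J = Suc p"
  shows "altd (\<lambda>j L. dz j (\<lambda>w. pull (\<lambda>k y. dz y (\<lambda>w. T w $ k) w) (a (T w)) L) z) J =
    pull (\<lambda>k y. dz y (\<lambda>w. T w $ k) z) (altd (\<lambda>j L. dz j (\<lambda>w. a w L) (T z))) J"
proof -
  let ?M = "\<lambda>w k y. dz y (\<lambda>w. T w $ k) w"
  let ?N = "\<lambda>k y j. dz j (\<lambda>w. ?M w k y) z"
  have M: "(\<lambda>w. ?M w k y) differentiable (at z)" for k y
    by (rule holo_on_differentiable[OF holo_on_dz[OF S T] z])
  have sym: "?N k x y = ?N k y x" for k x y
    by (rule dz_commute[OF S T z])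
  have "altd (\<lambda>j L. dz j (\<lambda>w. pull (?M w) (a (T w)) L) z) J =
    altd (\<lambda>j L. pullD (?M z) (\<lambda>k y. ?N k y j) (a (T z)) L
      + (\<Sum>l\<in>UNIV. ?M z l j * pull (?M z) (\<lambda>K. dz l (\<lambda>w. a w K) (T z)) L)) J"
  proof (rule altd_cong)
    fix j and L :: "'n list" assume "Suc (length L) = length J"
    then have L: "length L = p" using J by simp
    have "dz j (\<lambda>w. pull (?M w) (a (T w)) L) z =
      pullD (?M z) (\<lambda>k y. ?N k y j) (a (T z)) L + pull (?M z) (\<lambda>K. dz j (\<lambda>w. a (T w) K) z) L"
      by (rule dz_pull[OF M]) (use dz_compose(3)[OF T z a] L in auto)
    also have "pull (?M z) (\<lambda>K. dz j (\<lambda>w. a (T w) K) z) L =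
        pull (?M z) (\<lambda>K. \<Sum>l\<in>UNIV. ?M z l j * dz l (\<lambda>w. a w K) (T z)) L"
      by (rule pull_cong, rule dz_compose(1)[OF T z a]) (use L in auto)
    finally show "dz j (\<lambda>w. pull (?M w) (a (T w)) L) z =
      pullD (?M z) (\<lambda>k y. ?N k y j) (a (T z)) L
      + (\<Sum>l\<in>UNIV. ?M z l j * pull (?M z) (\<lambda>K. dz l (\<lambda>w. a w K) (T z)) L)"
      by (simp add: pull_sum)
  qed
  also have "\<dots> = pull (?M z) (altd (\<lambda>l K. dz l (\<lambda>w. a w K) (T z))) J"
    by (rule altd_pull[of ?N, OF sym _ sk]) (simp add: J)
  finally show ?thesis .
qed

lemma del_altd: "del u c z = altd (\<lambda>j L. dz j (\<lambda>w. u c w L) z)"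
  by (simp add: del_def altd_def fun_eq_iff)

section \<open>Test forms supported in one chart\<close>

context kaehler_setup
begin

text \<open>Integration by parts in each term, for a coefficient times the compactly supported test
  function. It serves for the test forms and for holomorphic forms, where it shows that
  \<open>D_op\<close> extends \<open>del_op\<close>.\<close>

lemma weak_del_C1:
  assumes u: "\<And>c J. c \<in> A \<Longrightarrow> length J = p \<Longrightarrow> C1_on (cimg c) (\<lambda>z. u c z J)"
    and f: "\<And>c z J. c \<in> A \<Longrightarrow> z \<in> cimg c \<Longrightarrow> length J = Suc p \<Longrightarrow> f c z J = del u c z J"
  shows "weak_del A p u f"
  unfolding weak_del_def
proof (intro ballI allI impI)
  fix c and J :: "'n list" and \<phi> :: "complex^'n \<Rightarrow> complex"
  assume c: "c \<in> A" and "J \<in> multi_idx (Suc p)"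
    and \<phi>: "smooth_on UNIV \<phi> \<and> compact (closure {z. \<phi> z \<noteq> 0}) \<and> closure {z. \<phi> z \<noteq> 0} \<subseteq> cimg c"
  then have J: "length J = Suc p" by (simp add: multi_idx_def)
  interpret c: kaehler_chart "cimg c" "h c" "\<lambda>z. \<psi> (cinv c z)" by (rule kaehler_chart[OF c])
  let ?K = "closure {z. \<phi> z \<noteq> 0}"
  have K: "compact ?K" "?K \<subseteq> cimg c" using \<phi> by auto
  have \<phi>C: "C1_on (cimg c) \<phi>" by (rule C1_on_subset[OF smooth_on_C1]) (use \<phi> in auto)
  have \<phi>z: "\<phi> z = 0" if "z \<notin> ?K" for z using that closure_subset[of "{z. \<phi> z \<noteq> 0}"] by blast
  let ?u = "\<lambda>i z. u c z (del_nth i J)"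
  have uC: "C1_on (cimg c) (?u i)" if "i < Suc p" for i
    by (rule u[OF c]) (use that J in \<open>simp add: length_del_nth\<close>)
  define E where "E i z = (-1) ^ i * (?u i z * \<phi> z)" for i z
  have EC: "C1_on (cimg c) (E i)" if "i < Suc p" for i
    unfolding E_def by (intro C1_on_mult C1_on_const uC that \<phi>C)
  have Ez: "E i z = 0" if "z \<in> cimg c - ?K" for i z
  proof -
    have "\<phi> z = 0" by (rule \<phi>z) (use that in blast)
    then show ?thesis by (simp add: E_def)
  qed
  define P where "P z = (\<Sum>i<Suc p. (-1) ^ i * ?u i z * dz (J ! i) \<phi> z)" for z
  have Pz: "P z = 0" if "z \<in> cimg c - ?K" for z
  proof -
    have "dz j \<phi> z = dz j (\<lambda>w. 0) z" for j
    proof (rule dz_cong_open)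
      show "open (- ?K)" by (rule open_Compl[OF closed_closure])
      show "z \<in> - ?K" using that by blast
      show "\<phi> w = 0" if "w \<in> - ?K" for w by (rule \<phi>z) (use that in blast)
    qed
    then show ?thesis by (simp add: P_def)
  qed
  have Pc: "continuous_on (cimg c) P"
    unfolding P_def by (intro continuous_intros C1_on_continuous[OF uC] C1_on_continuous_dz[OF \<phi>C]) simp
  have Pi: "integrable lborel (\<lambda>z. indicator (cimg c) z *\<^sub>R P z)"
    by (rule c.integrable_on_chart[OF K Pc Pz])
  have Ei: "integrable lborel (\<lambda>z. indicator (cimg c) z *\<^sub>R dz (J ! i) (E i) z)"
    "(LINT z|lborel. indicator (cimg c) z *\<^sub>R dz (J ! i) (E i) z) = 0" if "i < Suc p" for i
    by (rule c.integral_dz_eq_0[OF K EC[OF that] Ez], assumption)+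
  have eq: "indicator (cimg c) z *\<^sub>R (f c z J * \<phi> z) =
      (\<Sum>i<Suc p. indicator (cimg c) z *\<^sub>R dz (J ! i) (E i) z) - indicator (cimg c) z *\<^sub>R P z" for z
  proof (cases "z \<in> cimg c")
    case True
    have "dz (J ! i) (E i) z = (-1) ^ i * (dz (J ! i) (?u i) z * \<phi> z + ?u i z * dz (J ! i) \<phi> z)" if "i < Suc p" for i
      unfolding E_def
      by (subst dz_cmult[OF differentiable_mult[OF C1_on_differentiable[OF uC[OF that] True] C1_on_differentiable[OF \<phi>C True]]])
        (simp add: dz_mult[OF C1_on_differentiable[OF uC[OF that] True] C1_on_differentiable[OF \<phi>C True]])
    then have "(\<Sum>i<Suc p. dz (J ! i) (E i) z) = (\<Sum>i<Suc p. (-1) ^ i * dz (J ! i) (?u i) z) * \<phi> z + P z"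
      unfolding P_def sum_distrib_right sum.distrib[symmetric]
      by (intro sum.cong) (auto simp: algebra_simps)
    moreover have "f c z J = (\<Sum>i<Suc p. (-1) ^ i * dz (J ! i) (?u i) z)"
      unfolding f[OF c True J] del_def J ..
    ultimately show ?thesis using True by simp
  qed simp
  have "(LINT z:cimg c|lborel. f c z J * \<phi> z) =
      (LINT z|lborel. (\<Sum>i<Suc p. indicator (cimg c) z *\<^sub>R dz (J ! i) (E i) z) - indicator (cimg c) z *\<^sub>R P z)"
    unfolding set_lebesgue_integral_def eq ..
  also have "\<dots> = (LINT z|lborel. (\<Sum>i<Suc p. indicator (cimg c) z *\<^sub>R dz (J ! i) (E i) z)) -
      (LINT z|lborel. indicator (cimg c) z *\<^sub>R P z)"
    by (rule Bochner_Integration.integral_diff[OF Bochner_Integration.integrable_sum Pi], rule Ei(1), simp)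
  also have "(LINT z|lborel. (\<Sum>i<Suc p. indicator (cimg c) z *\<^sub>R dz (J ! i) (E i) z)) =
      (\<Sum>i<Suc p. LINT z|lborel. indicator (cimg c) z *\<^sub>R dz (J ! i) (E i) z)"
    by (rule Bochner_Integration.integral_sum, rule Ei(1), simp)
  also have "\<dots> = 0" by (rule sum.neutral, rule ballI, rule Ei(2), simp)
  finally show "(LINT z:cimg c|lborel. f c z J * \<phi> z) =
      - (LINT z:cimg c|lborel. \<Sum>i<Suc p. (-1) ^ i * u c z (del_nth i J) * dz (J ! i) \<phi> z)"
    by (simp add: set_lebesgue_integral_def P_def)
qed

text \<open>For \<open>a\<close> with compact support in the chart \<open>c\<close>, these are the test forms for the adjoint of \<open>D\<close>.\<close>

definition transport :: "('a, 'n) chart \<Rightarrow> (complex^'n \<Rightarrow> 'n list \<Rightarrow> complex) \<Rightarrow> ('a, 'n) form" where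
  "transport c a d z J =
     (if cinv d z \<in> cdom c then pull (Jc d c z) (a (cmap c (cinv d z))) J else 0)"

lemma Jc_eq: "Jc c d z = (\<lambda>k j. dz j (\<lambda>w. trans_map c d w $ k) z)"
  by (simp add: jac_def)

lemma transport_at:
  assumes "d \<in> A" "x \<in> cdom d"
  shows "transport c a d (cmap d x) J = (if x \<in> cdom c then pull (Jc d c (cmap d x)) (a (cmap c x)) J else 0)"
  using assms by (simp add: transport_def cinv_cmap)

lemma transport_self:
  assumes c: "c \<in> A" and z: "z \<in> cimg c"
  shows "transport c a c z = a z"
proof
  fix J
  have "pull (Jc c c z) (a z) J = pull (\<lambda>k x. if k = x then 1 else 0) (a z) J"
    using jac_self[OF c z] by simp
  then show "transport c a c z J = a z J"
    using cinv_in[OF c z] by (simp add: transport_def cmap_cinv[OF c z] pull_id)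
qed

text \<open>Over \<open>cdom c\<close> the transformation law is the cocycle identity, elsewhere
  both sides are 0; whether a point lies in \<open>cdom c\<close> does not depend on the chart
  through which it is seen.\<close>

lemma p0_form_transport:
  assumes c: "c \<in> A" and sk: "\<And>z. z \<in> cimg c \<Longrightarrow> skew p (a z)"
  shows "p0_form A p (transport c a)"
  unfolding p0_form_iff
proof (intro conjI ballI allI impI)
  fix d z assume d: "d \<in> A" "z \<in> cimg d"
  show "skew p (transport c a d z)"
  proof (cases "cinv d z \<in> cdom c")
    case True
    then have "transport c a d z = pull (Jc d c z) (a (cmap c (cinv d z)))" by (simp add: transport_def fun_eq_iff)
    then show ?thesis using skew_pull[OF sk[OF cmap_in[OF c True]]] by simp
  next
    case False
    then have "transport c a d z = (\<lambda>J. 0)" by (simp add: transport_def fun_eq_iff)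
    then show ?thesis by (simp add: skew_def)
  qed
next
  fix d e x and J :: "'n list" assume de: "d \<in> A" "e \<in> A" and "x \<in> cdom d \<inter> cdom e" and J: "length J = p"
  then have x: "x \<in> cdom d" "x \<in> cdom e" by auto
  show "transport c a d (cmap d x) J = pull (Jc d e (cmap d x)) (transport c a e (cmap e x)) J"
  proof (cases "x \<in> cdom c")
    case True
    have "transport c a e (cmap e x) = pull (Jc e c (cmap e x)) (a (cmap c x))"
      using True by (simp add: transport_at[OF de(2) x(2)] fun_eq_iff)
    moreover have "Jc d c (cmap d x) =
        (\<lambda>k y. \<Sum>m\<in>UNIV. jac e c (cmap e x) $ k $ m * jac d e (cmap d x) $ m $ y)"
      by (intro ext, rule jac_compose[OF de c x True])
    ultimately show ?thesis
      unfolding transport_at[OF de(1) x(1)] using True by (simp only: pull_compose if_True)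
  next
    case False
    have "transport c a e (cmap e x) = (\<lambda>J. 0)"
      using False by (simp add: transport_at[OF de(2) x(2)] fun_eq_iff)
    then show ?thesis using False by (simp add: transport_at[OF de(1) x(1)])
  qed
qed

text \<open>The support is compact in the manifold, hence closed, as the space is Hausdorff. So the
  extension by 0 vanishes near every point outside \<open>cdom c\<close>, boundary points of
  \<open>cdom c\<close> included.\<close>

lemma far_from_support:
  assumes c: "c \<in> A" and d: "d \<in> A" and K: "compact K" "K \<subseteq> cimg c"
    and z: "z \<in> cimg d" "cinv d z \<notin> cdom c"
  shows "\<exists>U. open U \<and> z \<in> U \<and> U \<subseteq> cimg d \<and> (\<forall>w\<in>U. cinv d w \<in> cdom c \<longrightarrow> cmap c (cinv d w) \<in> cimg c - K)"
proof -
  have "closed (cinv c ` K)"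
    by (intro compact_imp_closed compact_continuous_image continuous_on_subset[OF continuous_cinv[OF c] K(2)] K(1))
  then have "open {w \<in> cimg d. cinv d w \<in> - (cinv c ` K)}"
    by (intro open_preimage[OF d]) auto
  moreover have "z \<in> {w \<in> cimg d. cinv d w \<in> - (cinv c ` K)}"
    using z K cinv_in[OF c] by auto
  moreover have "cmap c (cinv d w) \<in> cimg c - K" if "w \<in> cimg d" "cinv d w \<in> - (cinv c ` K)" "cinv d w \<in> cdom c" for w
    using that cmap_in[OF c that(3)] cinv_cmap[OF c that(3)] by (auto simp: image_iff)
  ultimately show ?thesis by (intro exI[of _ "{w \<in> cimg d. cinv d w \<in> - (cinv c ` K)}"]) auto
qed

lemma jac_C1:
  assumes "d \<in> A" "c \<in> A"
  shows "C1_on {z \<in> cimg d. cinv d z \<in> cdom c} (\<lambda>w. jac d c w $ k $ y)"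
  unfolding jac_def vec_lambda_beta
  by (rule holo_on_C1[OF open_overlap[OF assms] holo_on_dz[OF open_overlap[OF assms] trans_holo[OF assms]]])

lemma trans_C1:
  assumes "d \<in> A" "c \<in> A"
  shows "C1_on {z \<in> cimg d. cinv d z \<in> cdom c} (trans_map d c)"
proof -
  have "C1_on {z \<in> cimg d. cinv d z \<in> cdom c} (\<lambda>w. trans_map d c w $ k)" for k
    by (rule holo_on_C1[OF open_overlap[OF assms] trans_holo[OF assms]])
  then have "C1_on {z \<in> cimg d. cinv d z \<in> cdom c} (\<lambda>w. \<Sum>k\<in>UNIV. axis k (trans_map d c w $ k))"
    by (intro C1_on_sum C1_on_linear[of "axis _"]) (auto intro: linear_axis simp: linear_conv_bounded_linear[symmetric])
  moreover have "(\<Sum>k\<in>UNIV. axis k (v $ k)) = v" for v :: "complex^'n"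
    by (simp add: vec_eq_iff axis_def if_distrib sum.delta cong: if_cong)
  ultimately show ?thesis by simp
qed

lemma transport_C1:
  assumes c: "c \<in> A" and K: "compact K" "K \<subseteq> cimg c"
    and a: "\<And>J. length J = p \<Longrightarrow> C1_on (cimg c) (\<lambda>z. a z J)"
    and az: "\<And>z J. z \<in> cimg c - K \<Longrightarrow> a z J = 0"
    and d: "d \<in> A" and J: "length J = p"
  shows "C1_on (cimg d) (\<lambda>z. transport c a d z J)"
proof (rule C1_on_locally)
  fix z assume z: "z \<in> cimg d"
  show "\<exists>U. open U \<and> z \<in> U \<and> C1_on U (\<lambda>z. transport c a d z J)"
  proof (cases "cinv d z \<in> cdom c")
    case True
    let ?O = "{z \<in> cimg d. cinv d z \<in> cdom c}"
    have "C1_on ?O (\<lambda>w. pull (Jc d c w) (a (trans_map d c w)) J)"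
    proof (rule C1_on_pull[OF jac_C1[OF d c]])
      fix K :: "'n list" assume "length K = length J"
      then show "C1_on ?O (\<lambda>w. a (trans_map d c w) K)"
        by (intro C1_on_compose[OF a trans_C1[OF d c]]) (use J in \<open>auto simp: trans_map_def cmap_in[OF c]\<close>)
    qed
    then have "C1_on ?O (\<lambda>z. transport c a d z J)"
      by (rule C1_on_cong[OF open_overlap[OF d c]]) (simp add: transport_def trans_map_def)
    then show ?thesis using open_overlap[OF d c] True z by blast
  next
    case False
    obtain U where U: "open U" "z \<in> U" "U \<subseteq> cimg d" "\<forall>w\<in>U. cinv d w \<in> cdom c \<longrightarrow> cmap c (cinv d w) \<in> cimg c - K"
      using far_from_support[OF c d K z False] by blast
    have "C1_on U (\<lambda>z. transport c a d z J)"
    proof (rule C1_on_cong[OF U(1) C1_on_const[of _ 0]])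
      fix w assume "w \<in> U"
      then have "a (cmap c (cinv d w)) = (\<lambda>J. 0)" if "cinv d w \<in> cdom c" using U(4) az that by blast
      then show "0 = transport c a d w J" by (simp add: transport_def)
    qed
    then show ?thesis using U by blast
  qed
qed

text \<open>Where the form is pulled back, this is naturality of \<partial>
  (\<open>altd_dz_pull\<close>); at a point outside \<open>cdom c\<close> the form is 0 in a
  neighbourhood.\<close>

lemma del_transport:
  assumes c: "c \<in> A" and K: "compact K" "K \<subseteq> cimg c"
    and a: "\<And>J. length J = p \<Longrightarrow> C1_on (cimg c) (\<lambda>z. a z J)"
    and az: "\<And>z J. z \<in> cimg c - K \<Longrightarrow> a z J = 0" and sk: "\<And>z. z \<in> cimg c \<Longrightarrow> skew p (a z)"
    and d: "d \<in> A" and z: "z \<in> cimg d" and J: "length J = Suc p"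
  shows "transport c (\<lambda>z. altd (\<lambda>j L. dz j (\<lambda>w. a w L) z)) d z J = del (transport c a) d z J"
proof (cases "cinv d z \<in> cdom c")
  case True
  let ?O = "{z \<in> cimg d. cinv d z \<in> cdom c}" and ?T = "trans_map d c"
  have zO: "z \<in> ?O" using True z by simp
  have Tz: "?T z \<in> cimg c" using cmap_in[OF c True] by (simp add: trans_map_def)
  have tr: "transport c a d w L = pull (\<lambda>k y. dz y (\<lambda>w. ?T w $ k) w) (a (?T w)) L" if "w \<in> ?O" for w L
    using that unfolding transport_def Jc_eq trans_map_def by simp
  have "del (transport c a) d z J = altd (\<lambda>j L. dz j (\<lambda>w. pull (\<lambda>k y. dz y (\<lambda>w. ?T w $ k) w) (a (?T w)) L) z) J"
    unfolding del_altd
    by (rule altd_cong, rule dz_cong_open[OF open_overlap[OF d c] zO], rule tr)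
  also have "\<dots> = pull (\<lambda>k y. dz y (\<lambda>w. ?T w $ k) z) (altd (\<lambda>j L. dz j (\<lambda>w. a w L) (?T z))) J"
    by (rule altd_dz_pull[OF open_overlap[OF d c] trans_holo[OF d c] zO C1_on_differentiable[OF a Tz] sk[OF Tz] J])
  finally show ?thesis using True unfolding transport_def Jc_eq trans_map_def by simp
next
  case False
  obtain U where U: "open U" "z \<in> U" "U \<subseteq> cimg d" "\<forall>w\<in>U. cinv d w \<in> cdom c \<longrightarrow> cmap c (cinv d w) \<in> cimg c - K"
    using far_from_support[OF c d K z False] by blast
  have "transport c a d w L = 0" if "w \<in> U" for w L
  proof -
    have "a (cmap c (cinv d w)) = (\<lambda>J. 0)" if "cinv d w \<in> cdom c" using U(4) az that \<open>w \<in> U\<close> by blast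
    then show ?thesis by (simp add: transport_def)
  qed
  then have "dz j (\<lambda>w. transport c a d w L) z = dz j (\<lambda>w. 0) z" for j L
    by (intro dz_cong_open[OF U(1,2)])
  then show ?thesis using False by (simp add: del_altd transport_def) (simp add: altd_def)
qed

lemma coeff_measurable_continuous:
  assumes "\<And>d J. d \<in> A \<Longrightarrow> length J = p \<Longrightarrow> continuous_on (cimg d) (\<lambda>z. u d z J)"
  shows "coeff_measurable p u"
  unfolding coeff_measurable_def set_borel_measurable_def
proof (intro ballI)
  fix d and J :: "'n list" assume "d \<in> A" "J \<in> multi_idx p"
  then show "(\<lambda>z. indicator (cimg d) z *\<^sub>R u d z J) \<in> borel_measurable lborel"
    using borel_measurable_continuous_on_indicator[OF _ assms[of d J]] open_cimg[of d]
    by (auto simp: multi_idx_def)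
qed

text \<open>Derivatives of C1 coefficients are merely continuous, hence this version for \<partial>
  of a test form besides \<open>transport_C1\<close>.\<close>

lemma transport_continuous:
  assumes c: "c \<in> A" and K: "compact K" "K \<subseteq> cimg c"
    and a: "\<And>J. length J = p \<Longrightarrow> continuous_on (cimg c) (\<lambda>z. a z J)"
    and az: "\<And>z J. z \<in> cimg c - K \<Longrightarrow> length J = p \<Longrightarrow> a z J = 0"
    and d: "d \<in> A" and J: "length J = p"
  shows "continuous_on (cimg d) (\<lambda>z. transport c a d z J)"
  unfolding continuous_on_eq_continuous_at[OF open_cimg[OF d]]
proof
  fix z assume z: "z \<in> cimg d"
  show "isCont (\<lambda>z. transport c a d z J) z"
  proof (cases "cinv d z \<in> cdom c")
    case True
    let ?O = "{z \<in> cimg d. cinv d z \<in> cdom c}"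
    have "continuous_on ?O (\<lambda>w. pull (Jc d c w) (a (trans_map d c w)) J)"
    proof (rule continuous_on_pull[OF C1_on_continuous[OF jac_C1[OF d c]]])
      fix K :: "'n list" assume "length K = length J"
      then show "continuous_on ?O (\<lambda>w. a (trans_map d c w) K)"
        by (intro continuous_on_compose2[OF a C1_on_continuous[OF trans_C1[OF d c]]])
          (use J in \<open>auto simp: trans_map_def cmap_in[OF c]\<close>)
    qed
    then have "continuous_on ?O (\<lambda>z. transport c a d z J)"
      by (rule continuous_on_eq) (simp add: transport_def trans_map_def)
    then show ?thesis using open_overlap[OF d c] True z continuous_on_eq_continuous_at by blast
  next
    case False
    obtain U where U: "open U" "z \<in> U" "U \<subseteq> cimg d" "\<forall>w\<in>U. cinv d w \<in> cdom c \<longrightarrow> cmap c (cinv d w) \<in> cimg c - K"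
      using far_from_support[OF c d K z False] by blast
    have "transport c a d w J = 0" if "w \<in> U" for w
    proof -
      have "pull (Jc d c w) (a (cmap c (cinv d w))) J = pull (Jc d c w) (\<lambda>J. 0) J" if "cinv d w \<in> cdom c"
        by (rule pull_cong) (use U(4) az that \<open>w \<in> U\<close> J in auto)
      then show ?thesis by (simp add: transport_def)
    qed
    then have "continuous_on U (\<lambda>z. transport c a d z J)"
      by (intro continuous_on_eq[OF continuous_on_const[of U 0]]) simp
    then show ?thesis using U continuous_on_eq_continuous_at by blast
  qed
qed

lemma inner_transport:
  assumes c: "c \<in> A" and sk: "\<And>z. z \<in> cimg c \<Longrightarrow> skew p (a z)" and v: "p0_form A p v"
  shows "form_inner A h p (transport c a) v x =
    (if x \<in> cdom c then ip (Hc c (cmap c x)) p (a (cmap c x)) (v c (cmap c x)) / fact p else 0)"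
proof (cases "x \<in> cdom c")
  case True
  then show ?thesis
    by (simp add: form_inner_chart[OF p0_form_transport[OF c sk] v c] transport_self[OF c cmap_in[OF c True]])
next
  case False
  let ?d = "chart_at A x"
  have "transport c a ?d (cmap ?d x) = (\<lambda>J. 0)"
    using False by (simp add: transport_at[OF chart_at] fun_eq_iff)
  then show ?thesis using False form_inner_chart[OF p0_form_transport[OF c sk] v chart_at[of x]] by simp
qed

abbreviation "rho c \<equiv> kaehler_chart.\<rho> (h c) (\<lambda>z. \<psi> (cinv c z))"

lemma rho_eq: "c \<in> A \<Longrightarrow> rho c z = exp (- \<psi> (cinv c z)) * Re (det (h c z))"
  by (rule kaehler_chart.\<rho>_def[OF kaehler_chart])

lemma integral_inner_transport:
  assumes c: "c \<in> A" and sk: "\<And>z. z \<in> cimg c \<Longrightarrow> skew p (a z)" and am: "coeff_measurable p (transport c a)"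
    and v: "p0_form A p v" "coeff_measurable p v"
  defines "F \<equiv> \<lambda>z. indicator (cimg c) z *\<^sub>R (ip (Hc c z) p (a z) (v c z) * rho c z)"
  shows "integrable V (\<lambda>x. form_inner A h p (transport c a) v x * complex_of_real (exp (- \<psi> x))) \<longleftrightarrow> integrable lborel F"
    and "L2_inner A h V \<psi> p (transport c a) v = (LINT z|lborel. F z) / fact p"
proof -
  let ?f = "\<lambda>x. form_inner A h p (transport c a) v x * complex_of_real (exp (- \<psi> x))"
  have [measurable]: "form_inner A h p (transport c a) v \<in> borel_measurable borel"
    "(\<lambda>x. exp (- \<psi> x)) \<in> borel_measurable borel"
    using measurable_form_inner[OF p0_form_transport[OF c sk] am v] measurable_weight by auto
  have fm: "?f \<in> borel_measurable borel" by measurable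
  have fz: "?f x = 0" if "x \<notin> cdom c" for x
    using that by (simp add: inner_transport[OF c sk v(1)])
  have e: "indicator (cimg c) z *\<^sub>R (?f (cinv c z) * Re (det (h c z))) = F z / fact p" for z
    using cinv_in[OF c, of z] cmap_cinv[OF c, of z]
    by (cases "z \<in> cimg c") (simp_all add: F_def inner_transport[OF c sk v(1)] rho_eq[OF c])
  have iff: "(integrable lborel (\<lambda>z. F z / fact p)) \<longleftrightarrow> integrable lborel F"
  proof
    assume "integrable lborel (\<lambda>z. F z / fact p)"
    then have "integrable lborel (\<lambda>z. F z / fact p * fact p)" by (intro integrable_mult_left)
    moreover have "(\<lambda>z. F z / fact p * fact p) = F" by (simp add: fun_eq_iff)
    ultimately show "integrable lborel F" by (simp only:)
  next
    assume "integrable lborel F"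
    then show "integrable lborel (\<lambda>z. F z / fact p)" by (intro integrable_divide_zero)
  qed
  show "integrable V ?f \<longleftrightarrow> integrable lborel F"
    using integral_chart(1)[OF c fm fz] unfolding e iff .
  show "L2_inner A h V \<psi> p (transport c a) v = (LINT z|lborel. F z) / fact p"
    using integral_chart(2)[OF c fm fz] unfolding e L2_inner_def integral_divide_zero .
qed

lemma Hc_continuous: "c \<in> A \<Longrightarrow> continuous_on (cimg c) (\<lambda>z. hinv h c z $ j $ k)"
  using C1_on_continuous[OF kaehler_chart.H_C1[OF kaehler_chart]] by (simp add: H_hinv)

lemma rho_continuous: "c \<in> A \<Longrightarrow> continuous_on (cimg c) (rho c)"
  by (rule C1_on_continuous[OF kaehler_chart.\<rho>_C1[OF kaehler_chart]])

lemma integrable_inner_transport: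
  assumes c: "c \<in> A" and K: "compact K" "K \<subseteq> cimg c"
    and a: "\<And>J. length J = p \<Longrightarrow> continuous_on (cimg c) (\<lambda>z. a z J)"
    and az: "\<And>z J. z \<in> cimg c - K \<Longrightarrow> length J = p \<Longrightarrow> a z J = 0"
    and v: "\<And>J. length J = p \<Longrightarrow> continuous_on (cimg c) (\<lambda>z. v z J)"
  shows "integrable lborel (\<lambda>z. indicator (cimg c) z *\<^sub>R (ip (Hc c z) p (a z) (v z) * rho c z))"
proof (rule kaehler_chart.integrable_on_chart[OF kaehler_chart[OF c] K])
  show "continuous_on (cimg c) (\<lambda>z. ip (Hc c z) p (a z) (v z) * rho c z)"
    unfolding ip_eq
    by (intro continuous_intros Hc_continuous[OF c] a v rho_continuous[OF c]) (auto simp: multi_idx_def)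
  show "ip (Hc c z) p (a z) (v z) * rho c z = 0" if "z \<in> cimg c - K" for z
  proof -
    have "ip (Hc c z) p (a z) (v z) = ip (Hc c z) p (\<lambda>J. 0) (v z)"
      by (rule ip_cong) (use az[OF that] in auto)
    then show ?thesis by simp
  qed
qed

lemma transport_L2:
  assumes c: "c \<in> A" and K: "compact K" "K \<subseteq> cimg c"
    and a: "\<And>J. length J = p \<Longrightarrow> continuous_on (cimg c) (\<lambda>z. a z J)"
    and az: "\<And>z J. z \<in> cimg c - K \<Longrightarrow> length J = p \<Longrightarrow> a z J = 0" and sk: "\<And>z. z \<in> cimg c \<Longrightarrow> skew p (a z)"
  shows "transport c a \<in> L2 A h V \<psi> p"
proof -
  have p0: "p0_form A p (transport c a)" by (rule p0_form_transport[OF c sk])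
  have m: "coeff_measurable p (transport c a)"
    by (rule coeff_measurable_continuous, rule transport_continuous[OF c K a az])
  have tc: "continuous_on (cimg c) (\<lambda>z. transport c a c z J)" if "length J = p" for J
    by (rule transport_continuous[OF c K a az c that])
  have "integrable lborel (\<lambda>z. indicator (cimg c) z *\<^sub>R (ip (Hc c z) p (a z) (transport c a c z) * rho c z))"
    by (rule integrable_inner_transport[OF c K a az tc])
  then have "integrable V (\<lambda>x. form_inner A h p (transport c a) (transport c a) x * complex_of_real (exp (- \<psi> x)))"
    by (subst integral_inner_transport(1)[OF c sk m p0 m])
  then have "integrable V (\<lambda>x. Re (form_inner A h p (transport c a) (transport c a) x * complex_of_real (exp (- \<psi> x))))"
    by (rule integrable_Re)
  then show ?thesis using p0 m by (simp add: L2_iff)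
qed

lemma transport_D_op:
  assumes c: "c \<in> A" and K: "compact K" "K \<subseteq> cimg c"
    and a: "\<And>J. length J = p \<Longrightarrow> C1_on (cimg c) (\<lambda>z. a z J)"
    and az: "\<And>z J. z \<in> cimg c - K \<Longrightarrow> a z J = 0" and sk: "\<And>z. skew p (a z)"
  defines "b \<equiv> \<lambda>z. altd (\<lambda>j L. dz j (\<lambda>w. a w L) z)"
  shows "(transport c a, transport c b) \<in> D_op A h V \<psi> p"
    and "coeff_measurable (Suc p) (transport c b)" and "\<And>z. z \<in> cimg c \<Longrightarrow> skew (Suc p) (b z)"
proof -
  have dzskew: "skew p (\<lambda>L. dz j (\<lambda>w. a w L) z)" if z: "z \<in> cimg c" for j z
    unfolding skew_def
  proof (intro allI impI)
    fix X Y :: "'n list" and x y assume l: "length X + length Y + 2 = p"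
    \<comment> \<open>The exchange is made under the derivative, as an equation of functions of
      \<open>w\<close>; this is why \<open>sk\<close> is assumed at all points, also outside the
      chart.\<close>
    have "dz j (\<lambda>w. a w (X @ x # y # Y)) z = dz j (\<lambda>w. - a w (X @ y # x # Y)) z"
      by (simp only: skewD[OF sk l, where x = x and y = y])
    also have "\<dots> = - dz j (\<lambda>w. a w (X @ y # x # Y)) z"
      by (rule dz_uminus[OF C1_on_differentiable[OF a z]]) (use l in simp)
    finally show "dz j (\<lambda>w. a w (X @ x # y # Y)) z = - dz j (\<lambda>w. a w (X @ y # x # Y)) z" .
  qed
  show skb: "skew (Suc p) (b z)" if "z \<in> cimg c" for z
    unfolding b_def by (rule skew_altd[OF dzskew[OF that]])
  have bc: "continuous_on (cimg c) (\<lambda>z. b z J)" if "length J = Suc p" for J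
    unfolding b_def altd_def
    by (intro continuous_intros C1_on_continuous_dz a) (use that in \<open>simp add: length_del_nth\<close>)
  have bz: "b z J = 0" if z: "z \<in> cimg c - K" for z J
  proof -
    have "open (cimg c - K)" using open_cimg[OF c] compact_imp_closed[OF K(1)] by (rule open_Diff)
    then have "dz j (\<lambda>w. a w L) z = dz j (\<lambda>w. 0) z" for j L
      using z by (rule dz_cong_open) (rule az)
    then show ?thesis by (simp add: b_def altd_def)
  qed
  show "coeff_measurable (Suc p) (transport c b)"
    by (rule coeff_measurable_continuous, rule transport_continuous[OF c K bc bz])
  have "transport c a \<in> L2 A h V \<psi> p"
    by (rule transport_L2[OF c K C1_on_continuous[OF a] az sk])
  moreover have "transport c b \<in> L2 A h V \<psi> (Suc p)"
    by (rule transport_L2[OF c K bc bz skb])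
  moreover have "weak_del A p (transport c a) (transport c b)"
  proof (rule weak_del_C1)
    show "C1_on (cimg d) (\<lambda>z. transport c a d z J)" if "d \<in> A" "length J = p" for d J
      by (rule transport_C1[OF c K a az that])
    show "transport c b d z J = del (transport c a) d z J" if "d \<in> A" "z \<in> cimg d" "length J = Suc p" for d z J
      unfolding b_def by (rule del_transport[OF c K a az sk that])
  qed
  ultimately show "(transport c a, transport c b) \<in> D_op A h V \<psi> p"
    unfolding D_op_def by blast
qed

end

lemma ip_hermitian:
  assumes "\<And>j k. H k j = cnj (H j k)"
  shows "ip H p v u = cnj (ip H p u v)"
proof (induction p arbitrary: u v)
  case (Suc p)
  have "ip H (Suc p) v u = (\<Sum>j\<in>UNIV. \<Sum>k\<in>UNIV. cnj (H k j * ip H p (\<lambda>K. u (k # K)) (\<lambda>K. v (j # K))))"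
    unfolding ip.simps
  proof (intro sum.cong refl)
    fix j k
    show "H j k * ip H p (\<lambda>K. v (j # K)) (\<lambda>K. u (k # K)) =
        cnj (H k j * ip H p (\<lambda>K. u (k # K)) (\<lambda>K. v (j # K)))"
      unfolding complex_cnj_mult using Suc.IH[of "\<lambda>K. v (j # K)" "\<lambda>K. u (k # K)"] assms[of j k] by simp
  qed
  also have "\<dots> = cnj (ip H (Suc p) u v)"
    unfolding ip.simps cnj_sum by (rule sum.swap)
  finally show ?case .
qed simp

section \<open>Contraction with the gradient field of the weight\<close>

context kaehler_setup
begin

text \<open>Interior product with \<open>(\<partial>bar \<psi>)^\<sharp>\<close>, inserted in the
  first slot: the candidate for the value of the adjoint.\<close>

definition contract :: "('a, 'n) form \<Rightarrow> ('a, 'n) form" where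
  "contract \<eta> c z K = (\<Sum>k\<in>UNIV. dbar_sharp h \<psi> c z k * \<eta> c z (k # K))"

lemma X_eq: "c \<in> A \<Longrightarrow> kaehler_chart.X (h c) (\<lambda>z. \<psi> (cinv c z)) z k = dbar_sharp h \<psi> c z k"
  unfolding kaehler_chart.X_def[OF kaehler_chart] dbar_sharp_def by (simp add: H_hinv)

text \<open>The coefficients of \<partial>bar \<psi> change by the conjugate Jacobian, and
  \<open>hinv_transform\<close> trades it for the Jacobian itself. So the local fields form one
  global vector field and contraction with it is independent of the chart.\<close>

lemma dbar_sharp_transform:
  assumes "c \<in> A" "d \<in> A" "x \<in> cdom c" "x \<in> cdom d"
  shows "(\<Sum>k\<in>UNIV. jac c d (cmap c x) $ l $ k * dbar_sharp h \<psi> c (cmap c x) k) = dbar_sharp h \<psi> d (cmap d x) l"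
proof -
  let ?O = "{z \<in> cimg c. cinv c z \<in> cdom d}" and ?T = "trans_map c d" and ?z = "cmap c x"
  let ?\<psi> = "\<lambda>d w. complex_of_real (\<psi> (cinv d w))" and ?J = "jac c d (cmap c x)"
  have zO: "?z \<in> ?O" using assms by (auto simp: cmap_in cinv_cmap)
  have T: "?T ?z = cmap d x" using assms by (simp add: trans_map_def cinv_cmap)
  have db: "dzbar k (?\<psi> c) ?z = (\<Sum>m\<in>UNIV. cnj (?J $ m $ k) * dzbar m (?\<psi> d) (cmap d x))" for k
  proof -
    have "dzbar k (?\<psi> c) ?z = dzbar k (\<lambda>w. ?\<psi> d (?T w)) ?z"
      by (rule dzbar_cong_open[OF open_overlap[OF assms(1,2)] zO])
        (simp add: trans_map_def cinv_cmap[OF assms(2)])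
    also have "\<dots> = (\<Sum>m\<in>UNIV. cnj (dz k (\<lambda>w. ?T w $ m) ?z) * dzbar m (?\<psi> d) (?T ?z))"
    proof (rule dz_compose(2)[OF trans_holo[OF assms(1,2)] zO])
      show "(\<lambda>w. complex_of_real (\<psi> (cinv d w))) differentiable at (?T ?z)"
        unfolding T by (rule kaehler_chart.\<psi>c_diff[OF kaehler_chart[OF assms(2)] cmap_in[OF assms(2,4)]])
    qed
    finally show ?thesis unfolding T jac_def by simp
  qed
  have "(\<Sum>k\<in>UNIV. ?J $ l $ k * dbar_sharp h \<psi> c ?z k) =
    (\<Sum>k\<in>UNIV. \<Sum>i\<in>UNIV. \<Sum>m\<in>UNIV. hinv h c ?z $ k $ i * ?J $ l $ k * cnj (?J $ m $ i) * dzbar m (?\<psi> d) (cmap d x))"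
    unfolding dbar_sharp_def db by (simp add: sum_distrib_left mult_ac)
  also have "\<dots> = (\<Sum>k\<in>UNIV. \<Sum>m\<in>UNIV. \<Sum>i\<in>UNIV. hinv h c ?z $ k $ i * ?J $ l $ k * cnj (?J $ m $ i) * dzbar m (?\<psi> d) (cmap d x))"
    by (rule sum.cong[OF refl], rule sum.swap)
  also have "\<dots> = (\<Sum>m\<in>UNIV. \<Sum>k\<in>UNIV. \<Sum>i\<in>UNIV. hinv h c ?z $ k $ i * ?J $ l $ k * cnj (?J $ m $ i) * dzbar m (?\<psi> d) (cmap d x))"
    by (rule sum.swap)
  also have "\<dots> = dbar_sharp h \<psi> d (cmap d x) l"
    unfolding dbar_sharp_def hinv_transform[OF assms] by (simp add: sum_distrib_right)
  finally show ?thesis .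
qed

lemma p0_form_contract:
  assumes \<eta>: "p0_form A (Suc p) \<eta>"
  shows "p0_form A p (contract \<eta>)"
  unfolding p0_form_iff
proof (intro conjI ballI allI impI)
  fix c z assume "c \<in> A" "z \<in> cimg c"
  then show "skew p (contract \<eta> c z)"
    unfolding contract_def[abs_def] by (intro skew_sum skew_Cons p0_form_skew[OF \<eta>])
next
  fix c d x and K :: "'n list" assume cd: "c \<in> A" "d \<in> A" and "x \<in> cdom c \<inter> cdom d" and K: "length K = p"
  then have x: "x \<in> cdom c" "x \<in> cdom d" by auto
  let ?J = "Jc c d (cmap c x)" and ?X = "dbar_sharp h \<psi> c (cmap c x)"
  have "contract \<eta> c (cmap c x) K = (\<Sum>k\<in>UNIV. ?X k * pull ?J (\<eta> d (cmap d x)) (k # K))"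
    unfolding contract_def
    by (intro sum.cong refl arg_cong[of _ _ "\<lambda>t. _ * t"] p0_form_pull[OF \<eta> cd x]) (simp add: K)
  also have "\<dots> = (\<Sum>k\<in>UNIV. \<Sum>l\<in>UNIV. (?J l k * ?X k) * pull ?J (\<lambda>L. \<eta> d (cmap d x) (l # L)) K)"
    by (simp add: sum_distrib_left mult_ac)
  also have "\<dots> = (\<Sum>l\<in>UNIV. \<Sum>k\<in>UNIV. (?J l k * ?X k) * pull ?J (\<lambda>L. \<eta> d (cmap d x) (l # L)) K)"
    by (rule sum.swap)
  also have "\<dots> = (\<Sum>l\<in>UNIV. dbar_sharp h \<psi> d (cmap d x) l * pull ?J (\<lambda>L. \<eta> d (cmap d x) (l # L)) K)"
    by (simp add: sum_distrib_right[symmetric] dbar_sharp_transform[OF cd x])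
  also have "\<dots> = pull ?J (contract \<eta> d (cmap d x)) K"
    unfolding contract_def[abs_def] by (rule pull_sum[symmetric])
  finally show "contract \<eta> c (cmap c x) K = pull ?J (contract \<eta> d (cmap d x)) K" .
qed

lemma holomorphic_contract:
  assumes X: "dbar_sharp_holomorphic A h \<psi>" and \<eta>: "holomorphic_form A (Suc p) \<eta>"
  shows "holomorphic_form A p (contract \<eta>)"
  unfolding holomorphic_form_def
proof (intro conjI ballI)
  show "p0_form A p (contract \<eta>)"
    using \<eta> unfolding holomorphic_form_def by (intro p0_form_contract) blast
  fix c and J :: "'n list" assume c: "c \<in> A" and "J \<in> multi_idx p"
  then have "k # J \<in> multi_idx (Suc p)" for k by (simp add: multi_idx_def)
  then show "holo_on (cimg c) (\<lambda>z. contract \<eta> c z J)"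
    using X \<eta> c unfolding contract_def dbar_sharp_holomorphic_def holomorphic_form_def
    by (intro holo_on_sum holo_on_mult) blast+
qed

lemma holomorphic_C1:
  assumes "holomorphic_form A p u" "c \<in> A" "length J = p"
  shows "C1_on (cimg c) (\<lambda>z. u c z J)"
proof -
  have "holo_on (cimg c) (\<lambda>z. u c z J)"
    using assms unfolding holomorphic_form_def multi_idx_def by blast
  then show ?thesis by (rule holo_on_C1[OF open_cimg[OF assms(2)]])
qed

lemma holomorphic_coeff_measurable: "holomorphic_form A p u \<Longrightarrow> coeff_measurable p u"
  by (rule coeff_measurable_continuous) (rule C1_on_continuous[OF holomorphic_C1])

subsection \<open>The adjoint of \<open>D\<close> on holomorphic forms\<close>

text \<open>Both sides of the adjoint relation for a transported test form become Lebesgue integrals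
  over the chart, and \<open>integral_ip_altd\<close> moves the derivative from the test form onto
  the weight.\<close>

lemma adjoint_test:
  assumes D: "(\<eta>, \<zeta>) \<in> D_star A h V \<psi> p" and \<eta>: "holomorphic_form A (Suc p) \<eta>"
    and X: "dbar_sharp_holomorphic A h \<psi>"
    and c: "c \<in> A" and K: "compact K" "K \<subseteq> cimg c"
    and a: "\<And>J. length J = p \<Longrightarrow> C1_on (cimg c) (\<lambda>z. a z J)"
    and az: "\<And>z J. z \<in> cimg c - K \<Longrightarrow> a z J = 0" and sk: "\<And>z. skew p (a z)"
  defines "F \<equiv> \<lambda>z. indicator (cimg c) z *\<^sub>R (ip (Hc c z) p (a z) (\<lambda>J. \<zeta> c z J - contract \<eta> c z J) * rho c z)"
  shows "integrable lborel F" "(LINT z|lborel. F z) = 0"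
proof -
  define b where "b z = altd (\<lambda>j L. dz j (\<lambda>w. a w L) z)" for z
  note test = transport_D_op[OF c K a az sk, folded b_def]
  have \<zeta>L: "\<zeta> \<in> L2 A h V \<psi> p" and \<eta>L: "\<eta> \<in> L2 A h V \<psi> (Suc p)"
    and adj: "\<And>u f. (u, f) \<in> D_op A h V \<psi> p \<Longrightarrow> L2_inner A h V \<psi> (Suc p) f \<eta> = L2_inner A h V \<psi> p u \<zeta>"
    using D unfolding D_star_def hilbert_adjoint_def by auto
  note \<zeta>' = \<zeta>L[unfolded L2_iff] and \<eta>' = \<eta>L[unfolded L2_iff]
  have uL: "transport c a \<in> L2 A h V \<psi> p" using test(1) unfolding D_op_def by blast
  then have um: "coeff_measurable p (transport c a)" unfolding L2_iff by blast
  have hc: "holomorphic_form A p (contract \<eta>)" by (rule holomorphic_contract[OF X \<eta>])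
  let ?I = "\<lambda>v z. indicator (cimg c) z *\<^sub>R (ip (Hc c z) p (a z) (v c z) * complex_of_real (rho c z))"
  have i1: "integrable lborel (?I \<zeta>)"
    by (subst integral_inner_transport(1)[OF c sk um, symmetric]) (use \<zeta>' L2_integrable[OF uL \<zeta>L] in blast)+
  \<comment> \<open>At this point \<open>contract \<eta>\<close> is not known to be square
    integrable; integrability comes from its continuity and the compact support of
    \<open>a\<close>.\<close>
  have i2: "integrable lborel (?I (contract \<eta>))"
    by (rule integrable_inner_transport[OF c K C1_on_continuous[OF a] az C1_on_continuous[OF holomorphic_C1[OF hc c]]])
  have l1: "L2_inner A h V \<psi> p (transport c a) \<zeta> = (LINT z|lborel. ?I \<zeta> z) / fact p"
    by (rule integral_inner_transport(2)[OF c sk um]) (use \<zeta>' in blast)+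
  interpret k: kaehler_chart "cimg c" "h c" "\<lambda>z. \<psi> (cinv c z)" by (rule kaehler_chart[OF c])
  have "L2_inner A h V \<psi> (Suc p) (transport c b) \<eta> =
    (LINT z|lborel. indicator (cimg c) z *\<^sub>R (ip (Hc c z) (Suc p) (b z) (\<eta> c z) * complex_of_real (rho c z))) / fact (Suc p)"
    by (rule integral_inner_transport(2)[OF c test(3) test(2)]) (use \<eta>' in blast)+
  also have "(LINT z|lborel. indicator (cimg c) z *\<^sub>R (ip (Hc c z) (Suc p) (b z) (\<eta> c z) * complex_of_real (rho c z))) =
    of_nat (Suc p) * (LINT z|lborel. ?I (contract \<eta>) z)"
  proof -
    have \<eta>h: "holo_on (cimg c) (\<lambda>w. \<eta> c w J)" if "length J = Suc p" for J
      using \<eta> c that unfolding holomorphic_form_def multi_idx_def by blast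
    have "skew (Suc p) (\<eta> c z)" if "z \<in> cimg c" for z
      by (rule p0_form_skew[OF _ c that]) (use \<eta>' in blast)
    from k.integral_ip_altd[OF K a az \<eta>h this]
    show ?thesis unfolding H_hinv[OF c] X_eq[OF c] b_def contract_def[abs_def] .
  qed
  \<comment> \<open>The factor from \<open>integral_ip_altd\<close> cancels in
    \<open>fact (Suc p)\<close>.\<close>
  also have "of_nat (Suc p) * (LINT z|lborel. ?I (contract \<eta>) z) / fact (Suc p) = (LINT z|lborel. ?I (contract \<eta>) z) / fact p"
    by (simp add: fact_Suc del: of_nat_Suc)
  finally have "(LINT z|lborel. ?I (contract \<eta>) z) = (LINT z|lborel. ?I \<zeta> z)"
    using adj[OF test(1)] unfolding l1 by simp
  moreover have F: "F = (\<lambda>z. ?I \<zeta> z - ?I (contract \<eta>) z)"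
    unfolding F_def ip_diff_right by (simp add: fun_eq_iff algebra_simps)
  ultimately show "integrable lborel F" "(LINT z|lborel. F z) = 0"
    unfolding F using i1 i2 by simp_all
qed

text \<open>The tests are \<open>\<omega>\<close> times \<open>bump\<close> times the constant form
  \<open>dz^K0\<close>. Varying \<open>\<omega>\<close> localises, and \<open>dz^K0\<close> reads
  off the coefficient at \<open>K0\<close> of the difference \<open>w\<close>, conjugated and with
  raised indices; when all of these vanish, so does \<open>ip\<close> of \<open>w\<close> with
  itself, hence \<open>w\<close>.\<close>

lemma adjoint_box:
  assumes D: "(\<eta>, \<zeta>) \<in> D_star A h V \<psi> p" and \<eta>: "holomorphic_form A (Suc p) \<eta>"
    and X: "dbar_sharp_holomorphic A h \<psi>"
    and c: "c \<in> A" and B: "cbox \<alpha> \<beta> \<subseteq> cimg c"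
  shows "AE z in lborel. z \<in> box \<alpha> \<beta> \<longrightarrow> (\<forall>J\<in>multi_idx p. \<zeta> c z J = contract \<eta> c z J)"
proof (cases "box \<alpha> \<beta> = {}")
  case True
  then show ?thesis by simp
next
  case False
  define w where "w z J = \<zeta> c z J - contract \<eta> c z J" for z J
  have p0: "p0_form A p \<zeta>" using D unfolding D_star_def hilbert_adjoint_def L2_def by auto
  have p0c: "p0_form A p (contract \<eta>)" using \<eta> unfolding holomorphic_form_def by (intro p0_form_contract) blast
  have wsk: "skew p (w z)" if "z \<in> cimg c" for z
    unfolding w_def[abs_def] by (intro skew_diff p0_form_skew[OF p0 c that] p0_form_skew[OF p0c c that])
  let ?b = "bump \<alpha> \<beta>"
  have test: "AE z in lborel. z \<in> box \<alpha> \<beta> \<longrightarrow> pull (\<lambda>k j. hinv h c z $ j $ k) (\<lambda>J. cnj (w z J)) K0 = 0"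
    if K0: "K0 \<in> multi_idx p" for K0
  proof -
    have lK: "length K0 = p" using K0 by (simp add: multi_idx_def)
    \<comment> \<open>The bump is put into \<open>G\<close>: this makes \<open>G\<close> integrable
      on the whole space and leaves \<open>\<omega>\<close> unrestricted, as
      \<open>AE_zero_of_C1_tests\<close> requires.\<close>
    define G where "G z = complex_of_real (?b z) *
      (indicator (cimg c) z *\<^sub>R (ip (Hc c z) p (alt_unit K0) (w z) * complex_of_real (rho c z)))" for z
    have t: "integrable lborel (\<lambda>z. complex_of_real (\<omega> z) * G z)" "(LINT z|lborel. complex_of_real (\<omega> z) * G z) = 0"
      if \<omega>: "C1_on UNIV \<omega>" for \<omega> :: "complex^'n \<Rightarrow> real"
    proof -
      define a where "a z J = complex_of_real (\<omega> z * ?b z) * alt_unit K0 J" for z J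
      have aC: "C1_on (cimg c) (\<lambda>z. a z J)" for J
        unfolding a_def
        by (intro C1_on_mult C1_on_const C1_on_of_real C1_on_bump C1_on_subset[OF \<omega>]) simp
      have az: "a z J = 0" if "z \<in> cimg c - cbox \<alpha> \<beta>" for z J
        using bump_zero[OF False, of z] that box_subset_cbox[of \<alpha> \<beta>] unfolding a_def by auto
      have sk: "skew p (a z)" for z
        unfolding a_def[abs_def] using skew_scale[OF skew_alt_unit[of K0]] lK by simp
      have e: "indicator (cimg c) z *\<^sub>R (ip (Hc c z) p (a z) (w z) * complex_of_real (rho c z)) = complex_of_real (\<omega> z) * G z" for z
        unfolding a_def[abs_def] G_def ip_scale_left by (simp add: mult_ac)
      show "integrable lborel (\<lambda>z. complex_of_real (\<omega> z) * G z)" "(LINT z|lborel. complex_of_real (\<omega> z) * G z) = 0"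
        using adjoint_test[OF D \<eta> X c compact_cbox B aC az sk] unfolding w_def[symmetric] w_def[abs_def, symmetric] e by simp_all
    qed
    have "integrable lborel G" using t(1)[OF C1_on_const[of _ 1]] by simp
    then have "AE z in lborel. G z = 0" by (rule AE_zero_of_C1_tests) (rule t(2))
    then show ?thesis
    proof (rule AE_mp, intro AE_I2 impI)
      fix z assume G0: "G z = 0" and z: "z \<in> box \<alpha> \<beta>"
      then have zc: "z \<in> cimg c" using B box_subset_cbox[of \<alpha> \<beta>] by auto
      have "?b z \<noteq> 0" using bump_pos_iff[OF False, of z] z by simp
      moreover have "rho c z \<noteq> 0" using kaehler_chart.\<rho>_pos[OF kaehler_chart[OF c] zc] by simp
      ultimately have "ip (Hc c z) p (alt_unit K0) (w z) = 0"
        using G0 zc by (simp add: G_def)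
      moreover have "skew p (pull (\<lambda>k j. hinv h c z $ j $ k) (\<lambda>J. cnj (w z J)))"
        by (intro skew_pull skew_cnj wsk zc)
      ultimately have "fact p * pull (\<lambda>k j. hinv h c z $ j $ k) (\<lambda>J. cnj (w z J)) K0 = 0"
        unfolding ip_eq_pull using sum_alt_unit[of K0 "pull (\<lambda>k j. hinv h c z $ j $ k) (\<lambda>J. cnj (w z J))"] lK by simp
      then show "pull (\<lambda>k j. hinv h c z $ j $ k) (\<lambda>J. cnj (w z J)) K0 = 0" by simp
    qed
  qed
  have "AE z in lborel. \<forall>K0\<in>multi_idx p. z \<in> box \<alpha> \<beta> \<longrightarrow> pull (\<lambda>k j. hinv h c z $ j $ k) (\<lambda>J. cnj (w z J)) K0 = 0"
    by (subst AE_ball_countable) (auto intro: countable_finite test)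
  then show ?thesis
  proof (rule AE_mp, intro AE_I2 impI ballI)
    fix z and J :: "'n list" assume *: "\<forall>K0\<in>multi_idx p. z \<in> box \<alpha> \<beta> \<longrightarrow> pull (\<lambda>k j. hinv h c z $ j $ k) (\<lambda>J. cnj (w z J)) K0 = 0"
      and z: "z \<in> box \<alpha> \<beta>" and J: "J \<in> multi_idx p"
    have zc: "z \<in> cimg c" using z B box_subset_cbox[of \<alpha> \<beta>] by auto
    interpret m: pos_def_hermitian "h c z" by (rule pos_def[OF c zc])
    have "ip (Hc c z) p (w z) (w z) = 0"
      unfolding ip_eq_pull by (rule sum.neutral) (use * z in simp)
    then have "w z J = 0"
      unfolding hinv_def by (rule m.ip_eq_0) (use J in \<open>simp add: multi_idx_def\<close>)
    then show "\<zeta> c z J = contract \<eta> c z J" by (simp add: w_def)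
  qed
qed

text \<open>By the Lindelof property, countably many open boxes with closed boxes inside the chart
  image cover it, so the exceptional sets add up to a null set.\<close>

lemma adjoint_chart:
  assumes D: "(\<eta>, \<zeta>) \<in> D_star A h V \<psi> p" and \<eta>: "holomorphic_form A (Suc p) \<eta>"
    and X: "dbar_sharp_holomorphic A h \<psi>" and c: "c \<in> A"
  shows "AE z in lborel. z \<in> cimg c \<longrightarrow> (\<forall>J\<in>multi_idx p. \<zeta> c z J = contract \<eta> c z J)"
proof -
  define S where "S = {ab. cbox (fst ab) (snd ab) \<subseteq> cimg c}"
  let ?B = "\<lambda>ab :: (complex^'n) \<times> (complex^'n). box (fst ab) (snd ab)"
  have "\<And>U. U \<in> ?B ` S \<Longrightarrow> open U" by auto
  then obtain F' where F': "F' \<subseteq> ?B ` S" "countable F'" "\<Union>F' = \<Union>(?B ` S)" by (rule Lindelof)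
  then obtain F where F: "countable F" "F \<subseteq> S" "F' = ?B ` F"
    using countable_subset_image[of F' ?B S] by blast
  have cov: "\<exists>ab\<in>F. z \<in> ?B ab" if z: "z \<in> cimg c" for z
  proof -
    obtain a b where "cbox a b \<subseteq> cimg c" "z \<in> box a b"
      using open_contains_cbox[of "cimg c"] open_cimg[OF c] z by metis
    then have "z \<in> \<Union>(?B ` S)" unfolding S_def by force
    then show ?thesis using F' F by auto
  qed
  have "AE z in lborel. \<forall>ab\<in>F. z \<in> ?B ab \<longrightarrow> (\<forall>J\<in>multi_idx p. \<zeta> c z J = contract \<eta> c z J)"
    unfolding AE_ball_countable[OF F(1)]
    by (intro ballI adjoint_box[OF D \<eta> X c]) (use F(2) in \<open>auto simp: S_def\<close>)
  then show ?thesis by eventually_elim (use cov in blast)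
qed

text \<open>\<open>L2_eq\<close> quantifies over all charts outside one null set, and there may be
  uncountably many. Equality at a point is therefore established in one chart and carried to the
  others by the transformation law.\<close>

lemma p0_form_eq_transfer:
  assumes u: "p0_form A p u" and v: "p0_form A p v"
    and c: "c \<in> A" "x \<in> cdom c" and e: "\<forall>J\<in>multi_idx p. u c (cmap c x) J = v c (cmap c x) J"
    and d: "d \<in> A" "x \<in> cdom d" and J: "J \<in> multi_idx p"
  shows "u d (cmap d x) J = v d (cmap d x) J"
proof -
  have lJ: "length J = p" using J by (simp add: multi_idx_def)
  have "u d (cmap d x) J = pull (Jc d c (cmap d x)) (u c (cmap c x)) J"
    by (rule p0_form_pull[OF u d(1) c(1) d(2) c(2) lJ])
  also have "\<dots> = pull (Jc d c (cmap d x)) (v c (cmap c x)) J"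
    by (rule pull_cong) (use e lJ in \<open>simp add: multi_idx_def\<close>)
  also have "\<dots> = v d (cmap d x) J"
    by (rule p0_form_pull[OF v d(1) c(1) d(2) c(2) lJ, symmetric])
  finally show ?thesis .
qed

lemma adjoint_eq_contract:
  assumes D: "(\<eta>, \<zeta>) \<in> D_star A h V \<psi> p" and \<eta>: "holomorphic_form A (Suc p) \<eta>"
    and X: "dbar_sharp_holomorphic A h \<psi>"
  shows "L2_eq A V p \<zeta> (contract \<eta>)"
  unfolding L2_eq_def
proof (rule AE_V)
  fix c assume c: "c \<in> A"
  have p0: "p0_form A p \<zeta>" using D unfolding D_star_def hilbert_adjoint_def L2_def by auto
  have p0c: "p0_form A p (contract \<eta>)" using \<eta> unfolding holomorphic_form_def by (intro p0_form_contract) blast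
  have "AE x in V. x \<in> cdom c \<longrightarrow> (\<forall>J\<in>multi_idx p. \<zeta> c (cmap c x) J = contract \<eta> c (cmap c x) J)"
    by (rule AE_chart[OF c adjoint_chart[OF D \<eta> X c]])
  then show "AE x in V. x \<in> cdom c \<longrightarrow> (\<forall>d\<in>A. x \<in> cdom d \<longrightarrow>
      (\<forall>J\<in>multi_idx p. \<zeta> d (cmap d x) J = contract \<eta> d (cmap d x) J))"
    by eventually_elim (use p0_form_eq_transfer[OF p0 p0c c] in blast)
qed

section \<open>Square integrable forms up to null sets\<close>

lemma form_inner_cong:
  assumes "\<forall>c\<in>A. x \<in> cdom c \<longrightarrow> (\<forall>J\<in>multi_idx p. u c (cmap c x) J = u' c (cmap c x) J)"
    and "\<forall>c\<in>A. x \<in> cdom c \<longrightarrow> (\<forall>J\<in>multi_idx p. v c (cmap c x) J = v' c (cmap c x) J)"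
  shows "form_inner A h p u v x = form_inner A h p u' v' x"
  using assms chart_at[of x] unfolding form_inner_def Let_def
  by (intro arg_cong[of _ _ "\<lambda>t. t / fact p"] sum.cong refl) auto

lemma L2_eq_L2:
  assumes e: "L2_eq A V p u v" and u: "u \<in> L2 A h V \<psi> p" and v: "p0_form A p v" "coeff_measurable p v"
  shows "v \<in> L2 A h V \<psi> p"
proof -
  note u' = u[unfolded L2_iff]
  have [measurable]: "form_inner A h p v v \<in> borel_measurable borel" "(\<lambda>x. exp (- \<psi> x)) \<in> borel_measurable borel"
    using measurable_form_inner[OF v v] measurable_weight by auto
  have "integrable V (\<lambda>x. Re (form_inner A h p v v x) * exp (- \<psi> x))"
  proof (rule integrable_cong_AE_imp)
    show "integrable V (\<lambda>x. Re (form_inner A h p u u x) * exp (- \<psi> x))" using u' by blast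
    show "(\<lambda>x. Re (form_inner A h p v v x) * exp (- \<psi> x)) \<in> borel_measurable V"
      unfolding measurable_V by measurable
    show "AE x in V. Re (form_inner A h p u u x) * exp (- \<psi> x) = Re (form_inner A h p v v x) * exp (- \<psi> x)"
      using e unfolding L2_eq_def
    proof eventually_elim
      case (elim x)
      from form_inner_cong[where u = u and u' = v and v = u and v' = v, OF this this] show ?case by simp
    qed
  qed
  then show ?thesis using v unfolding L2_iff by blast
qed

lemma L2_eq_inner:
  assumes e: "L2_eq A V p v v'" and u: "u \<in> L2 A h V \<psi> p" and v: "v \<in> L2 A h V \<psi> p" and v': "v' \<in> L2 A h V \<psi> p"
  shows "L2_inner A h V \<psi> p u v = L2_inner A h V \<psi> p u v'"
  unfolding L2_inner_def
proof (rule Bochner_Integration.integral_cong_AE)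
  show "(\<lambda>x. form_inner A h p u v x * complex_of_real (exp (- \<psi> x))) \<in> borel_measurable V"
    "(\<lambda>x. form_inner A h p u v' x * complex_of_real (exp (- \<psi> x))) \<in> borel_measurable V"
    by (rule borel_measurable_integrable[OF L2_integrable[OF u v]],
        rule borel_measurable_integrable[OF L2_integrable[OF u v']])
  show "AE x in V. form_inner A h p u v x * complex_of_real (exp (- \<psi> x)) =
      form_inner A h p u v' x * complex_of_real (exp (- \<psi> x))"
    using e unfolding L2_eq_def
  proof eventually_elim
    case (elim x)
    from form_inner_cong[where u = u and u' = u and v = v and v' = v', OF _ this] show ?case by simp
  qed
qed

lemma form_inner_hermitian:
  assumes "p0_form A p u" "p0_form A p v"
  shows "form_inner A h p v u x = cnj (form_inner A h p u v x)"
proof -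
  interpret m: pos_def_hermitian "h (chart_at A x) (cmap (chart_at A x) x)"
    by (rule pos_def) (simp_all add: chart_at cmap_in)
  show ?thesis
    unfolding form_inner_chart[OF assms chart_at] form_inner_chart[OF assms(2,1) chart_at] hinv_def
    by (subst ip_hermitian[OF m.inverse_hermitian]) simp
qed

lemma L2_diff:
  assumes u: "u \<in> L2 A h V \<psi> p" and v: "v \<in> L2 A h V \<psi> p"
  shows "(\<lambda>c z J. u c z J - v c z J) \<in> L2 A h V \<psi> p"
proof -
  note u' = u[unfolded L2_iff] and v' = v[unfolded L2_iff]
  let ?w = "\<lambda>c z J. u c z J - v c z J"
  have "p0_form A p ?w" using u' v' p0_form_diff by blast
  moreover have "coeff_measurable p ?w"
    using u' v' unfolding coeff_measurable_def set_borel_measurable_def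
    by (auto simp: scaleR_diff_right intro!: borel_measurable_diff)
  moreover have "integrable V (\<lambda>x. Re (form_inner A h p ?w ?w x) * exp (- \<psi> x))"
  proof -
    have "integrable V (\<lambda>x. form_inner A h p u u x * complex_of_real (exp (- \<psi> x))
        - form_inner A h p v u x * complex_of_real (exp (- \<psi> x))
        - (form_inner A h p u v x * complex_of_real (exp (- \<psi> x)) - form_inner A h p v v x * complex_of_real (exp (- \<psi> x))))"
      by (intro Bochner_Integration.integrable_diff L2_integrable u v)
    from integrable_Re[OF this] show ?thesis
      by (simp add: form_inner_diff_left form_inner_diff_right algebra_simps)
  qed
  ultimately show ?thesis unfolding L2_iff by blast
qed

lemma L2_inner_diff_right:
  assumes "u \<in> L2 A h V \<psi> p" "v \<in> L2 A h V \<psi> p" "w \<in> L2 A h V \<psi> p"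
  shows "L2_inner A h V \<psi> p u (\<lambda>c z J. v c z J - w c z J) = L2_inner A h V \<psi> p u v - L2_inner A h V \<psi> p u w"
  using L2_integrable[OF assms(1,2)] L2_integrable[OF assms(1,3)]
  unfolding L2_inner_def form_inner_diff_right by (simp add: left_diff_distrib)

lemma L2_inner_diff_left:
  assumes "u \<in> L2 A h V \<psi> p" "v \<in> L2 A h V \<psi> p" "w \<in> L2 A h V \<psi> p"
  shows "L2_inner A h V \<psi> p (\<lambda>c z J. v c z J - w c z J) u = L2_inner A h V \<psi> p v u - L2_inner A h V \<psi> p w u"
  using L2_integrable[OF assms(2,1)] L2_integrable[OF assms(3,1)]
  unfolding L2_inner_def form_inner_diff_left by (simp add: left_diff_distrib)

lemma L2_inner_hermitian:
  assumes "u \<in> L2 A h V \<psi> p" "v \<in> L2 A h V \<psi> p"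
  shows "L2_inner A h V \<psi> p v u = cnj (L2_inner A h V \<psi> p u v)"
proof -
  have "p0_form A p u" "p0_form A p v" using assms unfolding L2_iff by blast+
  from form_inner_hermitian[OF this]
  have "L2_inner A h V \<psi> p v u = (LINT x|V. cnj (form_inner A h p u v x * complex_of_real (exp (- \<psi> x))))"
    unfolding L2_inner_def by simp
  also have "\<dots> = cnj (L2_inner A h V \<psi> p u v)"
    unfolding L2_inner_def by (rule integral_bounded_linear[OF bounded_linear_cnj L2_integrable[OF assms]])
  finally show ?thesis .
qed

lemma Re_L2_inner_self:
  assumes u: "u \<in> L2 A h V \<psi> p"
  shows "Re (L2_inner A h V \<psi> p u u) = (LINT x|V. Re (form_inner A h p u u x) * exp (- \<psi> x))"
    and "Re (L2_inner A h V \<psi> p u u) \<ge> 0"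
proof -
  show e: "Re (L2_inner A h V \<psi> p u u) = (LINT x|V. Re (form_inner A h p u u x) * exp (- \<psi> x))"
    unfolding L2_inner_def integral_Re[OF L2_integrable[OF u u], symmetric] by simp
  show "Re (L2_inner A h V \<psi> p u u) \<ge> 0"
    unfolding e by (rule integral_nonneg_AE, rule AE_I2)
      (use u form_inner_self(1)[of p u] in \<open>auto simp: L2_iff\<close>)
qed

lemma L2_inner_self_eq_0:
  assumes u: "u \<in> L2 A h V \<psi> p" and 0: "Re (L2_inner A h V \<psi> p u u) = 0"
  shows "AE x in V. \<forall>c\<in>A. x \<in> cdom c \<longrightarrow> (\<forall>J\<in>multi_idx p. u c (cmap c x) J = 0)"
proof -
  note u' = u[unfolded L2_iff]
  have p0: "p0_form A p u" using u' by blast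
  have "AE x in V. Re (form_inner A h p u u x) * exp (- \<psi> x) = 0"
  proof (rule iffD1[OF integral_nonneg_eq_0_iff_AE])
    show "integrable V (\<lambda>x. Re (form_inner A h p u u x) * exp (- \<psi> x))" using u' by blast
    show "AE x in V. 0 \<le> Re (form_inner A h p u u x) * exp (- \<psi> x)"
      using form_inner_self(1)[OF p0] by (intro AE_I2) simp
    show "(LINT x|V. Re (form_inner A h p u u x) * exp (- \<psi> x)) = 0"
      using 0 unfolding Re_L2_inner_self(1)[OF u] .
  qed
  then show ?thesis
  proof (rule AE_mp, intro AE_I2 impI ballI)
    fix x c and J :: "'n list"
    assume "Re (form_inner A h p u u x) * exp (- \<psi> x) = 0" and c: "c \<in> A" "x \<in> cdom c" and J: "J \<in> multi_idx p"
    then have "Re (form_inner A h p u u x) = 0" by simp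
    then have "form_inner A h p u u x = 0" using form_inner_self(2)[OF p0, of x] by (metis of_real_0)
    from form_inner_eq_0D[OF p0 this c] show "u c (cmap c x) J = 0" using J by (simp add: multi_idx_def)
  qed
qed

text \<open>Holomorphy comes from the formula, square integrability from \<open>\<zeta>\<close>,
  which agrees with it almost everywhere.\<close>

lemma contract_A2:
  assumes D: "(\<eta>, \<zeta>) \<in> D_star A h V \<psi> p" and \<eta>: "holomorphic_form A (Suc p) \<eta>"
    and X: "dbar_sharp_holomorphic A h \<psi>"
  shows "contract \<eta> \<in> A2 A h V \<psi> p"
proof -
  have hc: "holomorphic_form A p (contract \<eta>)" by (rule holomorphic_contract[OF X \<eta>])
  have "\<zeta> \<in> L2 A h V \<psi> p" using D unfolding D_star_def hilbert_adjoint_def by auto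
  then have "contract \<eta> \<in> L2 A h V \<psi> p"
    by (rule L2_eq_L2[OF adjoint_eq_contract[OF D \<eta> X]])
      (use hc holomorphic_coeff_measurable in \<open>auto simp: holomorphic_form_def\<close>)
  then show ?thesis using hc unfolding A2_def by blast
qed

lemma del_op_subset_D_op: "del_op A h V \<psi> p \<subseteq> D_op A h V \<psi> p"
proof
  fix uf assume "uf \<in> del_op A h V \<psi> p"
  then obtain u where uf: "uf = (u, del u)" and u: "u \<in> A2 A h V \<psi> p" and d: "del u \<in> A2 A h V \<psi> (Suc p)"
    unfolding del_op_def by auto
  have "weak_del A p u (del u)"
    by (rule weak_del_C1) (use u in \<open>auto simp: A2_def intro: holomorphic_C1\<close>)
  then show "uf \<in> D_op A h V \<psi> p"
    using u d unfolding uf D_op_def A2_def by blast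
qed

text \<open>The adjoint relation survives restriction to \<open>del_op\<close>; replacing
  \<open>\<zeta>\<close> by its holomorphic representative puts the value into the Bergman space, as
  \<open>del_star\<close> demands.\<close>

lemma contract_del_star:
  assumes D: "(\<eta>, \<zeta>) \<in> D_star A h V \<psi> p" and \<eta>: "\<eta> \<in> A2 A h V \<psi> (Suc p)"
    and X: "dbar_sharp_holomorphic A h \<psi>"
  shows "(\<eta>, contract \<eta>) \<in> del_star A h V \<psi> p"
proof -
  have h\<eta>: "holomorphic_form A (Suc p) \<eta>" using \<eta> unfolding A2_def by blast
  have \<zeta>L: "\<zeta> \<in> L2 A h V \<psi> p"
    and adj: "\<And>u f. (u, f) \<in> D_op A h V \<psi> p \<Longrightarrow> L2_inner A h V \<psi> (Suc p) f \<eta> = L2_inner A h V \<psi> p u \<zeta>"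
    using D unfolding D_star_def hilbert_adjoint_def by auto
  have cA: "contract \<eta> \<in> A2 A h V \<psi> p" by (rule contract_A2[OF D h\<eta> X])
  have "L2_inner A h V \<psi> (Suc p) f \<eta> = L2_inner A h V \<psi> p u (contract \<eta>)" if uf: "(u, f) \<in> del_op A h V \<psi> p" for u f
  proof -
    have "(u, f) \<in> D_op A h V \<psi> p" using uf del_op_subset_D_op by blast
    moreover from this have "u \<in> L2 A h V \<psi> p" unfolding D_op_def by blast
    ultimately show ?thesis
      using adj L2_eq_inner[OF adjoint_eq_contract[OF D h\<eta> X] _ \<zeta>L, of u] cA unfolding A2_def by simp
  qed
  then show ?thesis using \<eta> cA unfolding del_star_def hilbert_adjoint_def by blast
qed

text \<open>The difference \<open>v\<close> is orthogonal to every \<open>u\<close> in the dense domain, hence \<open>\<parallel>v\<parallel> \<le> \<parallel>v - u\<parallel>\<close>, where the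
  right-hand side is arbitrarily small.\<close>

lemma del_star_unique:
  assumes dense: "del_densely_defined A h V \<psi> p"
    and 1: "(\<eta>, \<xi>) \<in> del_star A h V \<psi> p" and 2: "(\<eta>, \<xi>') \<in> del_star A h V \<psi> p"
  shows "L2_eq A V p \<xi> \<xi>'"
proof -
  define v where "v = (\<lambda>c z J. \<xi> c z J - \<xi>' c z J)"
  have \<xi>: "\<xi> \<in> A2 A h V \<psi> p" "\<xi>' \<in> A2 A h V \<psi> p"
    and adj: "\<And>u f. (u, f) \<in> del_op A h V \<psi> p \<Longrightarrow> L2_inner A h V \<psi> p u \<xi> = L2_inner A h V \<psi> p u \<xi>'"
    using 1 2 unfolding del_star_def hilbert_adjoint_def by fastforce+
  have L: "\<xi> \<in> L2 A h V \<psi> p" "\<xi>' \<in> L2 A h V \<psi> p" using \<xi> unfolding A2_def by blast+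
  have vL: "v \<in> L2 A h V \<psi> p" unfolding v_def by (rule L2_diff[OF L])
  \<comment> \<open>Density speaks of elements of the Bergman space, so the difference itself has to
    be holomorphic.\<close>
  have vA: "v \<in> A2 A h V \<psi> p"
  proof -
    have "holo_on (cimg c) (\<lambda>z. v c z J)" if "c \<in> A" "J \<in> multi_idx p" for c J
    proof -
      have "holo_on (cimg c) (\<lambda>z. \<xi> c z J + -1 * \<xi>' c z J)"
        using \<xi> that unfolding A2_def holomorphic_form_def by (intro holo_on_add holo_on_mult holo_on_const) auto
      then show ?thesis by (simp add: v_def)
    qed
    then show ?thesis using vL unfolding A2_def holomorphic_form_def L2_iff by blast
  qed
  have small: "sqrt (Re (L2_inner A h V \<psi> p v v)) < e" if e: "e > 0" for e
  proof -
    obtain u where u: "u \<in> Domain (del_op A h V \<psi> p)" "L2_norm A h V \<psi> p (\<lambda>c z J. v c z J - u c z J) < e"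
      using dense vA e unfolding del_densely_defined_def by blast
    then obtain f where uf: "(u, f) \<in> del_op A h V \<psi> p" by blast
    then have uL: "u \<in> L2 A h V \<psi> p" unfolding del_op_def A2_def by blast
    have uv: "L2_inner A h V \<psi> p u v = 0"
      unfolding v_def L2_inner_diff_right[OF uL L] using adj[OF uf] by simp
    have vu: "L2_inner A h V \<psi> p v u = 0"
      using L2_inner_hermitian[OF uL vL] uv by simp
    have "L2_inner A h V \<psi> p (\<lambda>c z J. v c z J - u c z J) (\<lambda>c z J. v c z J - u c z J) =
        L2_inner A h V \<psi> p v v + L2_inner A h V \<psi> p u u"
      by (simp add: L2_inner_diff_left[OF L2_diff[OF vL uL] vL uL] L2_inner_diff_right[OF vL vL uL]
          L2_inner_diff_right[OF uL vL uL] uv vu)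
    then have "Re (L2_inner A h V \<psi> p v v) \<le>
        Re (L2_inner A h V \<psi> p (\<lambda>c z J. v c z J - u c z J) (\<lambda>c z J. v c z J - u c z J))"
      using Re_L2_inner_self(2)[OF uL] by simp
    then show ?thesis using u(2) unfolding L2_norm_def by (meson le_less_trans real_sqrt_le_mono)
  qed
  have "Re (L2_inner A h V \<psi> p v v) = 0"
  proof (rule ccontr)
    assume "Re (L2_inner A h V \<psi> p v v) \<noteq> 0"
    then have "sqrt (Re (L2_inner A h V \<psi> p v v)) > 0" using Re_L2_inner_self(2)[OF vL] by simp
    from small[OF this] show False by simp
  qed
  from L2_inner_self_eq_0[OF vL this] show ?thesis
    unfolding L2_eq_def v_def by simp
qed

lemma L2_eq_trans:
  assumes "L2_eq A V p u v" "L2_eq A V p v w"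
  shows "L2_eq A V p u w"
  using assms unfolding L2_eq_def
proof eventually_elim
  case (elim x)
  then show ?case by metis
qed

end

theorem theorem1p1:
  fixes A :: "('a::{t2_space,second_countable_topology}, 'n::finite) chart set"
    and h :: "('a, 'n) metric"
    and V :: "'a measure"
    and \<psi> :: "'a \<Rightarrow> real"
    and p :: nat
  assumes "complete_kaehler_manifold A h"
    and "is_dvol A h V"
    and "smooth_fun A \<psi>"
    and "p \<le> CARD('n) - 1"
    and "del_densely_defined A h V \<psi> p"
    and "dbar_sharp_holomorphic A h \<psi>"
  shows "(\<forall>\<eta> \<in> Domain (D_star A h V \<psi> p) \<inter> A2 A h V \<psi> (Suc p).
           \<eta> \<in> Domain (del_star A h V \<psi> p) \<and>
           (\<forall>\<zeta> \<xi>. (\<eta>, \<zeta>) \<in> D_star A h V \<psi> p \<and> (\<eta>, \<xi>) \<in> del_star A h V \<psi> p \<longrightarrow>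
              L2_eq A V p \<zeta> \<xi>)) \<and>
         (\<forall>\<eta> \<in> Domain (D_star A h V \<psi> p). holomorphic_form A (Suc p) \<eta> \<longrightarrow>
           (\<forall>\<zeta>. (\<eta>, \<zeta>) \<in> D_star A h V \<psi> p \<longrightarrow>
              (\<exists>\<zeta>' \<in> A2 A h V \<psi> p. L2_eq A V p \<zeta> \<zeta>')))"
proof -
  interpret kaehler_setup A h V \<psi>
    using assms(1-3) unfolding complete_kaehler_manifold_def by unfold_locales blast+
  note X = assms(6)
  show ?thesis
  proof (intro conjI ballI allI impI)
    fix \<eta> assume "\<eta> \<in> Domain (D_star A h V \<psi> p) \<inter> A2 A h V \<psi> (Suc p)"
    then obtain \<zeta> where "(\<eta>, \<zeta>) \<in> D_star A h V \<psi> p" "\<eta> \<in> A2 A h V \<psi> (Suc p)" by blast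
    from contract_del_star[OF this X] show "\<eta> \<in> Domain (del_star A h V \<psi> p)" by blast
  next
    fix \<eta> \<zeta> \<xi>
    assume "\<eta> \<in> Domain (D_star A h V \<psi> p) \<inter> A2 A h V \<psi> (Suc p)"
      and "(\<eta>, \<zeta>) \<in> D_star A h V \<psi> p \<and> (\<eta>, \<xi>) \<in> del_star A h V \<psi> p"
    then have \<eta>: "\<eta> \<in> A2 A h V \<psi> (Suc p)" and D: "(\<eta>, \<zeta>) \<in> D_star A h V \<psi> p"
      and d: "(\<eta>, \<xi>) \<in> del_star A h V \<psi> p" by blast+
    have "holomorphic_form A (Suc p) \<eta>" using \<eta> unfolding A2_def by blast
    then show "L2_eq A V p \<zeta> \<xi>"
      by (rule L2_eq_trans[OF adjoint_eq_contract[OF D _ X] del_star_unique[OF assms(5) contract_del_star[OF D \<eta> X] d]])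
  next
    fix \<eta> \<zeta> assume "holomorphic_form A (Suc p) \<eta>" "(\<eta>, \<zeta>) \<in> D_star A h V \<psi> p"
    \<comment> \<open>The holomorphic representative is \<open>contract \<eta>\<close>; the square
      integrability of \<open>\<eta>\<close> is contained in \<open>D_star\<close>.\<close>
    then show "\<exists>\<zeta>'\<in>A2 A h V \<psi> p. L2_eq A V p \<zeta> \<zeta>'"
      using contract_A2 adjoint_eq_contract X by blast
  qed
qed

end
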